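(* Let $C=\mathcal{C}_\mu(R,\sigma,t)$ be a regular, $\mu$-consistent TGWC of rank $m$ and $A=\mathcal{A}_\mu(R,\sigma,t)$ the corresponding TGWA. Let $\nu\in M_m(k^\times)$ and let $C'=\mathcal{C}_\nu(R,\sigma,t)$, $A'=\mathcal{A}_\nu(R,\sigma,t)$. Then $C'\cong{}^{\chi}C$ (respectively $A'\cong{}^{\chi}\!A$) for some admissible twisting homomorphism $\chi$ of $C$ if and only if $\nu_{ij}\nu_{ji}=\mu_{ij}\mu_{ji}$ for all $i\neq j$.
   Context: $k$ is a field; algebras are unital $k$-algebras; $\cong$ denotes isomorphism of algebras; $[m]=\{1,\dots,m\}$; $Z(R)$ is the center of $R$; $\mathbf e_i$ is the $i$-th standard basis vector; $\mathrm{Aut}_k$ denotes $k$-algebra automorphisms. A twisted generalized Weyl datum (TGWD) of rank $m$ is a triple $(R,\sigma,t)$ with $R$ an algebra, $\sigma=(\sigma_1,\dots,\sigma_m)$ commuting automorphisms of $R$, and $t=(t_1,\dots,t_m)\in Z(R)^m$. For $\mu=(\mu_{ij})\in M_m(k^\times)$, the twisted generalized Weyl construction (TGWC) $\mathcal{C}_\mu(R,\sigma,t)$ is the algebra generated over $R$ by $X_1^{\pm},\dots,X_m^{\pm}$ (the canonical generators) with relations $X_i^{\pm}r=\sigma_i^{\pm1}(r)X_i^{\pm}$, $X_i^-X_i^+=t_i$, $X_i^+X_i^-=\sigma_i(t_i)$ for $r\in R$, $i\in[m]$, and $X_i^+X_j^-=\mu_{ij}X_j^-X_i^+$ for $i\ne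 j$. It is $\mathbb Z^m$-graded by $\deg r=\mathbf 0$, $\deg X_i^{\pm}=\pm\mathbf e_i$. The twisted generalized Weyl algebra (TGWA) is $\mathcal{A}_\mu(R,\sigma,t)=\mathcal{C}_\mu(R,\sigma,t)/\mathcal J$, where $\mathcal J$ is the sum of all graded ideals $J$ with $J_{\mathbf 0}=\{0\}$. The datum is regular if every $t_i$ is a regular element (non-zero-divisor) of $R$, and $\mu$-consistent if the canonical map $R\to\mathcal{A}_\mu(R,\sigma,t)$ is injective; a TGWC is regular (resp. $\mu$-consistent) if its datum is. An admissible twisting homomorphism of $C$ is a group homomorphism $\chi:\mathbb Z^m\to\mathrm{Aut}_k(C)$, $\alpha\mapsto\chi_\alpha$, with every $\chi_\alpha$ a graded automorphism, such that $\chi_{\mathbf e_i}(X_j^{\pm})=q_{ij}^{(+,\pm)}X_j^{\pm}$ and $\chi_{-\mathbf e_i}(X_j^{\pm})=q_{ij}^{(-,\pm)}X_j^{\pm}$ for some scalars $q_{ij}^{(\pm,\pm)}\in k^\times$ ($i,j\in[m]$). The graded twist ${}^{\chi}C$ is $C$ as a vector space with multiplication $a\star b=\chi_\beta(a)b$ for $a\in C_\alpha$, $b\in C_\beta$. The $\chi_\alpha$ descend to graded automorphisms of $A$, and ${}^{\chi}\!A$ is defined in the same way.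
   Formalization: The isomorphisms are taken to be isomorphisms of Z^m-graded algebras and R is assumed nonzero; with ungraded algebra isomorphisms, or for R = 0, the "only if" direction is false. *)

theory Defs
  imports
    "HOL-Algebra.QuotRing"
    "HOL-Algebra.Module"
    "HOL-Analysis.Finite_Cartesian_Product"
    "HOL-Library.Poly_Mapping"
begin

section \<open>Algebras over a field\<close>

text \<open>
  The locale \<^locale>\<open>algebra\<close> of HOL-Algebra is restricted to commutative algebras. Here the
  algebras are unital, associative, not necessarily commutative, and the ground field is a type.
\<close>

locale k_algebra = ring A for A :: "('k::field, 'a) module" (structure) +
  assumes smult_closed: "x \<in> carrier A \<Longrightarrow> c \<odot> x \<in> carrier A"
    and smult_l_distr: "x \<in> carrier A \<Longrightarrow> (c + d) \<odot> x = c \<odot> x \<oplus> d \<odot> x"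
    and smult_r_distr: "x \<in> carrier A \<Longrightarrow> y \<in> carrier A \<Longrightarrow> c \<odot> (x \<oplus> y) = c \<odot> x \<oplus> c \<odot> y"
    and smult_assoc: "x \<in> carrier A \<Longrightarrow> (c * d) \<odot> x = c \<odot> (d \<odot> x)"
    and smult_one: "x \<in> carrier A \<Longrightarrow> 1 \<odot> x = x"
    and smult_mult_left:
      "x \<in> carrier A \<Longrightarrow> y \<in> carrier A \<Longrightarrow> (c \<odot> x) \<otimes> y = c \<odot> (x \<otimes> y)"
    and smult_mult_right:
      "x \<in> carrier A \<Longrightarrow> y \<in> carrier A \<Longrightarrow> x \<otimes> (c \<odot> y) = c \<odot> (x \<otimes> y)"

definition alg_iso :: "('k::field, 'a) module \<Rightarrow> ('k, 'b) module \<Rightarrow> ('a \<Rightarrow> 'b) set" where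
  "alg_iso A B =
     {h \<in> ring_iso A B. \<forall>c. \<forall>x \<in> carrier A. h (c \<odot>\<^bsub>A\<^esub> x) = c \<odot>\<^bsub>B\<^esub> h x}"

definition ring_center :: "('a, 'e) ring_scheme \<Rightarrow> 'a set" where
  "ring_center A = {z \<in> carrier A. \<forall>x \<in> carrier A. z \<otimes>\<^bsub>A\<^esub> x = x \<otimes>\<^bsub>A\<^esub> z}"

definition regular_element :: "('a, 'e) ring_scheme \<Rightarrow> 'a \<Rightarrow> bool" where
  "regular_element A z \<longleftrightarrow> z \<in> carrier A \<and>
     (\<forall>x \<in> carrier A. (z \<otimes>\<^bsub>A\<^esub> x = \<zero>\<^bsub>A\<^esub> \<longrightarrow> x = \<zero>\<^bsub>A\<^esub>) \<and>
                      (x \<otimes>\<^bsub>A\<^esub> z = \<zero>\<^bsub>A\<^esub> \<longrightarrow> x = \<zero>\<^bsub>A\<^esub>))"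

text \<open>The quotient ring \<^const>\<open>FactRing\<close>, with the scalar multiplication induced on cosets.\<close>

definition quot_alg :: "('k::field, 'a) module \<Rightarrow> 'a set \<Rightarrow> ('k, 'a set) module" where
  "quot_alg A I =
     \<lparr>carrier = carrier (A Quot I), mult = mult (A Quot I), one = one (A Quot I),
      zero = zero (A Quot I), add = add (A Quot I),
      smult = (\<lambda>c X. \<Union>x\<in>X. I +>\<^bsub>A\<^esub> (c \<odot>\<^bsub>A\<^esub> x))\<rparr>"


section \<open>Free algebras\<close>

text \<open>
  With concatenation of words as addition, the convolution product that the library puts on
  finitely supported functions makes \<open>'g list \<Rightarrow>\<^sub>0 'k\<close> the free algebra on \<open>'g\<close>. The scalar \<open>c\<close>
  is \<open>Poly_Mapping.single [] c\<close>, supported on the empty word.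
\<close>

instantiation list :: (type) monoid_add
begin

definition zero_list :: "'a list" where "zero_list = []"

definition plus_list :: "'a list \<Rightarrow> 'a list \<Rightarrow> 'a list" where "plus_list = append"

instance
  by standard (simp_all add: zero_list_def plus_list_def)

end

definition free_algebra :: "'g set \<Rightarrow> ('k::field, 'g list \<Rightarrow>\<^sub>0 'k) module" where
  "free_algebra G =
     \<lparr>carrier = {f. \<forall>w \<in> Poly_Mapping.keys f. set w \<subseteq> G}, mult = (*), one = 1, zero = 0, add = (+),
      smult = (\<lambda>c f. Poly_Mapping.single [] c * f)\<rparr>"

definition letter :: "'g \<Rightarrow> 'g list \<Rightarrow>\<^sub>0 'k::field" where
  "letter g = Poly_Mapping.single [g] 1"


section \<open>Graded algebras and graded twists\<close>

text \<open>
  A grading of \<open>A\<close> is given by its family \<open>gr\<close> of homogeneous components. The following is the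
  family of homogeneous components of an element; the description is unique when \<open>A\<close> is
  the direct sum of the \<open>gr \<alpha>\<close>.
\<close>

definition hom_comps :: "('k::field, 'a) module \<Rightarrow> ('g \<Rightarrow> 'a set) \<Rightarrow> 'a \<Rightarrow> 'g \<Rightarrow> 'a" where
  "hom_comps A gr x =
     (THE c. (\<forall>\<alpha>. c \<alpha> \<in> gr \<alpha>) \<and> finite {\<alpha>. c \<alpha> \<noteq> \<zero>\<^bsub>A\<^esub>} \<and>
             x = (\<Oplus>\<^bsub>A\<^esub>\<alpha>\<in>{\<alpha>. c \<alpha> \<noteq> \<zero>\<^bsub>A\<^esub>}. c \<alpha>))"

definition graded_ideal :: "('k::field, 'a) module \<Rightarrow> ('g \<Rightarrow> 'a set) \<Rightarrow> 'a set \<Rightarrow> bool" where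
  "graded_ideal A gr J \<longleftrightarrow> ideal J A \<and> (\<forall>x \<in> J. \<forall>\<alpha>. hom_comps A gr x \<alpha> \<in> J)"

definition graded_iso ::
  "('k::field, 'a) module \<Rightarrow> ('g \<Rightarrow> 'a set) \<Rightarrow> ('k, 'b) module \<Rightarrow> ('g \<Rightarrow> 'b set) \<Rightarrow> ('a \<Rightarrow> 'b) set"
where
  "graded_iso A gr B gr' = {h \<in> alg_iso A B. \<forall>\<alpha>. h ` gr \<alpha> = gr' \<alpha>}"

definition graded_isomorphic ::
  "('k::field, 'a) module \<Rightarrow> ('g \<Rightarrow> 'a set) \<Rightarrow> ('k, 'b) module \<Rightarrow> ('g \<Rightarrow> 'b set) \<Rightarrow> bool"
where
  "graded_isomorphic A gr B gr' \<longleftrightarrow> graded_iso A gr B gr' \<noteq> {}"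

text \<open>
  The customary name \<open>chi\<close> of the twisting map is a binder in HOL-Analysis; here it is \<open>\<xi>\<close>.
  The rule \<open>a \<star> b = \<xi> \<beta> (a) b\<close> for \<open>b\<close> homogeneous of degree \<open>\<beta>\<close>, extended additively in \<open>b\<close>.
  (It is additive in \<open>a\<close> already, and does not involve the degree of \<open>a\<close>.)
\<close>

definition graded_twist ::
  "('k::field, 'a) module \<Rightarrow> ('g \<Rightarrow> 'a set) \<Rightarrow> ('g \<Rightarrow> 'a \<Rightarrow> 'a) \<Rightarrow> ('k, 'a) module"
where
  "graded_twist A gr \<xi> =
     A\<lparr>mult := (\<lambda>a b. \<Oplus>\<^bsub>A\<^esub>\<beta>\<in>{\<beta>. hom_comps A gr b \<beta> \<noteq> \<zero>\<^bsub>A\<^esub>}.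
                         \<xi> \<beta> a \<otimes>\<^bsub>A\<^esub> hom_comps A gr b \<beta>)\<rparr>"


section \<open>Twisted generalized Weyl constructions and algebras\<close>

text \<open>
  The rank \<open>m\<close> is the cardinality of the finite index type \<open>'n\<close>, and \<open>int ^ 'n\<close> is the grading
  group, with \<open>axis i 1\<close> as standard basis vectors. In commutativity of the automorphisms and in
  their inverses only the values on the carrier matter.
\<close>

definition tgw_datum ::
  "('k::field, 'r) module \<Rightarrow> ('n::finite \<Rightarrow> 'r \<Rightarrow> 'r) \<Rightarrow> ('n \<Rightarrow> 'r) \<Rightarrow> bool"
where
  "tgw_datum R \<sigma> t \<longleftrightarrow> k_algebra R \<and> (\<forall>i. \<sigma> i \<in> alg_iso R R) \<and>
     (\<forall>i j. \<forall>r \<in> carrier R. \<sigma> i (\<sigma> j r) = \<sigma> j (\<sigma> i r)) \<and> (\<forall>i. t i \<in> ring_center R)"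

definition regular_datum :: "('k::field, 'r) module \<Rightarrow> ('n::finite \<Rightarrow> 'r) \<Rightarrow> bool" where
  "regular_datum R t \<longleftrightarrow> (\<forall>i. regular_element R (t i))"

datatype ('r, 'n) tgw_letter = Coef 'r | Xp 'n | Xm 'n

definition tgw_letters :: "('k::field, 'r) module \<Rightarrow> ('r, 'n) tgw_letter set" where
  "tgw_letters R = Coef ` carrier R \<union> range Xp \<union> range Xm"

type_synonym ('k, 'r, 'n) tgw_free = "('r, 'n) tgw_letter list \<Rightarrow>\<^sub>0 'k"

text \<open>
  An algebra generated over \<open>R\<close> is presented by letters for the elements of \<open>R\<close> and for the
  \<open>X\<^sub>i\<^sup>\<plusminus>\<close>. The first four relations say that \<open>Coef\<close> induces a homomorphism of unital algebras from
  \<open>R\<close>; the others are the defining relations of the construction. Each element listed is set to 0.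
\<close>

inductive_set tgw_relations ::
  "('k::field, 'r) module \<Rightarrow> ('n::finite \<Rightarrow> 'r \<Rightarrow> 'r) \<Rightarrow> ('n \<Rightarrow> 'r) \<Rightarrow> 'k ^ 'n ^ 'n
    \<Rightarrow> ('k, 'r, 'n) tgw_free set"
  for R \<sigma> t \<mu>
where
  coef_add: "\<lbrakk>r \<in> carrier R; s \<in> carrier R\<rbrakk> \<Longrightarrow>
    letter (Coef (r \<oplus>\<^bsub>R\<^esub> s)) - (letter (Coef r) + letter (Coef s)) \<in> tgw_relations R \<sigma> t \<mu>"
| coef_mult: "\<lbrakk>r \<in> carrier R; s \<in> carrier R\<rbrakk> \<Longrightarrow>
    letter (Coef (r \<otimes>\<^bsub>R\<^esub> s)) - letter (Coef r) * letter (Coef s) \<in> tgw_relations R \<sigma> t \<mu>"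
| coef_one: "letter (Coef \<one>\<^bsub>R\<^esub>) - 1 \<in> tgw_relations R \<sigma> t \<mu>"
| coef_smult: "r \<in> carrier R \<Longrightarrow>
    letter (Coef (c \<odot>\<^bsub>R\<^esub> r)) - Poly_Mapping.single [] c * letter (Coef r) \<in> tgw_relations R \<sigma> t \<mu>"
| Xp_coef: "r \<in> carrier R \<Longrightarrow>
    letter (Xp i) * letter (Coef r) - letter (Coef (\<sigma> i r)) * letter (Xp i)
      \<in> tgw_relations R \<sigma> t \<mu>"
| Xm_coef: "r \<in> carrier R \<Longrightarrow>
    letter (Xm i) * letter (Coef r) - letter (Coef (inv_into (carrier R) (\<sigma> i) r)) * letter (Xm i)
      \<in> tgw_relations R \<sigma> t \<mu>"
| Xm_Xp: "letter (Xm i) * letter (Xp i) - letter (Coef (t i)) \<in> tgw_relations R \<sigma> t \<mu>"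
| Xp_Xm: "letter (Xp i) * letter (Xm i) - letter (Coef (\<sigma> i (t i))) \<in> tgw_relations R \<sigma> t \<mu>"
| Xp_Xm_swap: "i \<noteq> j \<Longrightarrow>
    letter (Xp i) * letter (Xm j) - Poly_Mapping.single [] (\<mu> $ i $ j) * letter (Xm j) * letter (Xp i)
      \<in> tgw_relations R \<sigma> t \<mu>"

definition tgwc_ideal ::
  "('k::field, 'r) module \<Rightarrow> ('n::finite \<Rightarrow> 'r \<Rightarrow> 'r) \<Rightarrow> ('n \<Rightarrow> 'r) \<Rightarrow> 'k ^ 'n ^ 'n
    \<Rightarrow> ('k, 'r, 'n) tgw_free set"
where
  "tgwc_ideal R \<sigma> t \<mu> = genideal (free_algebra (tgw_letters R)) (tgw_relations R \<sigma> t \<mu>)"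

definition tgwc ::
  "('k::field, 'r) module \<Rightarrow> ('n::finite \<Rightarrow> 'r \<Rightarrow> 'r) \<Rightarrow> ('n \<Rightarrow> 'r) \<Rightarrow> 'k ^ 'n ^ 'n
    \<Rightarrow> ('k, ('k, 'r, 'n) tgw_free set) module"
where
  "tgwc R \<sigma> t \<mu> = quot_alg (free_algebra (tgw_letters R)) (tgwc_ideal R \<sigma> t \<mu>)"

definition tgwc_proj ::
  "('k::field, 'r) module \<Rightarrow> ('n::finite \<Rightarrow> 'r \<Rightarrow> 'r) \<Rightarrow> ('n \<Rightarrow> 'r) \<Rightarrow> 'k ^ 'n ^ 'n
    \<Rightarrow> ('k, 'r, 'n) tgw_free \<Rightarrow> ('k, 'r, 'n) tgw_free set"
where
  "tgwc_proj R \<sigma> t \<mu> f = tgwc_ideal R \<sigma> t \<mu> +>\<^bsub>free_algebra (tgw_letters R)\<^esub> f"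

fun letter_degree :: "('r, 'n::finite) tgw_letter \<Rightarrow> int ^ 'n" where
  "letter_degree (Coef r) = 0"
| "letter_degree (Xp i) = axis i 1"
| "letter_degree (Xm i) = - axis i 1"

definition word_degree :: "('r, 'n::finite) tgw_letter list \<Rightarrow> int ^ 'n" where
  "word_degree w = sum_list (map letter_degree w)"

definition tgwc_part ::
  "('k::field, 'r) module \<Rightarrow> ('n::finite \<Rightarrow> 'r \<Rightarrow> 'r) \<Rightarrow> ('n \<Rightarrow> 'r) \<Rightarrow> 'k ^ 'n ^ 'n
    \<Rightarrow> int ^ 'n \<Rightarrow> ('k, 'r, 'n) tgw_free set set"
where
  "tgwc_part R \<sigma> t \<mu> \<alpha> =
     tgwc_proj R \<sigma> t \<mu> ` {f \<in> carrier (free_algebra (tgw_letters R)).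
                              \<forall>w \<in> Poly_Mapping.keys f. word_degree w = \<alpha>}"

text \<open>The sum of a family of ideals is the ideal generated by their union.\<close>

definition tgwa_ideal ::
  "('k::field, 'r) module \<Rightarrow> ('n::finite \<Rightarrow> 'r \<Rightarrow> 'r) \<Rightarrow> ('n \<Rightarrow> 'r) \<Rightarrow> 'k ^ 'n ^ 'n
    \<Rightarrow> ('k, 'r, 'n) tgw_free set set"
where
  "tgwa_ideal R \<sigma> t \<mu> =
     genideal (tgwc R \<sigma> t \<mu>)
       (\<Union>{J. graded_ideal (tgwc R \<sigma> t \<mu>) (tgwc_part R \<sigma> t \<mu>) J \<and>
             J \<inter> tgwc_part R \<sigma> t \<mu> 0 = {\<zero>\<^bsub>tgwc R \<sigma> t \<mu>\<^esub>}})"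

definition tgwa ::
  "('k::field, 'r) module \<Rightarrow> ('n::finite \<Rightarrow> 'r \<Rightarrow> 'r) \<Rightarrow> ('n \<Rightarrow> 'r) \<Rightarrow> 'k ^ 'n ^ 'n
    \<Rightarrow> ('k, ('k, 'r, 'n) tgw_free set set) module"
where
  "tgwa R \<sigma> t \<mu> = quot_alg (tgwc R \<sigma> t \<mu>) (tgwa_ideal R \<sigma> t \<mu>)"

definition tgwa_proj ::
  "('k::field, 'r) module \<Rightarrow> ('n::finite \<Rightarrow> 'r \<Rightarrow> 'r) \<Rightarrow> ('n \<Rightarrow> 'r) \<Rightarrow> 'k ^ 'n ^ 'n
    \<Rightarrow> ('k, 'r, 'n) tgw_free set \<Rightarrow> ('k, 'r, 'n) tgw_free set set"
where
  "tgwa_proj R \<sigma> t \<mu> x = tgwa_ideal R \<sigma> t \<mu> +>\<^bsub>tgwc R \<sigma> t \<mu>\<^esub> x"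

definition tgwa_part ::
  "('k::field, 'r) module \<Rightarrow> ('n::finite \<Rightarrow> 'r \<Rightarrow> 'r) \<Rightarrow> ('n \<Rightarrow> 'r) \<Rightarrow> 'k ^ 'n ^ 'n
    \<Rightarrow> int ^ 'n \<Rightarrow> ('k, 'r, 'n) tgw_free set set set"
where
  "tgwa_part R \<sigma> t \<mu> \<alpha> = tgwa_proj R \<sigma> t \<mu> ` tgwc_part R \<sigma> t \<mu> \<alpha>"

definition consistent_datum ::
  "('k::field, 'r) module \<Rightarrow> ('n::finite \<Rightarrow> 'r \<Rightarrow> 'r) \<Rightarrow> ('n \<Rightarrow> 'r) \<Rightarrow> 'k ^ 'n ^ 'n \<Rightarrow> bool"
where
  "consistent_datum R \<sigma> t \<mu> \<longleftrightarrow>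
     inj_on (\<lambda>r. tgwa_proj R \<sigma> t \<mu> (tgwc_proj R \<sigma> t \<mu> (letter (Coef r)))) (carrier R)"


section \<open>Admissible twisting homomorphisms\<close>

text \<open>
  A scalar \<open>qpm $ i $ j\<close> below is \<open>q\<^sub>i\<^sub>j\<close> with superscript \<open>(+,-)\<close>, and similarly for the other three.
\<close>

definition admissible_twisting ::
  "('k::field, 'r) module \<Rightarrow> ('n::finite \<Rightarrow> 'r \<Rightarrow> 'r) \<Rightarrow> ('n \<Rightarrow> 'r) \<Rightarrow> 'k ^ 'n ^ 'n
    \<Rightarrow> (int ^ 'n \<Rightarrow> ('k, 'r, 'n) tgw_free set \<Rightarrow> ('k, 'r, 'n) tgw_free set) \<Rightarrow> bool"
where
  "admissible_twisting R \<sigma> t \<mu> \<xi> \<longleftrightarrow>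
     (let C = tgwc R \<sigma> t \<mu>; gr = tgwc_part R \<sigma> t \<mu>;
          xp = (\<lambda>j. tgwc_proj R \<sigma> t \<mu> (letter (Xp j)));
          xm = (\<lambda>j. tgwc_proj R \<sigma> t \<mu> (letter (Xm j)))
      in (\<forall>\<alpha>. \<xi> \<alpha> \<in> graded_iso C gr C gr) \<and>
         (\<forall>\<alpha> \<beta>. \<forall>x \<in> carrier C. \<xi> (\<alpha> + \<beta>) x = \<xi> \<alpha> (\<xi> \<beta> x)) \<and>
         (\<exists>qpp qpm qmp qmm :: 'k ^ 'n ^ 'n. \<forall>i j.
            qpp $ i $ j \<noteq> 0 \<and> qpm $ i $ j \<noteq> 0 \<and> qmp $ i $ j \<noteq> 0 \<and> qmm $ i $ j \<noteq> 0 \<and>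
            \<xi> (axis i 1) (xp j) = qpp $ i $ j \<odot>\<^bsub>C\<^esub> xp j \<and>
            \<xi> (axis i 1) (xm j) = qpm $ i $ j \<odot>\<^bsub>C\<^esub> xm j \<and>
            \<xi> (- axis i 1) (xp j) = qmp $ i $ j \<odot>\<^bsub>C\<^esub> xp j \<and>
            \<xi> (- axis i 1) (xm j) = qmm $ i $ j \<odot>\<^bsub>C\<^esub> xm j))"

text \<open>
  Elements of \<open>A\<close> are cosets in \<open>C\<close>, so a map of \<open>C\<close> that descends to \<open>A\<close> does so by taking images.
\<close>

definition descended_twisting :: "('g \<Rightarrow> 'c \<Rightarrow> 'c) \<Rightarrow> 'g \<Rightarrow> 'c set \<Rightarrow> 'c set" where
  "descended_twisting \<xi> \<alpha> X = \<xi> \<alpha> ` X"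

definition twisted_tgwc ::
  "('k::field, 'r) module \<Rightarrow> ('n::finite \<Rightarrow> 'r \<Rightarrow> 'r) \<Rightarrow> ('n \<Rightarrow> 'r) \<Rightarrow> 'k ^ 'n ^ 'n
    \<Rightarrow> (int ^ 'n \<Rightarrow> ('k, 'r, 'n) tgw_free set \<Rightarrow> ('k, 'r, 'n) tgw_free set)
    \<Rightarrow> ('k, ('k, 'r, 'n) tgw_free set) module"
where
  "twisted_tgwc R \<sigma> t \<mu> \<xi> = graded_twist (tgwc R \<sigma> t \<mu>) (tgwc_part R \<sigma> t \<mu>) \<xi>"

definition twisted_tgwa ::
  "('k::field, 'r) module \<Rightarrow> ('n::finite \<Rightarrow> 'r \<Rightarrow> 'r) \<Rightarrow> ('n \<Rightarrow> 'r) \<Rightarrow> 'k ^ 'n ^ 'n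
    \<Rightarrow> (int ^ 'n \<Rightarrow> ('k, 'r, 'n) tgw_free set \<Rightarrow> ('k, 'r, 'n) tgw_free set)
    \<Rightarrow> ('k, ('k, 'r, 'n) tgw_free set set) module"
where
  "twisted_tgwa R \<sigma> t \<mu> \<xi> =
     graded_twist (tgwa R \<sigma> t \<mu>) (tgwa_part R \<sigma> t \<mu>) (descended_twisting \<xi>)"

end

theory Submission
  imports Defs
begin

text \<open>
  The three statements -- \<open>C'\<close> is a twist of \<open>C\<close>, \<open>A'\<close> is a twist of \<open>A\<close>, the products
  \<open>\<nu>\<^sub>i\<^sub>j \<nu>\<^sub>j\<^sub>i\<close> and \<open>\<mu>\<^sub>i\<^sub>j \<mu>\<^sub>j\<^sub>i\<close> agree -- are proved equivalent in a cycle.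

  If the products agree, then \<open>\<nu>\<^sub>i\<^sub>j / \<mu>\<^sub>i\<^sub>j\<close> and \<open>\<nu>\<^sub>j\<^sub>i / \<mu>\<^sub>j\<^sub>i\<close> are inverse to each other. So
  there is a bicharacter \<open>b\<close> of the grading group with \<open>\<nu>\<^sub>i\<^sub>j b(e\<^sub>j, e\<^sub>i) = \<mu>\<^sub>i\<^sub>j b(e\<^sub>i, e\<^sub>j)\<close>: order the
  indices and let \<open>b(e\<^sub>i, e\<^sub>j)\<close> be \<open>\<nu>\<^sub>i\<^sub>j / \<mu>\<^sub>i\<^sub>j\<close> for \<open>i\<close> before \<open>j\<close> and 1 otherwise. Let \<open>\<xi>\<^sub>\<alpha>\<close>
  multiply the component of degree \<open>\<beta>\<close> by \<open>b(\<alpha>, \<beta>)\<close>. Already on the free algebra \<open>F\<close>, the linear map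
  that rescales every word by a suitable product of values of \<open>b\<close> is an isomorphism from \<open>F\<close> onto
  its twist by \<open>\<xi>\<close> (\<open>twist_factor_graded_iso\<close>). It sends every defining relation for \<open>\<nu>\<close> to a
  multiple of the one for \<open>\<mu>\<close>, hence one ideal of relations onto the other
  (\<open>twist_factor_ideal\<close>), and so induces the isomorphism wanted (\<open>twisted_iso_exists\<close>).

  The ideal \<open>\<J>\<close> that is divided out to obtain \<open>A\<close> consists of the elements \<open>x\<close> with \<open>a x\<^sub>\<gamma> b = 0\<close> for all
  homogeneous \<open>a\<close>, \<open>b\<close> and all components \<open>x\<^sub>\<gamma>\<close> such that the product has degree 0
  (\<open>genideal_graded_radical\<close>). A twist changes such products only by applying bijections to them
  and to their factors \<open>a\<close> and \<open>b\<close>, so any isomorphism \<open>C' \<cong> \<^sup>\<xi>C\<close> maps one such ideal onto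
  the other and descends to \<open>A' \<cong> \<^sup>\<xi>A\<close> (\<open>tgwa_twisted_iso\<close>).

  Finally, let \<open>A' \<cong> \<^sup>\<xi>A\<close>. For \<open>i \<noteq> j\<close>, computing \<open>X\<^sub>i\<^sup>- X\<^sub>j\<^sup>+ X\<^sub>i\<^sup>+ X\<^sub>j\<^sup>-\<close> in two ways gives
  \<open>\<sigma>\<^sub>j(t\<^sub>i t\<^sub>j) = \<mu>\<^sub>i\<^sub>j \<mu>\<^sub>j\<^sub>i \<sigma>\<^sub>i\<^sup>-\<^sup>1(\<sigma>\<^sub>j(t\<^sub>j)) t\<^sub>i\<close> in the image of \<open>R\<close> in \<open>A\<close>, hence in \<open>R\<close>, as the datum is
  \<open>\<mu>\<close>-consistent. In the image of \<open>R\<close> in \<open>A'\<close> the same equation holds also with \<open>\<nu>\<close> in place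
  of \<open>\<mu>\<close>. If the two scalars differ, then \<open>X\<^sub>i\<^sup>- X\<^sub>j\<^sup>+ X\<^sub>i\<^sup>+ X\<^sub>j\<^sup>- = 0\<close> in \<open>A'\<close>. The components of
  degrees \<open>\<plusminus>e\<^sub>i\<close> of \<open>A'\<close> are generated over \<open>R\<close> by \<open>X\<^sub>i\<^sup>\<plusminus>\<close> (\<open>part_axis\<close>), so all products of four
  elements of degrees \<open>-e\<^sub>i, e\<^sub>j, e\<^sub>i, -e\<^sub>j\<close> vanish in \<open>A'\<close>. This property is invariant under twisted
  isomorphism, whereas the product of generators in \<open>A\<close> is \<open>\<mu>\<^sub>i\<^sub>j \<sigma>\<^sub>i\<^sup>-\<^sup>1(\<sigma>\<^sub>j(t\<^sub>j)) t\<^sub>i\<close>, which is not zero as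
  the datum is regular.
\<close>

section \<open>Algebras and their quotients\<close>

context k_algebra
begin

lemma smult_one_mult:
  assumes "x \<in> carrier A"
  shows "(c \<odot> \<one>) \<otimes> x = c \<odot> x"
  using assms by (simp add: smult_mult_left)

lemma smult_zero_right: "c \<odot> \<zero> = \<zero>"
  using smult_one_mult[of \<zero> c] smult_closed[of \<one> c] by simp

lemma smult_zero_left:
  assumes "x \<in> carrier A"
  shows "0 \<odot> x = \<zero>"
proof -
  have "0 \<odot> x \<oplus> 0 \<odot> x = 0 \<odot> x"
    using smult_l_distr[OF assms, of 0 0] by simp
  then show ?thesis
    using smult_closed[OF assms] by (metis add.l_cancel_one' r_zero zero_closed)
qed

lemma smult_minus_one:
  assumes "x \<in> carrier A"
  shows "(- 1) \<odot> x = \<ominus> x"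
proof -
  have "(- 1) \<odot> x \<oplus> x = \<zero>"
    using smult_l_distr[OF assms, of "- 1" 1] assms by (simp add: smult_one smult_zero_left)
  then show ?thesis
    using assms smult_closed by (simp add: minus_equality)
qed

lemma smult_cancel:
  assumes "x \<in> carrier A" "c \<odot> x = \<zero>" "c \<noteq> 0"
  shows "x = \<zero>"
proof -
  have "x = (inverse c * c) \<odot> x"
    using assms by (simp add: smult_one)
  also have "\<dots> = inverse c \<odot> (c \<odot> x)"
    using assms(1) by (rule smult_assoc)
  finally show ?thesis
    using assms by (simp add: smult_zero_right)
qed

lemma ideal_smult_closed:
  assumes "ideal I A" "x \<in> I"
  shows "c \<odot> x \<in> I"
proof -
  interpret I: ideal I A by fact
  have "(c \<odot> \<one>) \<otimes> x \<in> I"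
    using assms by (intro I.I_l_closed smult_closed) auto
  then show ?thesis
    using assms by (simp add: smult_one_mult)
qed

text \<open>
  Negation is multiplication by \<open>\<ominus> \<one>\<close>, so closure under sums is all that remains of the
  subgroup condition.
\<close>

lemma ideal_criterion:
  assumes "I \<subseteq> carrier A" "\<zero> \<in> I"
    and "\<And>x y. x \<in> I \<Longrightarrow> y \<in> I \<Longrightarrow> x \<oplus> y \<in> I"
    and l: "\<And>a x. a \<in> carrier A \<Longrightarrow> x \<in> I \<Longrightarrow> a \<otimes> x \<in> I"
    and r: "\<And>a x. a \<in> carrier A \<Longrightarrow> x \<in> I \<Longrightarrow> x \<otimes> a \<in> I"
  shows "ideal I A"
proof (rule idealI)
  have "\<ominus> x \<in> I" if "x \<in> I" for x
  proof -
    have "(\<ominus> \<one>) \<otimes> x \<in> I"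
      using l[OF _ that] by simp
    then show ?thesis
      using that assms(1) by (auto simp: l_minus)
  qed
  then show "subgroup I (add_monoid A)"
    using assms by (intro add.subgroupI) (auto simp: a_inv_def)
qed (use assms ring_axioms in auto)

end

locale quotient_algebra = k_algebra A + ideal I A for A :: "('k::field, 'a) module" (structure) and I
begin

lemma coset_carrier: "carrier (quot_alg A I) = (\<lambda>x. I +> x) ` carrier A"
  by (auto simp: quot_alg_def FactRing_def A_RCOSETS_def RCOSETS_def a_r_coset_def)

lemma coset_closed: "x \<in> carrier A \<Longrightarrow> I +> x \<in> carrier (quot_alg A I)"
  by (simp add: coset_carrier)

lemma coset_cases:
  assumes "X \<in> carrier (quot_alg A I)"
  obtains x where "x \<in> carrier A" "X = I +> x"
  using assms by (auto simp: coset_carrier)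

lemma coset_zero: "\<zero>\<^bsub>quot_alg A I\<^esub> = I +> \<zero>"
  using a_rcos_zero[OF ideal_axioms additive_subgroup.zero_closed[OF is_additive_subgroup]]
  by (simp add: quot_alg_def FactRing_def)

lemma coset_one: "\<one>\<^bsub>quot_alg A I\<^esub> = I +> \<one>"
  by (simp add: quot_alg_def FactRing_def)

lemma coset_add:
  "x \<in> carrier A \<Longrightarrow> y \<in> carrier A \<Longrightarrow> (I +> x) \<oplus>\<^bsub>quot_alg A I\<^esub> (I +> y) = I +> (x \<oplus> y)"
  by (simp add: quot_alg_def FactRing_def a_rcos_sum)

lemma coset_mult:
  "x \<in> carrier A \<Longrightarrow> y \<in> carrier A \<Longrightarrow> (I +> x) \<otimes>\<^bsub>quot_alg A I\<^esub> (I +> y) = I +> (x \<otimes> y)"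
  by (simp add: quot_alg_def FactRing_def rcoset_mult_add)

lemma coset_eq_iff:
  assumes "x \<in> carrier A" "y \<in> carrier A"
  shows "I +> x = I +> y \<longleftrightarrow> x \<ominus> y \<in> I"
  using quotient_eq_iff_same_a_r_cos[OF ideal_axioms assms] by simp

lemma coset_eq_zero_iff:
  assumes "x \<in> carrier A"
  shows "I +> x = \<zero>\<^bsub>quot_alg A I\<^esub> \<longleftrightarrow> x \<in> I"
  using coset_eq_iff[of x \<zero>] assms by (simp add: coset_zero minus_eq)

lemma coset_smult:
  assumes "x \<in> carrier A"
  shows "c \<odot>\<^bsub>quot_alg A I\<^esub> (I +> x) = I +> (c \<odot> x)"
proof -
  have const: "I +> (c \<odot> y) = I +> (c \<odot> x)" if "y \<in> I +> x" for y
  proof -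
    from that obtain z where z: "z \<in> I" "y = z \<oplus> x"
      by (auto simp: a_r_coset_def')
    then have zc: "z \<in> carrier A" by (simp add: Icarr)
    have "c \<odot> y = c \<odot> z \<oplus> c \<odot> x"
      using z zc assms by (simp add: smult_r_distr)
    then have "c \<odot> y \<ominus> c \<odot> x = c \<odot> z"
      using smult_closed[OF zc] smult_closed[OF assms]
      by (simp add: minus_eq a_assoc r_neg)
    moreover have "c \<odot> z \<in> I" by (rule ideal_smult_closed[OF ideal_axioms z(1)])
    ultimately show ?thesis
      using z zc assms by (subst coset_eq_iff) (simp_all add: smult_closed)
  qed
  have "I +> x \<noteq> {}"
    by (metis a_rcos_self[OF assms] empty_iff)
  then have "(\<Union>y\<in>I +> x. I +> (c \<odot> y)) = I +> (c \<odot> x)"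
    by (rule SUP_eq_const[OF _ const])
  then show ?thesis
    by (simp add: quot_alg_def)
qed

lemmas coset_simps = coset_zero coset_one coset_add coset_mult coset_smult

lemma quotient_k_algebra: "k_algebra (quot_alg A I)"
proof -
  have ring: "ring (quot_alg A I)"
  proof (rule ringI)
    show "abelian_group (quot_alg A I)"
    proof (rule abelian_groupI)
      fix X assume "X \<in> carrier (quot_alg A I)"
      then obtain x where "x \<in> carrier A" "X = I +> x"
        by (rule coset_cases)
      then show "\<exists>Y\<in>carrier (quot_alg A I). Y \<oplus>\<^bsub>quot_alg A I\<^esub> X = \<zero>\<^bsub>quot_alg A I\<^esub>"
        by (intro bexI[of _ "I +> (\<ominus> x)"]) (simp_all add: coset_closed coset_simps l_neg)
    qed (auto elim!: coset_cases simp: coset_closed coset_simps a_ac)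
    show "Group.monoid (quot_alg A I)"
      by (rule monoidI) (auto elim!: coset_cases simp: coset_closed coset_simps m_assoc)
  qed (auto elim!: coset_cases simp: coset_simps l_distr r_distr)
  show ?thesis
    by (intro k_algebra.intro ring k_algebra_axioms.intro; elim coset_cases)
      (simp_all add: coset_closed coset_simps smult_closed smult_l_distr smult_r_distr smult_assoc
        smult_one smult_mult_left smult_mult_right)
qed

text \<open>Elements of quotients are cosets, so the maps induced on quotients are images of sets.\<close>

lemma image_coset:
  assumes "\<And>x y. x \<in> carrier A \<Longrightarrow> y \<in> carrier A \<Longrightarrow> h (x \<oplus> y) = h x \<oplus>\<^bsub>B\<^esub> h y"
    and "h ` I = J" "x \<in> carrier A"
  shows "h ` (I +> x) = J +>\<^bsub>B\<^esub> h x"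
proof -
  have "h ` (I +> x) = (\<lambda>i. h (i \<oplus> x)) ` I"
    by (auto simp: a_r_coset_def')
  also have "\<dots> = (\<lambda>i. h i \<oplus>\<^bsub>B\<^esub> h x) ` I"
    using assms(1,3) by (intro image_cong) (auto intro: Icarr)
  also have "\<dots> = J +>\<^bsub>B\<^esub> h x"
    unfolding assms(2)[symmetric] by (auto simp: a_r_coset_def')
  finally show ?thesis .
qed

end


section \<open>Graded algebras\<close>

text \<open>
  The last two conditions say that \<open>A\<close> is the direct sum of the \<open>gr \<alpha>\<close>. They are what makes
  the description in \<^const>\<open>hom_comps\<close> have exactly one solution.
\<close>

locale graded_algebra = k_algebra A for A :: "('k::field, 'a) module" (structure) +
  fixes gr :: "'g::ab_group_add \<Rightarrow> 'a set"
  assumes part_closed: "x \<in> gr \<alpha> \<Longrightarrow> x \<in> carrier A"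
    and part_zero: "\<zero> \<in> gr \<alpha>"
    and part_add: "x \<in> gr \<alpha> \<Longrightarrow> y \<in> gr \<alpha> \<Longrightarrow> x \<oplus> y \<in> gr \<alpha>"
    and part_smult: "x \<in> gr \<alpha> \<Longrightarrow> c \<odot> x \<in> gr \<alpha>"
    and part_mult: "x \<in> gr \<alpha> \<Longrightarrow> y \<in> gr \<beta> \<Longrightarrow> x \<otimes> y \<in> gr (\<alpha> + \<beta>)"
    and part_one: "\<one> \<in> gr 0"
    and decomposition:
      "x \<in> carrier A \<Longrightarrow> \<exists>S f. finite S \<and> (\<forall>\<alpha>. f \<alpha> \<in> gr \<alpha>) \<and> x = (\<Oplus>\<alpha>\<in>S. f \<alpha>)"
    and independence:
      "finite S \<Longrightarrow> (\<And>\<alpha>. f \<alpha> \<in> gr \<alpha>) \<Longrightarrow> (\<Oplus>\<alpha>\<in>S. f \<alpha>) = \<zero> \<Longrightarrow> \<alpha> \<in> S \<Longrightarrow> f \<alpha> = \<zero>"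
begin

abbreviation comp :: "'a \<Rightarrow> 'g \<Rightarrow> 'a" where
  "comp \<equiv> hom_comps A gr"

lemma part_minus: "x \<in> gr \<alpha> \<Longrightarrow> \<ominus> x \<in> gr \<alpha>"
  using part_smult[of x \<alpha> "- 1"] by (simp add: smult_minus_one part_closed)

lemma finsum_support:
  assumes "finite S" "\<And>\<alpha>. \<alpha> \<notin> S \<Longrightarrow> f \<alpha> = \<zero>" "\<And>\<alpha>. f \<alpha> \<in> carrier A"
  shows "(\<Oplus>\<alpha>\<in>{\<alpha>. f \<alpha> \<noteq> \<zero>}. f \<alpha>) = (\<Oplus>\<alpha>\<in>S. f \<alpha>)"
  using assms by (intro add.finprod_mono_neutral_cong_left) auto

lemma comps_unique:
  assumes "finite S" "\<And>\<alpha>. c \<alpha> \<in> gr \<alpha>" "\<And>\<alpha>. \<alpha> \<notin> S \<Longrightarrow> c \<alpha> = \<zero>" "x = (\<Oplus>\<alpha>\<in>S. c \<alpha>)"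
  shows "comp x = c"
  unfolding hom_comps_def
proof (rule the_equality)
  have cc: "c \<alpha> \<in> carrier A" for \<alpha>
    using assms(2) part_closed by blast
  have "finite {\<alpha>. c \<alpha> \<noteq> \<zero>}"
    using assms(3) by (intro finite_subset[OF _ assms(1)]) auto
  then show "(\<forall>\<alpha>. c \<alpha> \<in> gr \<alpha>) \<and> finite {\<alpha>. c \<alpha> \<noteq> \<zero>} \<and> x = (\<Oplus>\<alpha>\<in>{\<alpha>. c \<alpha> \<noteq> \<zero>}. c \<alpha>)"
    using assms cc finsum_support[of S c] by simp
next
  fix d
  assume d: "(\<forall>\<alpha>. d \<alpha> \<in> gr \<alpha>) \<and> finite {\<alpha>. d \<alpha> \<noteq> \<zero>} \<and> x = (\<Oplus>\<alpha>\<in>{\<alpha>. d \<alpha> \<noteq> \<zero>}. d \<alpha>)"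
  define T where "T = S \<union> {\<alpha>. d \<alpha> \<noteq> \<zero>}"
  have T: "finite T" using assms(1) d by (simp add: T_def)
  have cc: "c \<alpha> \<in> carrier A" and dc: "d \<alpha> \<in> carrier A" for \<alpha>
    using assms(2) d part_closed by blast+
  have xc: "x = (\<Oplus>\<alpha>\<in>T. c \<alpha>)"
    unfolding assms(4) by (rule add.finprod_mono_neutral_cong_left) (use assms T cc in \<open>auto simp: T_def\<close>)
  have xd: "x = (\<Oplus>\<alpha>\<in>T. d \<alpha>)"
  proof -
    have "(\<Oplus>\<alpha>\<in>{\<alpha>. d \<alpha> \<noteq> \<zero>}. d \<alpha>) = (\<Oplus>\<alpha>\<in>T. d \<alpha>)"
      by (rule finsum_support[OF T]) (use dc in \<open>auto simp: T_def\<close>)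
    then show ?thesis using d by simp
  qed
  have minus: "(\<Oplus>\<alpha>\<in>T. \<ominus> c \<alpha>) = \<ominus> (\<Oplus>\<alpha>\<in>T. c \<alpha>)"
    using T by (induction T rule: finite_induct) (auto simp: finsum_insert finsum_empty cc minus_add finsum_closed)
  have "(\<Oplus>\<alpha>\<in>T. d \<alpha> \<oplus> \<ominus> c \<alpha>) = x \<oplus> \<ominus> x"
    using cc dc by (subst finsum_addf) (auto simp: minus xc[symmetric] xd[symmetric])
  moreover have "x \<in> carrier A" unfolding xc using cc by (intro finsum_closed) auto
  ultimately have zero: "(\<Oplus>\<alpha>\<in>T. d \<alpha> \<oplus> \<ominus> c \<alpha>) = \<zero>"
    by (simp add: r_neg)
  show "d = c"
  proof
    fix \<alpha>
    show "d \<alpha> = c \<alpha>"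
    proof (cases "\<alpha> \<in> T")
      case True
      have "d \<alpha> \<oplus> \<ominus> c \<alpha> = \<zero>"
        by (rule independence[OF T _ zero True]) (use assms(2) d part_add part_minus in blast)
      then show ?thesis
        using cc dc using add.inv_solve_right[of "\<zero>" "d \<alpha>" "c \<alpha>"] by simp
    next
      case False
      then show ?thesis using assms(3) by (auto simp: T_def)
    qed
  qed
qed

lemma
  assumes "x \<in> carrier A"
  shows comp_part: "comp x \<alpha> \<in> gr \<alpha>"
    and comp_finite: "finite {\<alpha>. comp x \<alpha> \<noteq> \<zero>}"
    and comp_sum: "(\<Oplus>\<alpha>\<in>{\<alpha>. comp x \<alpha> \<noteq> \<zero>}. comp x \<alpha>) = x"
proof -
  obtain S f where f: "finite S" "\<And>\<alpha>. f \<alpha> \<in> gr \<alpha>" "x = (\<Oplus>\<alpha>\<in>S. f \<alpha>)"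
    using decomposition[OF assms] by blast
  define c where "c = (\<lambda>\<alpha>. if \<alpha> \<in> S then f \<alpha> else \<zero>)"
  have cg: "c \<alpha> \<in> gr \<alpha>" for \<alpha>
    using f part_zero by (simp add: c_def)
  then have cc: "c \<alpha> \<in> carrier A" for \<alpha>
    using part_closed by blast
  have xc: "x = (\<Oplus>\<alpha>\<in>S. c \<alpha>)"
    unfolding f(3) using part_closed[OF f(2)] by (intro finsum_cong') (auto simp: c_def)
  have c: "comp x = c"
    by (rule comps_unique[OF f(1) cg _ xc]) (simp add: c_def)
  show "comp x \<alpha> \<in> gr \<alpha>" by (simp add: c cg)
  show "finite {\<alpha>. comp x \<alpha> \<noteq> \<zero>}"
    unfolding c by (rule finite_subset[OF _ f(1)]) (auto simp: c_def)
  show "(\<Oplus>\<alpha>\<in>{\<alpha>. comp x \<alpha> \<noteq> \<zero>}. comp x \<alpha>) = x"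
    unfolding c using finsum_support[OF f(1) _ cc] xc by (simp add: c_def)
qed

lemma comp_closed: "x \<in> carrier A \<Longrightarrow> comp x \<alpha> \<in> carrier A"
  using comp_part part_closed by blast

lemma comp_homogeneous:
  assumes "x \<in> gr \<alpha>"
  shows "comp x \<beta> = (if \<beta> = \<alpha> then x else \<zero>)"
proof -
  have "comp x = (\<lambda>\<beta>. if \<beta> = \<alpha> then x else \<zero>)"
    using assms part_closed[OF assms] part_zero
    by (intro comps_unique[of "{\<alpha>}"]) (simp_all add: finsum_insert finsum_empty)
  then show ?thesis by simp
qed

lemma comp_sum_superset:
  assumes "x \<in> carrier A" "finite S" "{\<alpha>. comp x \<alpha> \<noteq> \<zero>} \<subseteq> S"
  shows "(\<Oplus>\<alpha>\<in>S. comp x \<alpha>) = x"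
proof -
  have "(\<Oplus>\<alpha>\<in>{\<alpha>. comp x \<alpha> \<noteq> \<zero>}. comp x \<alpha>) = (\<Oplus>\<alpha>\<in>S. comp x \<alpha>)"
    using assms by (intro finsum_support comp_closed) auto
  then show ?thesis by (simp add: comp_sum[OF assms(1)])
qed

lemma comp_add:
  assumes "x \<in> carrier A" "y \<in> carrier A"
  shows "comp (x \<oplus> y) \<alpha> = comp x \<alpha> \<oplus> comp y \<alpha>"
proof -
  let ?S = "{\<alpha>. comp x \<alpha> \<noteq> \<zero>} \<union> {\<alpha>. comp y \<alpha> \<noteq> \<zero>}"
  have S: "finite ?S" using comp_finite assms by blast
  have "comp (x \<oplus> y) = (\<lambda>\<alpha>. comp x \<alpha> \<oplus> comp y \<alpha>)"
  proof (rule comps_unique[OF S])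
    show "x \<oplus> y = (\<Oplus>\<alpha>\<in>?S. comp x \<alpha> \<oplus> comp y \<alpha>)"
      using assms comp_closed S by (subst finsum_addf) (auto simp: comp_sum_superset)
  qed (use assms comp_part part_add in auto)
  then show ?thesis by simp
qed

lemma comp_zero: "comp \<zero> \<alpha> = \<zero>"
  using comp_homogeneous[OF part_zero] by simp

lemma graded_ideal_induct [consumes 2, case_names zero homogeneous add]:
  assumes "graded_ideal A gr J" "x \<in> J"
    and "P \<zero>"
    and hom: "\<And>\<alpha> y. y \<in> J \<Longrightarrow> y \<in> gr \<alpha> \<Longrightarrow> P y"
    and add: "\<And>y z. y \<in> J \<Longrightarrow> z \<in> J \<Longrightarrow> P y \<Longrightarrow> P z \<Longrightarrow> P (y \<oplus> z)"
  shows "P x"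
proof -
  interpret J: ideal J A using assms(1) by (simp add: graded_ideal_def)
  have x: "x \<in> carrier A" using assms(2) by (rule J.Icarr)
  have cJ: "comp x \<alpha> \<in> J" for \<alpha>
    using assms by (simp add: graded_ideal_def)
  have "(\<Oplus>\<alpha>\<in>S. comp x \<alpha>) \<in> J \<and> P (\<Oplus>\<alpha>\<in>S. comp x \<alpha>)" if "finite S" for S
    using that
  proof (induction S rule: finite_induct)
    case empty
    then show ?case using assms(3) by (simp add: finsum_empty)
  next
    case (insert \<beta> S)
    then have "(\<Oplus>\<alpha>\<in>insert \<beta> S. comp x \<alpha>) = comp x \<beta> \<oplus> (\<Oplus>\<alpha>\<in>S. comp x \<alpha>)"
      using comp_closed[OF x] by (simp add: finsum_insert)
    moreover have "P (comp x \<beta>)"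
      using hom[OF cJ] comp_part[OF x] by blast
    ultimately show ?case
      using insert add[OF cJ] cJ J.a_closed by auto
  qed
  from this[OF comp_finite[OF x]] show ?thesis
    by (simp add: comp_sum[OF x])
qed

lemma homogeneous_induct [consumes 1, case_names zero homogeneous add]:
  assumes "x \<in> carrier A"
    and "P \<zero>"
    and "\<And>\<alpha> y. y \<in> gr \<alpha> \<Longrightarrow> P y"
    and "\<And>y z. y \<in> carrier A \<Longrightarrow> z \<in> carrier A \<Longrightarrow> P y \<Longrightarrow> P z \<Longrightarrow> P (y \<oplus> z)"
  shows "P x"
proof -
  have "graded_ideal A gr (carrier A)"
    using oneideal comp_closed by (simp add: graded_ideal_def)
  from this assms show ?thesis
    by (induction rule: graded_ideal_induct) auto
qed

text \<open>
  Both sides are additive in \<open>x\<close>. The formula is used to see that sets of elements defined by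
  conditions on components are ideals.
\<close>

lemma comp_mult_left:
  assumes "a \<in> gr \<delta>" "x \<in> carrier A"
  shows "comp (a \<otimes> x) (\<delta> + \<gamma>) = a \<otimes> comp x \<gamma>"
  using assms(2)
proof (induction x rule: homogeneous_induct)
  case zero
  then show ?case using part_closed[OF assms(1)] by (simp add: comp_zero)
next
  case (homogeneous \<alpha> y)
  then show ?case
    using part_closed[OF assms(1)]
    by (simp add: comp_homogeneous[OF part_mult[OF assms(1) homogeneous]] comp_homogeneous)
next
  case (add y z)
  then show ?case
    using part_closed[OF assms(1)] by (simp add: r_distr comp_add comp_closed)
qed

lemma comp_mult_right:
  assumes "a \<in> gr \<delta>" "x \<in> carrier A"
  shows "comp (x \<otimes> a) (\<gamma> + \<delta>) = comp x \<gamma> \<otimes> a"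
  using assms(2)
proof (induction x rule: homogeneous_induct)
  case zero
  then show ?case using part_closed[OF assms(1)] by (simp add: comp_zero)
next
  case (homogeneous \<alpha> y)
  then show ?case
    using part_closed[OF assms(1)]
    by (simp add: comp_homogeneous[OF part_mult[OF homogeneous assms(1)]] comp_homogeneous)
next
  case (add y z)
  then show ?case
    using part_closed[OF assms(1)] by (simp add: l_distr comp_add comp_closed)
qed

text \<open>
  A general element is a sum of homogeneous ones, and membership of a product in \<open>I\<close> is additive in
  each factor.
\<close>

lemma ideal_homogeneous_criterion:
  assumes "I \<subseteq> carrier A" "\<zero> \<in> I"
    and add: "\<And>x y. x \<in> I \<Longrightarrow> y \<in> I \<Longrightarrow> x \<oplus> y \<in> I"
    and l: "\<And>\<alpha> a x. a \<in> gr \<alpha> \<Longrightarrow> x \<in> I \<Longrightarrow> a \<otimes> x \<in> I"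
    and r: "\<And>\<alpha> a x. a \<in> gr \<alpha> \<Longrightarrow> x \<in> I \<Longrightarrow> x \<otimes> a \<in> I"
  shows "ideal I A"
proof (rule ideal_criterion[OF assms(1,2) add])
  fix a x assume a: "a \<in> carrier A" and x: "x \<in> I"
  then have xc: "x \<in> carrier A" using assms(1) by blast
  from a show "a \<otimes> x \<in> I"
    by (induction a rule: homogeneous_induct) (use assms(2) xc x l in \<open>auto simp: l_distr intro!: add\<close>)
  from a show "x \<otimes> a \<in> I"
    by (induction a rule: homogeneous_induct) (use assms(2) xc x r in \<open>auto simp: r_distr intro!: add\<close>)
qed

text \<open>
  The elements of the generated ideal all of whose components lie in it form an ideal containing
  the generators.
\<close>

lemma graded_ideal_genideal:
  assumes S: "\<And>s. s \<in> S \<Longrightarrow> \<exists>\<alpha>. s \<in> gr \<alpha>"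
  shows "graded_ideal A gr (Idl S)"
proof -
  have SA: "S \<subseteq> carrier A" using S part_closed by blast
  interpret I: ideal "Idl S" A by (rule genideal_ideal[OF SA])
  define K where "K = {x \<in> Idl S. \<forall>\<alpha>. comp x \<alpha> \<in> Idl S}"
  have Kc: "x \<in> carrier A" if "x \<in> K" for x
    using that I.Icarr by (simp add: K_def)
  have "ideal K A"
  proof (rule ideal_homogeneous_criterion)
    fix \<alpha> a x assume a: "a \<in> gr \<alpha>" and x: "x \<in> K"
    have "comp (a \<otimes> x) \<gamma> \<in> Idl S" for \<gamma>
      using comp_mult_left[OF a Kc[OF x], of "\<gamma> - \<alpha>"] x part_closed[OF a]
      by (simp add: K_def I.I_l_closed)
    then show "a \<otimes> x \<in> K"
      using x part_closed[OF a] by (simp add: K_def I.I_l_closed)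
    have "comp (x \<otimes> a) \<gamma> \<in> Idl S" for \<gamma>
      using comp_mult_right[OF a Kc[OF x], of "\<gamma> - \<alpha>"] x part_closed[OF a]
      by (simp add: K_def I.I_r_closed)
    then show "x \<otimes> a \<in> K"
      using x part_closed[OF a] by (simp add: K_def I.I_r_closed)
  qed (use I.Icarr in \<open>auto simp: K_def comp_zero comp_add\<close>)
  moreover have "S \<subseteq> K"
  proof
    fix s assume s: "s \<in> S"
    then obtain \<alpha> where "s \<in> gr \<alpha>" using S by blast
    then show "s \<in> K"
      using genideal_self[OF SA] s by (auto simp: K_def comp_homogeneous)
  qed
  ultimately have "Idl S \<subseteq> K"
    by (rule genideal_minimal)
  then show ?thesis
    using I.ideal_axioms by (auto simp: graded_ideal_def K_def)
qed

end

lemma (in abelian_group) additive_finsum: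
  assumes "abelian_group B"
    and "\<And>x. x \<in> carrier G \<Longrightarrow> h x \<in> carrier B"
    and "\<And>x y. x \<in> carrier G \<Longrightarrow> y \<in> carrier G \<Longrightarrow> h (x \<oplus> y) = h x \<oplus>\<^bsub>B\<^esub> h y"
    and "h \<zero> = \<zero>\<^bsub>B\<^esub>"
    and "finite S" "\<And>s. s \<in> S \<Longrightarrow> f s \<in> carrier G"
  shows "h (\<Oplus>s\<in>S. f s) = (\<Oplus>\<^bsub>B\<^esub>s\<in>S. h (f s))"
proof -
  interpret B: abelian_group B by fact
  show ?thesis
    using assms(5,6)
  proof (induction S rule: finite_induct)
    case empty
    then show ?case using assms(4) by (simp add: finsum_empty B.finsum_empty)
  next
    case (insert s S)
    then show ?case
      using assms(2,3) by (simp add: finsum_insert B.finsum_insert finsum_closed Pi_def)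
  qed
qed

context graded_algebra
begin

text \<open>
  Both sides are additive in \<open>x\<close> and agree on homogeneous elements.
\<close>

lemma graded_map_comp:
  assumes "graded_algebra B gr'"
    and add: "\<And>x y. x \<in> carrier A \<Longrightarrow> y \<in> carrier A \<Longrightarrow> h (x \<oplus> y) = h x \<oplus>\<^bsub>B\<^esub> h y"
    and part: "\<And>\<alpha> x. x \<in> gr \<alpha> \<Longrightarrow> h x \<in> gr' \<alpha>"
    and zero: "h \<zero> = \<zero>\<^bsub>B\<^esub>"
    and "x \<in> carrier A"
  shows "hom_comps B gr' (h x) \<alpha> = h (comp x \<alpha>)"
proof -
  interpret B: graded_algebra B gr' by fact
  have closed: "h x \<in> carrier B" if "x \<in> carrier A" for x
    using that
  proof (induction x rule: homogeneous_induct)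
    case (homogeneous \<alpha> y)
    then show ?case using part B.part_closed by blast
  qed (simp_all add: zero add)
  show ?thesis
    using assms(5)
  proof (induction x rule: homogeneous_induct)
    case zero
    then show ?case by (simp add: comp_zero B.comp_zero \<open>h \<zero> = \<zero>\<^bsub>B\<^esub>\<close>)
  next
    case (homogeneous \<beta> y)
    then show ?case
      by (simp add: comp_homogeneous[OF homogeneous] B.comp_homogeneous[OF part[OF homogeneous]]
          \<open>h \<zero> = \<zero>\<^bsub>B\<^esub>\<close>)
  next
    case (add y z)
    then show ?case
      by (simp add: assms(2) comp_add B.comp_add closed comp_closed)
  qed
qed

lemma comp_finsum:
  assumes "finite S" "\<And>\<alpha>. f \<alpha> \<in> gr \<alpha>" "\<beta> \<in> S"
  shows "comp (\<Oplus>\<alpha>\<in>S. f \<alpha>) \<beta> = f \<beta>"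
proof -
  have "comp (\<Oplus>\<alpha>\<in>S. f \<alpha>) = (\<lambda>\<alpha>. if \<alpha> \<in> S then f \<alpha> else \<zero>)"
    using assms(1,2) part_closed[OF assms(2)] part_zero
    by (intro comps_unique[of S]) (auto intro!: finsum_cong')
  then show ?thesis
    using assms(3) by simp
qed

text \<open>
  Gradedness of \<open>J\<close> is needed for the independence of the images: if a sum of homogeneous
  representatives of different degrees lies in \<open>J\<close>, then so does each of them, being a component of
  the sum.
\<close>

lemma quotient_graded_algebra:
  assumes J: "graded_ideal A gr J"
  shows "graded_algebra (quot_alg A J) (\<lambda>\<alpha>. (\<lambda>x. J +> x) ` gr \<alpha>)"
proof -
  interpret J: ideal J A using J by (simp add: graded_ideal_def)
  interpret quotient_algebra A J ..
  interpret Q: k_algebra "quot_alg A J" by (rule quotient_k_algebra)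
  have finsum: "J +> (\<Oplus>\<alpha>\<in>S. f \<alpha>) = (\<Oplus>\<^bsub>quot_alg A J\<^esub>\<alpha>\<in>S. J +> f \<alpha>)"
    if "finite S" "\<And>\<alpha>. f \<alpha> \<in> gr \<alpha>" for S and f :: "'g \<Rightarrow> 'a"
    using that part_closed[OF that(2)]
    by (intro additive_finsum) (simp_all add: coset_closed coset_simps Q.abelian_group_axioms)
  show ?thesis
  proof (intro graded_algebra.intro Q.k_algebra_axioms graded_algebra_axioms.intro)
    fix X \<alpha> assume "X \<in> (\<lambda>x. J +> x) ` gr \<alpha>"
    then show "X \<in> carrier (quot_alg A J)"
      by (auto simp: part_closed intro!: coset_closed)
  next
    fix \<alpha>
    show "\<zero>\<^bsub>quot_alg A J\<^esub> \<in> (\<lambda>x. J +> x) ` gr \<alpha>"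
      unfolding coset_zero by (intro imageI part_zero)
  next
    fix X Y \<alpha> assume "X \<in> (\<lambda>x. J +> x) ` gr \<alpha>" "Y \<in> (\<lambda>x. J +> x) ` gr \<alpha>"
    then obtain x y where xy: "x \<in> gr \<alpha>" "y \<in> gr \<alpha>" and XY: "X = J +> x" "Y = J +> y"
      by blast
    show "X \<oplus>\<^bsub>quot_alg A J\<^esub> Y \<in> (\<lambda>x. J +> x) ` gr \<alpha>"
      unfolding XY coset_add[OF part_closed[OF xy(1)] part_closed[OF xy(2)]]
      by (intro imageI part_add xy)
  next
    fix X \<alpha> c assume "X \<in> (\<lambda>x. J +> x) ` gr \<alpha>"
    then obtain x where x: "x \<in> gr \<alpha>" and X: "X = J +> x"
      by blast
    show "c \<odot>\<^bsub>quot_alg A J\<^esub> X \<in> (\<lambda>x. J +> x) ` gr \<alpha>"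
      unfolding X coset_smult[OF part_closed[OF x]] by (intro imageI part_smult x)
  next
    fix X Y \<alpha> \<beta> assume "X \<in> (\<lambda>x. J +> x) ` gr \<alpha>" "Y \<in> (\<lambda>x. J +> x) ` gr \<beta>"
    then obtain x y where xy: "x \<in> gr \<alpha>" "y \<in> gr \<beta>" and XY: "X = J +> x" "Y = J +> y"
      by blast
    show "X \<otimes>\<^bsub>quot_alg A J\<^esub> Y \<in> (\<lambda>x. J +> x) ` gr (\<alpha> + \<beta>)"
      unfolding XY coset_mult[OF part_closed[OF xy(1)] part_closed[OF xy(2)]]
      by (intro imageI part_mult xy)
  next
    show "\<one>\<^bsub>quot_alg A J\<^esub> \<in> (\<lambda>x. J +> x) ` gr 0"
      unfolding coset_one by (intro imageI part_one)
  next
    fix X assume "X \<in> carrier (quot_alg A J)"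
    then obtain x where x: "x \<in> carrier A" and X: "X = J +> x"
      by (rule coset_cases)
    obtain S f where f: "finite S" "\<And>\<alpha>. f \<alpha> \<in> gr \<alpha>" "x = (\<Oplus>\<alpha>\<in>S. f \<alpha>)"
      using decomposition[OF x] by blast
    show "\<exists>S F. finite S \<and> (\<forall>\<alpha>. F \<alpha> \<in> (\<lambda>x. J +> x) ` gr \<alpha>) \<and> X = (\<Oplus>\<^bsub>quot_alg A J\<^esub>\<alpha>\<in>S. F \<alpha>)"
      by (rule exI[of _ S], rule exI[of _ "\<lambda>\<alpha>. J +> f \<alpha>"])
        (use f finsum[OF f(1,2)] in \<open>simp add: X\<close>)
  next
    fix S F \<alpha>
    assume S: "finite S" and F: "\<And>\<alpha>. F \<alpha> \<in> (\<lambda>x. J +> x) ` gr \<alpha>"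
      and sum: "(\<Oplus>\<^bsub>quot_alg A J\<^esub>\<alpha>\<in>S. F \<alpha>) = \<zero>\<^bsub>quot_alg A J\<^esub>" and \<alpha>: "\<alpha> \<in> S"
    have "\<forall>\<alpha>. \<exists>x. x \<in> gr \<alpha> \<and> F \<alpha> = J +> x"
      using F by blast
    then obtain f where f: "\<And>\<alpha>. f \<alpha> \<in> gr \<alpha>" and Ff: "\<And>\<alpha>. F \<alpha> = J +> f \<alpha>"
      by metis
    have fc: "(\<Oplus>\<alpha>\<in>S. f \<alpha>) \<in> carrier A"
      using part_closed[OF f] by (simp add: finsum_closed)
    have "J +> (\<Oplus>\<alpha>\<in>S. f \<alpha>) = \<zero>\<^bsub>quot_alg A J\<^esub>"
      using sum finsum[OF S f] by (simp add: Ff)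
    then have "(\<Oplus>\<alpha>\<in>S. f \<alpha>) \<in> J"
      by (simp add: coset_eq_zero_iff fc)
    then have "comp (\<Oplus>\<alpha>\<in>S. f \<alpha>) \<alpha> \<in> J"
      using J by (simp add: graded_ideal_def)
    then have "f \<alpha> \<in> J"
      by (simp add: comp_finsum[where f = f, OF S f \<alpha>])
    then show "F \<alpha> = \<zero>\<^bsub>quot_alg A J\<^esub>"
      by (simp add: Ff coset_eq_zero_iff part_closed[OF f])
  qed
qed

end


section \<open>Graded twists\<close>

lemma graded_twist_simps:
  "carrier (graded_twist A gr \<xi>) = carrier A" "add (graded_twist A gr \<xi>) = add A"
  "one (graded_twist A gr \<xi>) = one A" "zero (graded_twist A gr \<xi>) = zero A"
  "smult (graded_twist A gr \<xi>) = smult A"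
  by (simp_all add: graded_twist_def)

context graded_algebra
begin

abbreviation twisted_mult :: "('g \<Rightarrow> 'a \<Rightarrow> 'a) \<Rightarrow> 'a \<Rightarrow> 'a \<Rightarrow> 'a" where
  "twisted_mult \<xi> \<equiv> mult (graded_twist A gr \<xi>)"

lemma twisted_mult_superset:
  assumes "x \<in> carrier A" "y \<in> carrier A" "\<And>\<beta>. \<xi> \<beta> x \<in> carrier A"
    and "finite S" "{\<beta>. comp y \<beta> \<noteq> \<zero>} \<subseteq> S"
  shows "twisted_mult \<xi> x y = (\<Oplus>\<beta>\<in>S. \<xi> \<beta> x \<otimes> comp y \<beta>)"
proof -
  have "(\<Oplus>\<beta>\<in>{\<beta>. comp y \<beta> \<noteq> \<zero>}. \<xi> \<beta> x \<otimes> comp y \<beta>) = (\<Oplus>\<beta>\<in>S. \<xi> \<beta> x \<otimes> comp y \<beta>)"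
    by (rule add.finprod_mono_neutral_cong_left) (use assms comp_closed in auto)
  then show ?thesis
    by (simp add: graded_twist_def)
qed

lemma twisted_mult_homogeneous:
  assumes "x \<in> carrier A" "y \<in> gr \<beta>" "\<And>\<beta>. \<xi> \<beta> x \<in> carrier A"
  shows "twisted_mult \<xi> x y = \<xi> \<beta> x \<otimes> y"
proof -
  have "twisted_mult \<xi> x y = (\<Oplus>\<gamma>\<in>{\<beta>}. \<xi> \<gamma> x \<otimes> comp y \<gamma>)"
    using assms part_closed[OF assms(2)]
    by (intro twisted_mult_superset) (auto simp: comp_homogeneous[OF assms(2)])
  then show ?thesis
    using assms part_closed[OF assms(2)]
    by (simp add: comp_homogeneous[OF assms(2)] finsum_insert finsum_empty)
qed

lemma twisted_mult_add:
  assumes "x \<in> carrier A" "y \<in> carrier A" "z \<in> carrier A" "\<And>\<beta>. \<xi> \<beta> x \<in> carrier A"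
  shows "twisted_mult \<xi> x (y \<oplus> z) = twisted_mult \<xi> x y \<oplus> twisted_mult \<xi> x z"
proof -
  let ?S = "{\<beta>. comp y \<beta> \<noteq> \<zero>} \<union> {\<beta>. comp z \<beta> \<noteq> \<zero>}"
  have S: "finite ?S" using comp_finite assms by blast
  have "twisted_mult \<xi> x (y \<oplus> z) = (\<Oplus>\<beta>\<in>?S. \<xi> \<beta> x \<otimes> comp (y \<oplus> z) \<beta>)"
    by (rule twisted_mult_superset[OF _ _ _ S]) (use assms in \<open>auto simp: comp_add\<close>)
  also have "\<dots> = (\<Oplus>\<beta>\<in>?S. \<xi> \<beta> x \<otimes> comp y \<beta> \<oplus> \<xi> \<beta> x \<otimes> comp z \<beta>)"
    using assms by (intro finsum_cong') (auto simp: comp_add r_distr comp_closed)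
  also have "\<dots> = (\<Oplus>\<beta>\<in>?S. \<xi> \<beta> x \<otimes> comp y \<beta>) \<oplus> (\<Oplus>\<beta>\<in>?S. \<xi> \<beta> x \<otimes> comp z \<beta>)"
    using assms comp_closed by (intro finsum_addf) auto
  also have "(\<Oplus>\<beta>\<in>?S. \<xi> \<beta> x \<otimes> comp y \<beta>) = twisted_mult \<xi> x y"
    by (rule twisted_mult_superset[OF _ _ _ S, symmetric]) (use assms in auto)
  also have "(\<Oplus>\<beta>\<in>?S. \<xi> \<beta> x \<otimes> comp z \<beta>) = twisted_mult \<xi> x z"
    by (rule twisted_mult_superset[OF _ _ _ S, symmetric]) (use assms in auto)
  finally show ?thesis .
qed

lemma twisted_mult_zero: "twisted_mult \<xi> x \<zero> = \<zero>"
  by (simp add: graded_twist_def comp_zero finsum_empty)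

lemma twisted_mult_closed:
  assumes "x \<in> carrier A" "y \<in> carrier A" "\<And>\<beta>. \<xi> \<beta> x \<in> carrier A"
  shows "twisted_mult \<xi> x y \<in> carrier A"
  using assms comp_closed unfolding graded_twist_def by (auto intro!: finsum_closed)

end

lemma graded_isoI:
  assumes "bij_betw h (carrier A) (carrier B)"
    and "\<And>x y. x \<in> carrier A \<Longrightarrow> y \<in> carrier A \<Longrightarrow> h (x \<oplus>\<^bsub>A\<^esub> y) = h x \<oplus>\<^bsub>B\<^esub> h y"
    and "\<And>x y. x \<in> carrier A \<Longrightarrow> y \<in> carrier A \<Longrightarrow> h (x \<otimes>\<^bsub>A\<^esub> y) = h x \<otimes>\<^bsub>B\<^esub> h y"
    and "h \<one>\<^bsub>A\<^esub> = \<one>\<^bsub>B\<^esub>"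
    and "\<And>c x. x \<in> carrier A \<Longrightarrow> h (c \<odot>\<^bsub>A\<^esub> x) = c \<odot>\<^bsub>B\<^esub> h x"
    and "\<And>\<alpha>. h ` gr \<alpha> = gr' \<alpha>"
  shows "h \<in> graded_iso A gr B gr'"
  using assms bij_betwE[OF assms(1)]
  by (auto simp: graded_iso_def alg_iso_def intro!: ring_iso_memI)

lemma graded_isoD:
  assumes "h \<in> graded_iso A gr B gr'"
  shows "bij_betw h (carrier A) (carrier B)"
    and "\<And>x. x \<in> carrier A \<Longrightarrow> h x \<in> carrier B"
    and "\<And>x y. x \<in> carrier A \<Longrightarrow> y \<in> carrier A \<Longrightarrow> h (x \<oplus>\<^bsub>A\<^esub> y) = h x \<oplus>\<^bsub>B\<^esub> h y"
    and "\<And>x y. x \<in> carrier A \<Longrightarrow> y \<in> carrier A \<Longrightarrow> h (x \<otimes>\<^bsub>A\<^esub> y) = h x \<otimes>\<^bsub>B\<^esub> h y"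
    and "h \<one>\<^bsub>A\<^esub> = \<one>\<^bsub>B\<^esub>"
    and "\<And>c x. x \<in> carrier A \<Longrightarrow> h (c \<odot>\<^bsub>A\<^esub> x) = c \<odot>\<^bsub>B\<^esub> h x"
    and "\<And>\<alpha>. h ` gr \<alpha> = gr' \<alpha>"
  using assms ring_iso_memE[of h A B] by (auto simp: graded_iso_def alg_iso_def)

lemma graded_iso_zero:
  assumes "k_algebra A" "k_algebra B" and h: "h \<in> graded_iso A gr (graded_twist B gr' \<xi>) gr'"
  shows "h \<zero>\<^bsub>A\<^esub> = \<zero>\<^bsub>B\<^esub>"
proof -
  interpret A: k_algebra A by fact
  interpret B: k_algebra B by fact
  have "h (0 \<odot>\<^bsub>A\<^esub> \<zero>\<^bsub>A\<^esub>) = 0 \<odot>\<^bsub>B\<^esub> h \<zero>\<^bsub>A\<^esub>"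
    using graded_isoD(6)[OF h] by (simp add: graded_twist_simps)
  then show ?thesis
    using graded_isoD(2)[OF h, of "\<zero>\<^bsub>A\<^esub>"]
    by (simp add: graded_twist_simps A.smult_zero_right B.smult_zero_left)
qed

text \<open>
  Passage to quotients, for any multiplication on the target that the ideal respects; it is used
  for the given multiplication and for the twisted one.
\<close>

lemma quotient_graded_iso:
  assumes "quotient_algebra A I" "quotient_algebra B J"
    and part: "\<And>\<alpha> x. x \<in> gr \<alpha> \<Longrightarrow> x \<in> carrier A"
    and h: "h \<in> graded_iso A gr (B\<lparr>mult := m\<rparr>) gr'"
    and hI: "h ` I = J"
    and m: "\<And>x y. x \<in> carrier B \<Longrightarrow> y \<in> carrier B \<Longrightarrow> m x y \<in> carrier B \<and>
        m' (J +>\<^bsub>B\<^esub> x) (J +>\<^bsub>B\<^esub> y) = J +>\<^bsub>B\<^esub> m x y"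
  shows "(`) h \<in> graded_iso (quot_alg A I) (\<lambda>\<alpha>. (\<lambda>x. I +>\<^bsub>A\<^esub> x) ` gr \<alpha>)
           ((quot_alg B J)\<lparr>mult := m'\<rparr>) (\<lambda>\<alpha>. (\<lambda>x. J +>\<^bsub>B\<^esub> x) ` gr' \<alpha>)"
proof -
  interpret A: quotient_algebra A I by fact
  interpret B: quotient_algebra B J by fact
  note hD = graded_isoD[OF h, simplified]
  have coset: "h ` (I +>\<^bsub>A\<^esub> x) = J +>\<^bsub>B\<^esub> h x" if "x \<in> carrier A" for x
    by (rule A.image_coset[OF hD(3) hI that])
  show ?thesis
  proof (rule graded_isoI)
    have "inj_on ((`) h) (carrier (quot_alg A I))"
    proof (rule inj_on_subset)
      show "inj_on ((`) h) (Pow (carrier A))"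
        using hD(1) by (simp add: bij_betw_def inj_on_image_Pow)
      show "carrier (quot_alg A I) \<subseteq> Pow (carrier A)"
        using A.a_r_coset_subset_G[OF A.a_subset] by (auto elim!: A.coset_cases)
    qed
    moreover have "(`) h ` carrier (quot_alg A I) = carrier (quot_alg B J)"
    proof -
      have "(`) h ` carrier (quot_alg A I) = (\<lambda>x. J +>\<^bsub>B\<^esub> x) ` h ` carrier A"
        unfolding A.coset_carrier image_image by (rule image_cong) (simp_all add: coset)
      then show ?thesis
        using hD(1) by (simp add: B.coset_carrier bij_betw_def)
    qed
    ultimately show "bij_betw ((`) h) (carrier (quot_alg A I)) (carrier ((quot_alg B J)\<lparr>mult := m'\<rparr>))"
      by (simp add: bij_betw_def)
  next
    fix X Y assume "X \<in> carrier (quot_alg A I)" "Y \<in> carrier (quot_alg A I)"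
    then obtain x y where xy: "x \<in> carrier A" "y \<in> carrier A" "X = I +>\<^bsub>A\<^esub> x" "Y = I +>\<^bsub>A\<^esub> y"
      by (metis A.coset_cases)
    show "h ` (X \<oplus>\<^bsub>quot_alg A I\<^esub> Y) = h ` X \<oplus>\<^bsub>(quot_alg B J)\<lparr>mult := m'\<rparr>\<^esub> h ` Y"
      using xy by (simp add: A.coset_add B.coset_add coset hD)
    show "h ` (X \<otimes>\<^bsub>quot_alg A I\<^esub> Y) = h ` X \<otimes>\<^bsub>(quot_alg B J)\<lparr>mult := m'\<rparr>\<^esub> h ` Y"
      using xy m[OF hD(2)[OF xy(1)] hD(2)[OF xy(2)]] by (simp add: A.coset_mult coset hD)
  next
    show "h ` \<one>\<^bsub>quot_alg A I\<^esub> = \<one>\<^bsub>(quot_alg B J)\<lparr>mult := m'\<rparr>\<^esub>"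
      by (simp add: A.coset_one B.coset_one coset hD)
  next
    fix c X assume "X \<in> carrier (quot_alg A I)"
    then obtain x where x: "x \<in> carrier A" "X = I +>\<^bsub>A\<^esub> x"
      by (rule A.coset_cases)
    then show "h ` (c \<odot>\<^bsub>quot_alg A I\<^esub> X) = c \<odot>\<^bsub>(quot_alg B J)\<lparr>mult := m'\<rparr>\<^esub> (h ` X)"
      by (simp add: A.coset_smult B.coset_smult A.smult_closed coset hD)
  next
    fix \<alpha>
    have "(`) h ` (\<lambda>x. I +>\<^bsub>A\<^esub> x) ` gr \<alpha> = (\<lambda>x. J +>\<^bsub>B\<^esub> x) ` h ` gr \<alpha>"
      unfolding image_image by (rule image_cong) (simp_all add: coset part)
    then show "(`) h ` (\<lambda>x. I +>\<^bsub>A\<^esub> x) ` gr \<alpha> = (\<lambda>x. J +>\<^bsub>B\<^esub> x) ` gr' \<alpha>"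
      by (simp add: hD)
  qed
qed

lemma quotient_graded_automorphism:
  assumes "graded_algebra A gr" "ideal J A"
    and h: "h \<in> graded_iso A gr A gr" and hJ: "h ` J = J"
  shows "(`) h \<in> graded_iso (quot_alg A J) (\<lambda>\<alpha>. (\<lambda>x. J +>\<^bsub>A\<^esub> x) ` gr \<alpha>)
           (quot_alg A J) (\<lambda>\<alpha>. (\<lambda>x. J +>\<^bsub>A\<^esub> x) ` gr \<alpha>)"
proof -
  interpret A: graded_algebra A gr by fact
  interpret J: ideal J A by fact
  interpret quotient_algebra A J ..
  have "(`) h \<in> graded_iso (quot_alg A J) (\<lambda>\<alpha>. (\<lambda>x. J +>\<^bsub>A\<^esub> x) ` gr \<alpha>)
           ((quot_alg A J)\<lparr>mult := mult (quot_alg A J)\<rparr>) (\<lambda>\<alpha>. (\<lambda>x. J +>\<^bsub>A\<^esub> x) ` gr \<alpha>)"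
    by (rule quotient_graded_iso[where m = "mult A"])
      (use h hJ A.part_closed in \<open>auto simp: coset_mult quotient_algebra_axioms\<close>)
  then show ?thesis by simp
qed

text \<open>
  The multiplications have to be compared only for a homogeneous second factor, since the twisted
  multiplication is additive in it.
\<close>

lemma quotient_twisted_graded_iso:
  assumes "graded_algebra A gr" "graded_algebra B gr'" "ideal I A" "graded_ideal B gr' J"
    and h: "h \<in> graded_iso A gr (graded_twist B gr' \<xi>) gr'" and hI: "h ` I = J"
    and \<xi>: "\<And>\<alpha>. \<xi> \<alpha> \<in> graded_iso B gr' B gr'" and \<xi>J: "\<And>\<alpha>. \<xi> \<alpha> ` J = J"
  shows "(`) h \<in> graded_iso (quot_alg A I) (\<lambda>\<alpha>. (\<lambda>x. I +>\<^bsub>A\<^esub> x) ` gr \<alpha>)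
           (graded_twist (quot_alg B J) (\<lambda>\<alpha>. (\<lambda>x. J +>\<^bsub>B\<^esub> x) ` gr' \<alpha>) (descended_twisting \<xi>))
           (\<lambda>\<alpha>. (\<lambda>x. J +>\<^bsub>B\<^esub> x) ` gr' \<alpha>)"
proof -
  interpret A: graded_algebra A gr by fact
  interpret B: graded_algebra B gr' by fact
  interpret I: ideal I A by fact
  interpret J: ideal J B using assms(4) by (simp add: graded_ideal_def)
  interpret QA: quotient_algebra A I ..
  interpret QB: quotient_algebra B J ..
  define grJ where "grJ = (\<lambda>\<alpha>. (\<lambda>x. J +>\<^bsub>B\<^esub> x) ` gr' \<alpha>)"
  interpret Q: graded_algebra "quot_alg B J" grJ
    unfolding grJ_def by (rule B.quotient_graded_algebra[OF assms(4)])
  have \<xi>c: "\<xi> \<alpha> x \<in> carrier B" if "x \<in> carrier B" for \<alpha> x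
    using graded_isoD(2)[OF \<xi>] that .
  have desc: "descended_twisting \<xi> \<alpha> (J +>\<^bsub>B\<^esub> x) = J +>\<^bsub>B\<^esub> \<xi> \<alpha> x" if "x \<in> carrier B" for \<alpha> x
    unfolding descended_twisting_def by (rule QB.image_coset[OF graded_isoD(3)[OF \<xi>] \<xi>J that])
  have mult: "Q.twisted_mult (descended_twisting \<xi>) (J +>\<^bsub>B\<^esub> x) (J +>\<^bsub>B\<^esub> y) =
      J +>\<^bsub>B\<^esub> B.twisted_mult \<xi> x y" if x: "x \<in> carrier B" and y: "y \<in> carrier B" for x y
    using y
  proof (induction y rule: B.homogeneous_induct)
    case zero
    have "Q.twisted_mult (descended_twisting \<xi>) (J +>\<^bsub>B\<^esub> x) \<zero>\<^bsub>quot_alg B J\<^esub> = \<zero>\<^bsub>quot_alg B J\<^esub>"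
      by (rule Q.twisted_mult_zero)
    then show ?case
      by (simp add: B.twisted_mult_zero QB.coset_zero)
  next
    case (homogeneous \<alpha> y)
    have "J +>\<^bsub>B\<^esub> y \<in> grJ \<alpha>"
      using homogeneous by (simp add: grJ_def)
    then show ?case
      using x homogeneous B.part_closed[OF homogeneous]
      by (simp add: Q.twisted_mult_homogeneous B.twisted_mult_homogeneous desc \<xi>c QB.coset_closed
          QB.coset_mult)
  next
    case (add y z)
    have "Q.twisted_mult (descended_twisting \<xi>) (J +>\<^bsub>B\<^esub> x)
        ((J +>\<^bsub>B\<^esub> y) \<oplus>\<^bsub>quot_alg B J\<^esub> (J +>\<^bsub>B\<^esub> z)) =
      (J +>\<^bsub>B\<^esub> B.twisted_mult \<xi> x y) \<oplus>\<^bsub>quot_alg B J\<^esub> (J +>\<^bsub>B\<^esub> B.twisted_mult \<xi> x z)"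
      using x add by (simp add: Q.twisted_mult_add desc \<xi>c QB.coset_closed)
    then show ?case
      using x add by (simp add: QB.coset_add B.twisted_mult_add B.twisted_mult_closed \<xi>c)
  qed
  define m where "m = B.twisted_mult \<xi>"
  define m' where "m' = Q.twisted_mult (descended_twisting \<xi>)"
  have twist: "graded_twist B gr' \<xi> = B\<lparr>mult := m\<rparr>"
    "graded_twist (quot_alg B J) grJ (descended_twisting \<xi>) = (quot_alg B J)\<lparr>mult := m'\<rparr>"
    by (simp_all add: graded_twist_def m_def m'_def)
  have "(`) h \<in> graded_iso (quot_alg A I) (\<lambda>\<alpha>. (\<lambda>x. I +>\<^bsub>A\<^esub> x) ` gr \<alpha>)
      (graded_twist (quot_alg B J) grJ (descended_twisting \<xi>)) (\<lambda>\<alpha>. (\<lambda>x. J +>\<^bsub>B\<^esub> x) ` gr' \<alpha>)"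
    unfolding twist(2)
  proof (rule quotient_graded_iso)
    show "h \<in> graded_iso A gr (B\<lparr>mult := m\<rparr>) gr'"
      using h unfolding twist(1) .
    show "quotient_algebra A I" ..
    show "quotient_algebra B J" ..
    show "x \<in> carrier A" if "x \<in> gr \<alpha>" for x \<alpha>
      using that by (rule A.part_closed)
    show "h ` I = J" by fact
    show "m x y \<in> carrier B \<and> m' (J +>\<^bsub>B\<^esub> x) (J +>\<^bsub>B\<^esub> y) = J +>\<^bsub>B\<^esub> m x y"
      if "x \<in> carrier B" "y \<in> carrier B" for x y
      using that mult by (simp add: B.twisted_mult_closed \<xi>c m_def m'_def)
  qed
  then show ?thesis
    by (simp add: grJ_def)
qed

section \<open>The radical of a graded algebra\<close>

text \<open>
  The largest graded ideal that meets the component of degree 0 only in 0: the condition says that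
  the ideal generated by the component of degree \<open>- (\<alpha> + \<beta>)\<close> of \<open>x\<close> contributes nothing in degree 0.
  Unlike the description as a sum of ideals, it can be checked element by element, which is what
  comparison along a twisted isomorphism requires.
\<close>

definition graded_radical :: "('k::field, 'a) module \<Rightarrow> ('g::ab_group_add \<Rightarrow> 'a set) \<Rightarrow> 'a set" where
  "graded_radical A gr = {x \<in> carrier A. \<forall>\<alpha> \<beta>. \<forall>a \<in> gr \<alpha>. \<forall>b \<in> gr \<beta>.
     a \<otimes>\<^bsub>A\<^esub> hom_comps A gr x (- (\<alpha> + \<beta>)) \<otimes>\<^bsub>A\<^esub> b = \<zero>\<^bsub>A\<^esub>}"

context graded_algebra
begin

lemma graded_radicalD:
  assumes "x \<in> graded_radical A gr" "a \<in> gr \<alpha>" "b \<in> gr \<beta>" "\<alpha> + \<gamma> + \<beta> = 0"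
  shows "a \<otimes> comp x \<gamma> \<otimes> b = \<zero>"
proof -
  have "\<gamma> = - (\<alpha> + \<beta>)"
    using assms(4) by (metis add.commute add.left_commute add_eq_0_iff2 minus_unique)
  then show ?thesis
    using assms by (auto simp: graded_radical_def)
qed

lemma graded_radical_graded_ideal: "graded_ideal A gr (graded_radical A gr)"
proof -
  have c: "a \<in> carrier A" if "a \<in> gr \<alpha>" for a \<alpha>
    using that by (rule part_closed)
  have rc: "x \<in> carrier A" if "x \<in> graded_radical A gr" for x
    using that by (simp add: graded_radical_def)
  have "ideal (graded_radical A gr) A"
  proof (rule ideal_homogeneous_criterion)
    show "graded_radical A gr \<subseteq> carrier A"
      by (auto simp: graded_radical_def)
    show "\<zero> \<in> graded_radical A gr"
      using c by (auto simp: graded_radical_def comp_zero)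
    show "x \<oplus> y \<in> graded_radical A gr" if "x \<in> graded_radical A gr" "y \<in> graded_radical A gr" for x y
      using that c by (auto simp: graded_radical_def comp_add comp_closed r_distr l_distr)
  next
    fix \<delta> d x assume d: "d \<in> gr \<delta>" and x: "x \<in> graded_radical A gr"
    show "d \<otimes> x \<in> graded_radical A gr"
      unfolding graded_radical_def
    proof (intro CollectI conjI allI ballI)
      fix \<alpha> \<beta> a b assume a: "a \<in> gr \<alpha>" and b: "b \<in> gr \<beta>"
      have "comp (d \<otimes> x) (\<delta> + - (\<alpha> + \<delta> + \<beta>)) = d \<otimes> comp x (- (\<alpha> + \<delta> + \<beta>))"
        by (rule comp_mult_left[OF d rc[OF x]])
      moreover have "a \<otimes> d \<otimes> comp x (- (\<alpha> + \<delta> + \<beta>)) \<otimes> b = \<zero>"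
        by (rule graded_radicalD[OF x part_mult[OF a d] b]) simp
      ultimately show "a \<otimes> comp (d \<otimes> x) (- (\<alpha> + \<beta>)) \<otimes> b = \<zero>"
        using c[OF a] c[OF d] comp_closed[OF rc[OF x]] by (simp add: m_assoc algebra_simps)
    qed (use c[OF d] rc[OF x] in simp)
    show "x \<otimes> d \<in> graded_radical A gr"
      unfolding graded_radical_def
    proof (intro CollectI conjI allI ballI)
      fix \<alpha> \<beta> a b assume a: "a \<in> gr \<alpha>" and b: "b \<in> gr \<beta>"
      have "comp (x \<otimes> d) (- (\<alpha> + \<delta> + \<beta>) + \<delta>) = comp x (- (\<alpha> + \<delta> + \<beta>)) \<otimes> d"
        by (rule comp_mult_right[OF d rc[OF x]])
      moreover have "a \<otimes> comp x (- (\<alpha> + \<delta> + \<beta>)) \<otimes> (d \<otimes> b) = \<zero>"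
        by (rule graded_radicalD[OF x a part_mult[OF d b]]) simp
      ultimately show "a \<otimes> comp (x \<otimes> d) (- (\<alpha> + \<beta>)) \<otimes> b = \<zero>"
        using c[OF a] c[OF b] c[OF d] comp_closed[OF rc[OF x]] by (simp add: m_assoc algebra_simps)
    qed (use c[OF d] rc[OF x] in simp)
  qed
  moreover have "comp x \<gamma> \<in> graded_radical A gr" if x: "x \<in> graded_radical A gr" for x \<gamma>
    unfolding graded_radical_def
  proof (intro CollectI conjI allI ballI)
    fix \<alpha> \<beta> a b assume a: "a \<in> gr \<alpha>" and b: "b \<in> gr \<beta>"
    show "a \<otimes> comp (comp x \<gamma>) (- (\<alpha> + \<beta>)) \<otimes> b = \<zero>"
    proof (cases "- (\<alpha> + \<beta>) = \<gamma>")
      case True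
      then show ?thesis
        using graded_radicalD[OF x a b, of \<gamma>]
        by (simp add: comp_homogeneous[OF comp_part[OF rc[OF x]]] flip: True)
    next
      case False
      then show ?thesis
        using c[OF a] c[OF b] by (simp add: comp_homogeneous[OF comp_part[OF rc[OF x]]])
    qed
  qed (use comp_closed[OF rc[OF x]] in simp)
  ultimately show ?thesis
    by (simp add: graded_ideal_def)
qed

lemma graded_radical_part_zero: "graded_radical A gr \<inter> gr 0 = {\<zero>}"
proof -
  have "x = \<zero>" if "x \<in> graded_radical A gr" "x \<in> gr 0" for x
    using graded_radicalD[OF that(1) part_one part_one, of 0] part_closed[OF that(2)]
    by (simp add: comp_homogeneous[OF that(2)])
  moreover have "\<zero> \<in> graded_radical A gr"
    using graded_radical_graded_ideal
    by (simp add: graded_ideal_def ideal_def additive_subgroup.zero_closed)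
  ultimately show ?thesis
    using part_zero by blast
qed

text \<open>
  The product \<open>a x\<^sub>\<gamma> b\<close> in the definition of the radical lies in the ideal \<open>J\<close> and has degree 0.
\<close>

lemma graded_radical_maximal:
  assumes J: "graded_ideal A gr J" "J \<inter> gr 0 = {\<zero>}"
  shows "J \<subseteq> graded_radical A gr"
proof
  interpret J: ideal J A using J by (simp add: graded_ideal_def)
  fix x assume x: "x \<in> J"
  show "x \<in> graded_radical A gr"
    unfolding graded_radical_def
  proof (intro CollectI conjI allI ballI)
    fix \<alpha> \<beta> a b assume a: "a \<in> gr \<alpha>" and b: "b \<in> gr \<beta>"
    have "a \<otimes> comp x (- (\<alpha> + \<beta>)) \<otimes> b \<in> gr (\<alpha> + - (\<alpha> + \<beta>) + \<beta>)"
      by (intro part_mult a b comp_part J.Icarr x)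
    moreover have "a \<otimes> comp x (- (\<alpha> + \<beta>)) \<otimes> b \<in> J"
      using J(1) x part_closed[OF a] part_closed[OF b]
      by (intro J.I_l_closed J.I_r_closed) (simp_all add: graded_ideal_def)
    ultimately show "a \<otimes> comp x (- (\<alpha> + \<beta>)) \<otimes> b = \<zero>"
      using J(2) by auto
  qed (rule J.Icarr[OF x])
qed

lemma genideal_graded_radical:
  "Idl (\<Union>{J. graded_ideal A gr J \<and> J \<inter> gr 0 = {\<zero>}}) = graded_radical A gr" (is "Idl ?U = _")
proof
  have "?U \<subseteq> graded_radical A gr"
    using graded_radical_maximal by blast
  then show "Idl ?U \<subseteq> graded_radical A gr"
    using graded_radical_graded_ideal by (intro genideal_minimal) (simp_all add: graded_ideal_def)
  have "?U \<subseteq> carrier A"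
    using additive_subgroup.a_subset by (fastforce simp: graded_ideal_def ideal_def)
  then have "?U \<subseteq> Idl ?U"
    by (rule genideal_self)
  moreover have "graded_radical A gr \<subseteq> ?U"
    using graded_radical_graded_ideal graded_radical_part_zero by blast
  ultimately show "graded_radical A gr \<subseteq> Idl ?U"
    by blast
qed

end

text \<open>
  For homogeneous \<open>a\<close>, \<open>x\<close>, \<open>b\<close>, with \<open>x\<close> of degree \<open>\<gamma>\<close> and \<open>b\<close> of degree \<open>\<beta>\<close>, the image
  \<open>h (a x b) = \<xi> \<beta> (\<xi> \<gamma> (h a) h x) h b\<close> can be written as \<open>\<xi> \<beta> (\<xi> \<gamma> (h a) h x b')\<close> with
  \<open>\<xi> \<beta> b' = h b\<close>. When \<open>a\<close> and \<open>b\<close> run through the components of their degrees, so do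
  \<open>\<xi> \<gamma> (h a)\<close> and \<open>b'\<close>. Hence \<open>x\<close> and \<open>h x\<close> satisfy the condition of the radical simultaneously.
\<close>

lemma graded_radical_twisted_iso:
  assumes "graded_algebra A gr" "graded_algebra B gr'"
    and h: "h \<in> graded_iso A gr (graded_twist B gr' \<xi>) gr'"
    and \<xi>: "\<And>\<alpha>. \<xi> \<alpha> \<in> graded_iso B gr' B gr'"
  shows "h ` graded_radical A gr = graded_radical B gr'"
proof -
  interpret A: graded_algebra A gr by fact
  interpret B: graded_algebra B gr' by fact
  note hD = graded_isoD[OF h, unfolded graded_twist_simps]
  note \<xi>D = graded_isoD[OF \<xi>]
  have h0: "h \<zero>\<^bsub>A\<^esub> = \<zero>\<^bsub>B\<^esub>"
    using A.k_algebra_axioms B.k_algebra_axioms h by (rule graded_iso_zero)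
  have \<xi>0: "\<xi> \<alpha> \<zero>\<^bsub>B\<^esub> = \<zero>\<^bsub>B\<^esub>" for \<alpha>
    using \<xi>D(6)[of "\<zero>\<^bsub>B\<^esub>" \<alpha> 0] \<xi>D(2)[of "\<zero>\<^bsub>B\<^esub>"]
    by (simp add: B.smult_zero_left)
  have h_iff: "h x = \<zero>\<^bsub>B\<^esub> \<longleftrightarrow> x = \<zero>\<^bsub>A\<^esub>" if "x \<in> carrier A" for x
    using hD(1) h0 that by (auto simp: bij_betw_def dest: inj_onD[where y = "\<zero>\<^bsub>A\<^esub>"])
  have \<xi>_iff: "\<xi> \<alpha> x = \<zero>\<^bsub>B\<^esub> \<longleftrightarrow> x = \<zero>\<^bsub>B\<^esub>" if "x \<in> carrier B" for x \<alpha>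
    using \<xi>D(1)[of \<alpha>] \<xi>0[of \<alpha>] that by (auto simp: bij_betw_def dest: inj_onD[where y = "\<zero>\<^bsub>B\<^esub>"])
  have comp: "hom_comps B gr' (h x) \<gamma> = h (A.comp x \<gamma>)" if "x \<in> carrier A" for x \<gamma>
    by (rule A.graded_map_comp[OF B.graded_algebra_axioms hD(3) _ h0 that]) (use hD(7) in auto)
  have h_part: "h x \<in> gr' \<alpha>" if "x \<in> gr \<alpha>" for x \<alpha>
    using that imageI[of x "gr \<alpha>" h] by (simp add: hD(7))
  have \<xi>_part: "\<xi> \<beta> x \<in> gr' \<alpha>" if "x \<in> gr' \<alpha>" for x \<alpha> \<beta>
    using that imageI[of x "gr' \<alpha>" "\<xi> \<beta>"] by (simp add: \<xi>D(7))
  have h_surj: "\<exists>x. x \<in> gr \<alpha> \<and> h x = y" if "y \<in> gr' \<alpha>" for y \<alpha>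
    using that unfolding hD(7)[of \<alpha>, symmetric] by (auto simp: image_iff)
  have \<xi>_surj: "\<exists>x. x \<in> gr' \<alpha> \<and> \<xi> \<beta> x = y" if "y \<in> gr' \<alpha>" for y \<alpha> \<beta>
  proof -
    have "y \<in> \<xi> \<beta> ` gr' \<alpha>" using that by (simp add: \<xi>D(7))
    then show ?thesis by (auto simp: image_iff)
  qed
  have prod: "h (a \<otimes>\<^bsub>A\<^esub> x \<otimes>\<^bsub>A\<^esub> b) =
      \<xi> \<beta> (\<xi> \<gamma> (h a) \<otimes>\<^bsub>B\<^esub> h x \<otimes>\<^bsub>B\<^esub> b')"
    if "a \<in> gr \<alpha>" "x \<in> gr \<gamma>" "b \<in> gr \<beta>" "h b = \<xi> \<beta> b'" "b' \<in> gr' \<beta>" for a x b b' \<alpha> \<beta> \<gamma>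
  proof -
    have c: "a \<in> carrier A" "x \<in> carrier A" "b \<in> carrier A" "b' \<in> carrier B"
      using that A.part_closed B.part_closed by blast+
    have hp: "h x \<in> gr' \<gamma>" "h b \<in> gr' \<beta>"
      by (rule h_part[OF that(2)], rule h_part[OF that(3)])
    have "h (a \<otimes>\<^bsub>A\<^esub> x) = \<xi> \<gamma> (h a) \<otimes>\<^bsub>B\<^esub> h x"
      using c by (simp add: hD(2,4) \<xi>D(2) B.twisted_mult_homogeneous[OF _ hp(1)])
    then have "h (a \<otimes>\<^bsub>A\<^esub> x \<otimes>\<^bsub>A\<^esub> b) = \<xi> \<beta> (\<xi> \<gamma> (h a) \<otimes>\<^bsub>B\<^esub> h x) \<otimes>\<^bsub>B\<^esub> h b"
      using c by (simp add: hD(2,4) \<xi>D(2) B.twisted_mult_homogeneous[OF _ hp(2)])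
    then show ?thesis
      using c that(4) by (simp add: hD(2) \<xi>D(2,4))
  qed
  have iff: "x \<in> graded_radical A gr \<longleftrightarrow> h x \<in> graded_radical B gr'" if x: "x \<in> carrier A" for x
  proof
    assume rad: "x \<in> graded_radical A gr"
    show "h x \<in> graded_radical B gr'"
      unfolding graded_radical_def
    proof (intro CollectI conjI allI ballI)
      fix \<alpha> \<beta> a' b' assume a': "a' \<in> gr' \<alpha>" and b': "b' \<in> gr' \<beta>"
      define \<gamma> where "\<gamma> = - (\<alpha> + \<beta>)"
      obtain a'' where a'': "a'' \<in> gr' \<alpha>" "\<xi> \<gamma> a'' = a'"
        using \<xi>_surj[OF a', where \<beta> = \<gamma>] by blast
      obtain a where a: "a \<in> gr \<alpha>" "h a = a''"
        using h_surj[OF a''(1)] by blast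
      obtain b where b: "b \<in> gr \<beta>" "h b = \<xi> \<beta> b'"
        using h_surj[OF \<xi>_part[OF b', where \<beta> = \<beta>]] by blast
      have "h (a \<otimes>\<^bsub>A\<^esub> A.comp x \<gamma> \<otimes>\<^bsub>A\<^esub> b) = \<xi> \<beta> (a' \<otimes>\<^bsub>B\<^esub> h (A.comp x \<gamma>) \<otimes>\<^bsub>B\<^esub> b')"
        using prod[OF a(1) A.comp_part[OF x] b b'] a a'' by simp
      moreover have "a \<otimes>\<^bsub>A\<^esub> A.comp x \<gamma> \<otimes>\<^bsub>A\<^esub> b = \<zero>\<^bsub>A\<^esub>"
        by (rule A.graded_radicalD[OF rad a(1) b(1)]) (simp add: \<gamma>_def)
      moreover have "a' \<otimes>\<^bsub>B\<^esub> h (A.comp x \<gamma>) \<otimes>\<^bsub>B\<^esub> b' \<in> carrier B"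
        by (intro B.m_closed hD(2) A.comp_closed x B.part_closed[OF a'] B.part_closed[OF b'])
      ultimately have "a' \<otimes>\<^bsub>B\<^esub> h (A.comp x \<gamma>) \<otimes>\<^bsub>B\<^esub> b' = \<zero>\<^bsub>B\<^esub>"
        using \<xi>_iff[of "a' \<otimes>\<^bsub>B\<^esub> h (A.comp x \<gamma>) \<otimes>\<^bsub>B\<^esub> b'" \<beta>] by (simp add: h0)
      then show "a' \<otimes>\<^bsub>B\<^esub> hom_comps B gr' (h x) (- (\<alpha> + \<beta>)) \<otimes>\<^bsub>B\<^esub> b' = \<zero>\<^bsub>B\<^esub>"
        by (simp add: comp[OF x] \<gamma>_def)
    qed (rule hD(2)[OF x])
  next
    assume rad: "h x \<in> graded_radical B gr'"
    show "x \<in> graded_radical A gr"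
      unfolding graded_radical_def
    proof (intro CollectI conjI allI ballI)
      fix \<alpha> \<beta> a b assume a: "a \<in> gr \<alpha>" and b: "b \<in> gr \<beta>"
      define \<gamma> where "\<gamma> = - (\<alpha> + \<beta>)"
      have ha: "\<xi> \<gamma> (h a) \<in> gr' \<alpha>"
        by (rule \<xi>_part[OF h_part[OF a]])
      obtain b' where b': "b' \<in> gr' \<beta>" "\<xi> \<beta> b' = h b"
        using \<xi>_surj[OF h_part[OF b], where \<beta> = \<beta>] by blast
      have "\<xi> \<gamma> (h a) \<otimes>\<^bsub>B\<^esub> h (A.comp x \<gamma>) \<otimes>\<^bsub>B\<^esub> b' = \<zero>\<^bsub>B\<^esub>"
        using B.graded_radicalD[OF rad ha b'(1), of \<gamma>] by (simp add: comp[OF x] \<gamma>_def)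
      then have "h (a \<otimes>\<^bsub>A\<^esub> A.comp x \<gamma> \<otimes>\<^bsub>A\<^esub> b) = \<zero>\<^bsub>B\<^esub>"
        using prod[OF a A.comp_part[OF x] b b'(2)[symmetric] b'(1)] by (simp add: \<xi>0)
      moreover have "a \<otimes>\<^bsub>A\<^esub> A.comp x \<gamma> \<otimes>\<^bsub>A\<^esub> b \<in> carrier A"
        by (intro A.m_closed A.comp_closed x A.part_closed[OF a] A.part_closed[OF b])
      ultimately show "a \<otimes>\<^bsub>A\<^esub> A.comp x (- (\<alpha> + \<beta>)) \<otimes>\<^bsub>A\<^esub> b = \<zero>\<^bsub>A\<^esub>"
        by (simp add: h_iff \<gamma>_def)
    qed (rule x)
  qed
  show ?thesis
  proof (intro equalityI subsetI)
    fix y assume "y \<in> h ` graded_radical A gr"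
    then obtain x where "x \<in> graded_radical A gr" "y = h x"
      by (rule imageE)
    then show "y \<in> graded_radical B gr'"
      using iff[of x] by (simp add: graded_radical_def)
  next
    fix y assume y: "y \<in> graded_radical B gr'"
    then have "y \<in> h ` carrier A"
      using hD(1) by (simp add: graded_radical_def bij_betw_def)
    then obtain x where "x \<in> carrier A" "y = h x"
      by (rule imageE)
    then show "y \<in> h ` graded_radical A gr"
      using iff[of x] y by simp
  qed
qed

lemma (in graded_algebra) trivial_twist:
  assumes "x \<in> carrier A" "y \<in> carrier A"
  shows "twisted_mult (\<lambda>_ x. x) x y = x \<otimes> y"
  using assms(2)
proof (induction y rule: homogeneous_induct)
  case (homogeneous \<alpha> y)
  then show ?case
    using assms(1) by (simp add: twisted_mult_homogeneous)
next
  case (add y z)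
  then show ?case
    using assms(1) twisted_mult_add[of x y z "\<lambda>_ x. x"] by (simp add: r_distr)
qed (simp add: assms(1) twisted_mult_zero)

text \<open>
  An untwisted isomorphism is an isomorphism onto the trivial twist.
\<close>

lemma (in graded_algebra) graded_radical_automorphism:
  assumes "h \<in> graded_iso A gr A gr"
  shows "h ` graded_radical A gr = graded_radical A gr"
proof (rule graded_radical_twisted_iso[OF graded_algebra_axioms graded_algebra_axioms])
  show "h \<in> graded_iso A gr (graded_twist A gr (\<lambda>_ x. x)) gr"
    using graded_isoD[OF assms] by (intro graded_isoI) (simp_all add: graded_twist_simps trivial_twist)
  show "(\<lambda>x. x) \<in> graded_iso A gr A gr"
    by (rule graded_isoI) (simp_all add: bij_betw_def)
qed

section \<open>Free algebras and diagonal operators\<close>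

lemma support_induct [consumes 1, case_names zero single add]:
  assumes "Poly_Mapping.keys f \<subseteq> W"
    and "P 0"
    and "\<And>w a. w \<in> W \<Longrightarrow> P (Poly_Mapping.single w a)"
    and "\<And>f g. Poly_Mapping.keys f \<subseteq> W \<Longrightarrow> Poly_Mapping.keys g \<subseteq> W \<Longrightarrow> P f \<Longrightarrow> P g \<Longrightarrow> P (f + g)"
  shows "P (f :: 'a \<Rightarrow>\<^sub>0 'k::comm_monoid_add)"
proof -
  let ?g = "\<lambda>S. \<Sum>w\<in>S. Poly_Mapping.single w (Poly_Mapping.lookup f w)"
  have "f = ?g (Poly_Mapping.keys f)"
    by (rule poly_mapping_eqI)
      (simp add: lookup_sum lookup_single when_def in_keys_iff)
  moreover have "Poly_Mapping.keys (?g S) \<subseteq> W \<and> P (?g S)" if "finite S" "S \<subseteq> W" for S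
    using that
  proof (induction S rule: finite_induct)
    case (insert w S)
    have "Poly_Mapping.keys (Poly_Mapping.single w (Poly_Mapping.lookup f w)) \<subseteq> W"
      using insert by simp
    then show ?case
      using insert assms(3,4) keys_add[of "Poly_Mapping.single w (Poly_Mapping.lookup f w)" "?g S"]
      by simp blast
  qed (simp add: assms(2))
  ultimately show ?thesis
    using assms(1) by (metis finite_keys)
qed

lemma free_algebra_simps:
  "\<zero>\<^bsub>free_algebra G\<^esub> = 0" "\<one>\<^bsub>free_algebra G\<^esub> = 1"
  "f \<oplus>\<^bsub>free_algebra G\<^esub> g = f + g" "f \<otimes>\<^bsub>free_algebra G\<^esub> g = f * g"
  "c \<odot>\<^bsub>free_algebra G\<^esub> f = Poly_Mapping.single [] c * f"
  "f \<in> carrier (free_algebra G) \<longleftrightarrow> Poly_Mapping.keys f \<subseteq> lists G"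
  by (auto simp: free_algebra_def)

lemma lookup_scalar_mult:
  fixes f :: "'g list \<Rightarrow>\<^sub>0 'k::field"
  shows "Poly_Mapping.lookup (Poly_Mapping.single [] c * f) w = c * Poly_Mapping.lookup f w"
proof -
  have "Poly_Mapping.single [] c * f = Poly_Mapping.map ((*) c) f"
    by (simp add: mult_map_scale_conv_mult zero_list_def)
  then show ?thesis
    by (simp add: Poly_Mapping.map.rep_eq when_def)
qed

lemma keys_mult_lists:
  fixes f g :: "'g list \<Rightarrow>\<^sub>0 'k::field"
  assumes "Poly_Mapping.keys f \<subseteq> U" "Poly_Mapping.keys g \<subseteq> V"
  shows "Poly_Mapping.keys (f * g) \<subseteq> {u @ v | u v. u \<in> U \<and> v \<in> V}"
  using keys_mult[of f g] assms by (force simp: plus_list_def)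

lemma single_Nil_1: "Poly_Mapping.single [] 1 = (1 :: 'g list \<Rightarrow>\<^sub>0 'k::field)"
  by (simp add: zero_list_def flip: single_one)

lemma single_mult:
  "Poly_Mapping.single u a * Poly_Mapping.single v b = (Poly_Mapping.single (u @ v) (a * b) :: 'g list \<Rightarrow>\<^sub>0 'k::field)"
  by (simp add: mult_single plus_list_def)

lemma free_algebra_k_algebra: "k_algebra (free_algebra G :: ('k::field, 'g list \<Rightarrow>\<^sub>0 'k) module)"
proof -
  let ?F = "free_algebra G :: ('k, 'g list \<Rightarrow>\<^sub>0 'k) module"
  have add: "f + g \<in> carrier ?F" if "f \<in> carrier ?F" "g \<in> carrier ?F" for f g
    using that keys_add[of f g] by (auto simp: free_algebra_simps)
  have mult: "f * g \<in> carrier ?F" if "f \<in> carrier ?F" "g \<in> carrier ?F" for f g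
  proof -
    have "{u @ v | u v. u \<in> lists G \<and> v \<in> lists G} \<subseteq> lists G"
      by auto
    with that keys_mult_lists[of f "lists G" g "lists G"] show ?thesis
      unfolding free_algebra_simps by (meson order_trans)
  qed
  have one: "1 \<in> carrier ?F"
    by (simp add: free_algebra_simps zero_list_def)
  have scalar: "Poly_Mapping.single [] c \<in> carrier ?F" for c
    by (simp add: free_algebra_simps)
  have comm: "f * Poly_Mapping.single [] c = Poly_Mapping.single [] c * f" for f :: "'g list \<Rightarrow>\<^sub>0 'k" and c
    by (induction f rule: support_induct[OF subset_UNIV])
      (simp_all add: single_mult mult.commute distrib_left distrib_right)
  have swap: "f * (Poly_Mapping.single [] c * g) = Poly_Mapping.single [] c * (f * g)"
    for f g :: "'g list \<Rightarrow>\<^sub>0 'k" and c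
    by (simp add: comm flip: mult.assoc)
  have scalar_mult: "Poly_Mapping.single [] (c * d) = Poly_Mapping.single [] c * (Poly_Mapping.single [] d :: 'g list \<Rightarrow>\<^sub>0 'k)"
    for c d
    by (simp add: single_mult)
  have "ring ?F"
  proof (rule ringI)
    show "abelian_group ?F"
    proof (rule abelian_groupI)
      fix f assume "f \<in> carrier ?F"
      then show "\<exists>g\<in>carrier ?F. g \<oplus>\<^bsub>?F\<^esub> f = \<zero>\<^bsub>?F\<^esub>"
        using mult[OF scalar, of f "- 1"]
        by (intro bexI[of _ "- f"]) (simp_all add: free_algebra_simps single_uminus single_Nil_1)
    qed (use add in \<open>simp_all add: free_algebra_simps ac_simps\<close>)
    show "Group.monoid ?F"
      by (rule monoidI) (use mult one in \<open>simp_all add: free_algebra_simps(1-5) mult.assoc\<close>)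
  qed (simp_all add: free_algebra_simps(3,4) distrib_left distrib_right)
  then show ?thesis
  proof (intro k_algebra.intro k_algebra_axioms.intro)
    fix f g c d assume "f \<in> carrier ?F"
    then show "c \<odot>\<^bsub>?F\<^esub> f \<in> carrier ?F"
      using mult[OF scalar] by (simp add: free_algebra_simps(5))
    show "f \<otimes>\<^bsub>?F\<^esub> (c \<odot>\<^bsub>?F\<^esub> g) = c \<odot>\<^bsub>?F\<^esub> (f \<otimes>\<^bsub>?F\<^esub> g)"
      by (simp add: free_algebra_simps(4,5) swap)
    show "(c * d) \<odot>\<^bsub>?F\<^esub> f = c \<odot>\<^bsub>?F\<^esub> (d \<odot>\<^bsub>?F\<^esub> f)"
      by (simp add: free_algebra_simps(5) scalar_mult mult.assoc)
  qed (simp_all add: free_algebra_simps(3-5) single_add single_Nil_1 distrib_left distrib_right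
      mult.assoc)
qed

text \<open>
  The linear operator with every word \<open>w\<close> as an eigenvector, with eigenvalue \<open>c w\<close>. Projections to
  homogeneous components, the twisting automorphisms and the isomorphism onto the twist all have this
  form on a free algebra.
\<close>

definition diag :: "('g list \<Rightarrow> 'k) \<Rightarrow> ('g list \<Rightarrow>\<^sub>0 'k) \<Rightarrow> 'g list \<Rightarrow>\<^sub>0 'k::field" where
  "diag c f = Abs_poly_mapping (\<lambda>w. c w * Poly_Mapping.lookup f w)"

lemma lookup_diag: "Poly_Mapping.lookup (diag c f) w = c w * Poly_Mapping.lookup f w"
proof -
  have "finite {w. c w * Poly_Mapping.lookup f w \<noteq> 0}"
    by (rule finite_subset[OF _ finite_lookup[of f]]) auto
  then show ?thesis
    by (simp add: diag_def)
qed

lemma keys_diag: "Poly_Mapping.keys (diag c f) \<subseteq> Poly_Mapping.keys f"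
  by (auto simp: in_keys_iff lookup_diag)

lemma diag_closed: "f \<in> carrier (free_algebra G) \<Longrightarrow> diag c f \<in> carrier (free_algebra G)"
  using keys_diag[of c f] by (auto simp: free_algebra_simps)

lemma diag_zero: "diag c 0 = 0"
  by (rule poly_mapping_eqI) (simp add: lookup_diag)

lemma diag_add: "diag c (f + g) = diag c f + diag c g"
  by (rule poly_mapping_eqI) (simp add: lookup_diag lookup_add distrib_left)

lemma diag_diff: "diag c (f - g) = diag c f - diag c g"
  by (rule poly_mapping_eqI) (simp add: lookup_diag lookup_minus right_diff_distrib)

lemma diag_diag: "diag c (diag d f) = diag (\<lambda>w. c w * d w) f"
  by (rule poly_mapping_eqI) (simp add: lookup_diag)

lemma diag_cong:
  assumes "\<And>w. w \<in> Poly_Mapping.keys f \<Longrightarrow> c w = d w"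
  shows "diag c f = diag d f"
  by (rule poly_mapping_eqI) (use assms in \<open>auto simp: lookup_diag in_keys_iff\<close>)

lemma diag_const: "diag (\<lambda>_. a) f = Poly_Mapping.single [] a * f"
  by (rule poly_mapping_eqI) (simp add: lookup_diag lookup_scalar_mult)

lemma diag_one: "diag (\<lambda>_. 1) f = f"
  by (rule poly_mapping_eqI) (simp add: lookup_diag)

lemma diag_single: "diag c (Poly_Mapping.single w a) = Poly_Mapping.single w (c w * a)"
  by (rule poly_mapping_eqI) (simp add: lookup_diag lookup_single when_def)

lemma diag_scalar_mult:
  "diag c (Poly_Mapping.single [] a * f) = Poly_Mapping.single [] a * diag c f"
  by (simp add: diag_diag mult.commute flip: diag_const)

text \<open>
  This one identity, a product formula for coefficients, yields multiplicativity of a diagonal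
  operator as well as its twisted versions, for which \<open>a\<close> or \<open>b\<close> involves the degree of the other
  factor.
\<close>

lemma diag_mult:
  assumes "\<And>u v. u \<in> Poly_Mapping.keys f \<Longrightarrow> v \<in> Poly_Mapping.keys g \<Longrightarrow> c (u @ v) = a u * b v"
  shows "diag c (f * g) = diag a f * diag b g"
proof -
  define U V where "U = Poly_Mapping.keys f" and "V = Poly_Mapping.keys g"
  have c: "c (u @ v) = a u * b v" if "u \<in> U" "v \<in> V" for u v
    using assms that by (simp add: U_def V_def)
  have single: "diag c (Poly_Mapping.single u x * g) = diag a (Poly_Mapping.single u x) * diag b g"
    if u: "u \<in> U" for u x
  proof -
    have "Poly_Mapping.keys g \<subseteq> V" by (simp add: V_def)
    then show ?thesis
    proof (induction g rule: support_induct)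
      case (single v y)
      then show ?case by (simp add: single_mult diag_single c u ac_simps)
    qed (simp_all add: diag_zero diag_add distrib_left)
  qed
  have "Poly_Mapping.keys f \<subseteq> U" by (simp add: U_def)
  then show ?thesis
    by (induction f rule: support_induct) (simp_all add: diag_zero diag_add distrib_right single)
qed

lemma bij_betw_diag:
  assumes "\<And>w. c w \<noteq> 0"
  shows "bij_betw (diag c) (carrier (free_algebra G)) (carrier (free_algebra G))"
  using assms
  by (intro bij_betw_byWitness[where f' = "diag (\<lambda>w. inverse (c w))"])
    (auto simp: diag_diag diag_one diag_closed)

definition free_part :: "'g set \<Rightarrow> ('g list \<Rightarrow> 'd) \<Rightarrow> 'd \<Rightarrow> ('g list \<Rightarrow>\<^sub>0 'k::field) set" where
  "free_part G deg \<alpha> =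
     {f \<in> carrier (free_algebra G). \<forall>w \<in> Poly_Mapping.keys f. deg w = \<alpha>}"

lemma diag_free_part:
  assumes "\<And>w. c w \<noteq> 0"
  shows "diag c ` free_part G deg \<alpha> = free_part G deg \<alpha>"
proof -
  have sub: "diag d ` free_part G deg \<alpha> \<subseteq> free_part G deg \<alpha>" for d
    using keys_diag diag_closed by (fastforce simp: free_part_def)
  have "f \<in> diag c ` free_part G deg \<alpha>" if "f \<in> free_part G deg \<alpha>" for f
  proof (rule image_eqI[of _ _ "diag (\<lambda>w. inverse (c w)) f"])
    show "f = diag c (diag (\<lambda>w. inverse (c w)) f)"
      using assms by (simp add: diag_diag diag_one)
  qed (use sub that in blast)
  with sub show ?thesis by blast
qed

lemma free_graded_algebra:
  fixes deg :: "'g list \<Rightarrow> 'd::ab_group_add"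
  assumes deg: "deg [] = 0" "\<And>u v. deg (u @ v) = deg u + deg v"
  shows "graded_algebra (free_algebra G :: ('k::field, 'g list \<Rightarrow>\<^sub>0 'k) module) (free_part G deg)"
proof -
  let ?F = "free_algebra G :: ('k, 'g list \<Rightarrow>\<^sub>0 'k) module"
  interpret F: k_algebra ?F by (rule free_algebra_k_algebra)
  have finsum: "(\<Oplus>\<^bsub>?F\<^esub>\<alpha>\<in>S. f \<alpha>) = (\<Sum>\<alpha>\<in>S. f \<alpha>)"
    if "finite S" "\<And>\<alpha>. f \<alpha> \<in> carrier ?F" for S and f :: "'d \<Rightarrow> 'g list \<Rightarrow>\<^sub>0 'k"
    using that(1)
  proof (induction S rule: finite_induct)
    case empty
    then show ?case by (simp add: F.finsum_empty free_algebra_simps)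
  next
    case (insert \<alpha> S)
    then show ?case
      using that(2) by (simp add: F.finsum_insert free_algebra_simps(3))
  qed
  show ?thesis
  proof (intro graded_algebra.intro F.k_algebra_axioms graded_algebra_axioms.intro)
    fix \<alpha> and f :: "'g list \<Rightarrow>\<^sub>0 'k" and c assume f: "f \<in> free_part G deg \<alpha>"
    then show "f \<in> carrier ?F"
      by (simp add: free_part_def)
    show "c \<odot>\<^bsub>?F\<^esub> f \<in> free_part G deg \<alpha>"
      using f keys_diag[of "\<lambda>_. c" f] diag_closed[of f G "\<lambda>_. c"]
      by (auto simp: free_part_def free_algebra_simps(5) simp flip: diag_const)
  next
    fix \<alpha> and f g :: "'g list \<Rightarrow>\<^sub>0 'k"
    assume "f \<in> free_part G deg \<alpha>" "g \<in> free_part G deg \<alpha>"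
    then show "f \<oplus>\<^bsub>?F\<^esub> g \<in> free_part G deg \<alpha>"
      using keys_add[of f g] F.a_closed[of f g] by (auto simp: free_part_def free_algebra_simps(3))
  next
    fix \<alpha> \<beta> and f g :: "'g list \<Rightarrow>\<^sub>0 'k"
    assume "f \<in> free_part G deg \<alpha>" "g \<in> free_part G deg \<beta>"
    then show "f \<otimes>\<^bsub>?F\<^esub> g \<in> free_part G deg (\<alpha> + \<beta>)"
      using keys_mult_lists[OF subset_refl subset_refl, of f g] F.m_closed[of f g]
      by (fastforce simp: free_part_def free_algebra_simps(4) deg)
  next
    show "\<zero>\<^bsub>?F\<^esub> \<in> free_part G deg \<alpha>" for \<alpha>
      by (simp add: free_part_def free_algebra_simps)
    show "\<one>\<^bsub>?F\<^esub> \<in> free_part G deg 0"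
      by (simp add: free_part_def free_algebra_simps zero_list_def deg)
  next
    fix f :: "'g list \<Rightarrow>\<^sub>0 'k" assume f: "f \<in> carrier ?F"
    define S where "S = deg ` Poly_Mapping.keys f"
    define c where "c = (\<lambda>\<alpha>. diag (\<lambda>w. if deg w = \<alpha> then 1 else 0) f)"
    have c: "c \<alpha> \<in> free_part G deg \<alpha>" for \<alpha>
      using f by (auto simp: c_def free_part_def in_keys_iff lookup_diag intro!: diag_closed split: if_splits)
    have "f = (\<Sum>\<alpha>\<in>S. c \<alpha>)"
      by (rule poly_mapping_eqI)
        (auto simp: lookup_sum c_def lookup_diag S_def in_keys_iff if_distrib[of "\<lambda>x. x * _"] cong: if_cong)
    then have "f = (\<Oplus>\<^bsub>?F\<^esub>\<alpha>\<in>S. c \<alpha>)"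
      using c by (subst finsum) (auto simp: S_def free_part_def)
    moreover have "finite S" by (simp add: S_def)
    ultimately show "\<exists>S c. finite S \<and> (\<forall>\<alpha>. c \<alpha> \<in> free_part G deg \<alpha>) \<and> f = (\<Oplus>\<^bsub>?F\<^esub>\<alpha>\<in>S. c \<alpha>)"
      using c by blast
  next
    fix S \<alpha> and f :: "'d \<Rightarrow> 'g list \<Rightarrow>\<^sub>0 'k"
    assume S: "finite S" and f: "\<And>\<alpha>. f \<alpha> \<in> free_part G deg \<alpha>"
      and zero: "(\<Oplus>\<^bsub>?F\<^esub>\<alpha>\<in>S. f \<alpha>) = \<zero>\<^bsub>?F\<^esub>" and \<alpha>: "\<alpha> \<in> S"
    have sum: "(\<Sum>\<alpha>\<in>S. f \<alpha>) = 0"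
      using zero f by (subst (asm) finsum[OF S]) (auto simp: free_part_def free_algebra_simps(1))
    have off: "Poly_Mapping.lookup (f \<beta>) w = 0" if "deg w \<noteq> \<beta>" for w \<beta>
      using f[of \<beta>] that by (auto simp: free_part_def in_keys_iff)
    have "Poly_Mapping.lookup (f \<alpha>) w = 0" for w
    proof (cases "deg w = \<alpha>")
      case True
      have "0 = (\<Sum>\<beta>\<in>S. Poly_Mapping.lookup (f \<beta>) w)"
        using sum by (simp flip: lookup_sum)
      also have "\<dots> = (\<Sum>\<beta>\<in>{\<alpha>}. Poly_Mapping.lookup (f \<beta>) w)"
        using S \<alpha> True by (intro sum.mono_neutral_right) (auto intro!: off)
      finally show ?thesis by simp
    qed (rule off)
    then show "f \<alpha> = \<zero>\<^bsub>?F\<^esub>"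
      by (simp add: poly_mapping_eqI free_algebra_simps(1))
  qed
qed

text \<open>The operator is scalar on each component, and the ideal contains the components of its elements.\<close>

lemma graded_ideal_diag:
  fixes deg :: "'g list \<Rightarrow> 'd::ab_group_add"
  assumes deg: "deg [] = 0" "\<And>u v. deg (u @ v) = deg u + deg v"
    and J: "graded_ideal (free_algebra G :: ('k::field, 'g list \<Rightarrow>\<^sub>0 'k) module) (free_part G deg) J"
    and f: "f \<in> J"
  shows "diag (\<lambda>w. \<phi> (deg w)) f \<in> J"
proof -
  interpret F: graded_algebra "free_algebra G :: ('k, 'g list \<Rightarrow>\<^sub>0 'k) module" "free_part G deg"
    by (rule free_graded_algebra[where deg = deg, OF deg])
  interpret J: ideal J "free_algebra G :: ('k, 'g list \<Rightarrow>\<^sub>0 'k) module"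
    using J by (simp add: graded_ideal_def)
  from J f show ?thesis
  proof (induction f rule: F.graded_ideal_induct)
    case zero
    then show ?case
      using J.zero_closed by (simp add: free_algebra_simps(1) diag_zero)
  next
    case (homogeneous \<alpha> f)
    have "diag (\<lambda>w. \<phi> (deg w)) f = diag (\<lambda>_. \<phi> \<alpha>) f"
      using homogeneous by (intro diag_cong) (simp add: free_part_def)
    then show ?case
      using F.ideal_smult_closed[OF J.ideal_axioms homogeneous(1), of "\<phi> \<alpha>"]
      by (simp add: diag_const free_algebra_simps(5))
  next
    case (add f g)
    then show ?case
      using J.a_closed by (simp add: free_algebra_simps(3) diag_add)
  qed
qed

section \<open>Bicharacters of the grading group\<close>

text \<open>
  For nonzero entries of \<open>L\<close>, the bimultiplicative map with value \<open>L i j\<close> at the pair of standard basis vectors \<open>(e\<^sub>i, e\<^sub>j)\<close>.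
\<close>

definition bichar :: "('n::finite \<Rightarrow> 'n \<Rightarrow> 'k::field) \<Rightarrow> int ^ 'n \<Rightarrow> int ^ 'n \<Rightarrow> 'k" where
  "bichar L \<alpha> \<beta> = (\<Prod>i\<in>UNIV. \<Prod>j\<in>UNIV. L i j powi (\<alpha> $ i * \<beta> $ j))"

lemma bichar_add:
  assumes "\<And>i j. L i j \<noteq> 0"
  shows "bichar L (\<alpha> + \<beta>) \<gamma> = bichar L \<alpha> \<gamma> * bichar L \<beta> \<gamma>"
    and "bichar L \<gamma> (\<alpha> + \<beta>) = bichar L \<gamma> \<alpha> * bichar L \<gamma> \<beta>"
  using assms by (simp_all add: bichar_def distrib_left distrib_right power_int_add prod.distrib)

lemma bichar_zero: "bichar L 0 \<gamma> = 1" "bichar L \<gamma> 0 = 1"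
  by (simp_all add: bichar_def)

lemma bichar_nonzero:
  assumes "\<And>i j. L i j \<noteq> 0"
  shows "bichar L \<alpha> \<beta> \<noteq> 0"
  using assms by (simp add: bichar_def)

lemma bichar_minus:
  "bichar L (- \<alpha>) \<gamma> = inverse (bichar L \<alpha> \<gamma>)" "bichar L \<gamma> (- \<alpha>) = inverse (bichar L \<gamma> \<alpha>)"
  by (simp_all add: bichar_def power_int_minus prod_inversef[unfolded comp_def])

lemma bichar_inverse: "bichar (\<lambda>i j. inverse (L i j)) \<alpha> \<beta> = inverse (bichar L \<alpha> \<beta>)"
  by (simp add: bichar_def power_int_inverse prod_inversef[unfolded comp_def])

lemma bichar_axis: "bichar L (axis i 1) (axis j 1) = L i j"
proof -
  have "(\<Prod>j'\<in>UNIV. L i' j' powi (axis i 1 $ i' * axis j 1 $ j')) = (if i' = i then L i j else 1)" for i'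
  proof (cases "i' = i")
    case True
    have "(\<Prod>j'\<in>UNIV. L i' j' powi (axis i 1 $ i' * axis j 1 $ j')) =
        (\<Prod>j'\<in>UNIV. if j' = j then L i j else 1)"
      using True by (intro prod.cong) (simp_all add: axis_def)
    then show ?thesis using True by simp
  qed (simp add: axis_def)
  then show ?thesis
    by (simp add: bichar_def)
qed

text \<open>
  The scalar \<open>c w\<close> for which \<open>w \<mapsto> c w \<cdot> w\<close> becomes multiplicative as a map to the twist and fixes the
  letters. In the twist \<open>x \<star> w = b(deg w, deg x) x w\<close>, where \<open>b\<close> is the bicharacter, which dictates
  the recursion.
\<close>

fun twist_factor :: "('n::finite \<Rightarrow> 'n \<Rightarrow> 'k::field) \<Rightarrow> ('r, 'n) tgw_letter list \<Rightarrow> 'k" where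
  "twist_factor L [] = 1"
| "twist_factor L (x # w) = bichar L (word_degree w) (letter_degree x) * twist_factor L w"

lemma word_degree_Nil: "word_degree [] = 0"
  and word_degree_Cons: "word_degree (x # w) = letter_degree x + word_degree w"
  and word_degree_append: "word_degree (u @ v) = word_degree u + word_degree v"
  by (simp_all add: word_degree_def)

lemmas word_degree_simps = word_degree_Nil word_degree_Cons word_degree_append

lemma twist_factor_append:
  assumes "\<And>i j. L i j \<noteq> 0"
  shows "twist_factor L (u @ v) =
    bichar L (word_degree v) (word_degree u) * twist_factor L u * twist_factor L v"
  by (induction u) (simp_all add: bichar_zero bichar_add[OF assms] word_degree_simps mult_ac)

lemma twist_factor_nonzero:
  assumes "\<And>i j. L i j \<noteq> 0"
  shows "twist_factor L w \<noteq> 0"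
  by (induction w) (simp_all add: bichar_nonzero[OF assms])

lemma twist_factor_inverse:
  "twist_factor (\<lambda>i j. inverse (L i j)) w = inverse (twist_factor L w)"
  by (induction w) (simp_all add: bichar_inverse)


section \<open>The grading of a twisted generalized Weyl construction\<close>

locale twisted_weyl_datum =
  fixes R :: "('k::field, 'r) module"
    and \<sigma> :: "'n::finite \<Rightarrow> 'r \<Rightarrow> 'r"
    and t :: "'n \<Rightarrow> 'r"
  assumes datum: "tgw_datum R \<sigma> t"
begin

abbreviation F :: "('k, ('k, 'r, 'n) tgw_free) module" where
  "F \<equiv> free_algebra (tgw_letters R)"

abbreviation F_part :: "int ^ 'n \<Rightarrow> ('k, 'r, 'n) tgw_free set" where
  "F_part \<equiv> free_part (tgw_letters R) word_degree"

sublocale R: k_algebra R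
  using datum by (simp add: tgw_datum_def)

sublocale F: graded_algebra F F_part
  by (rule free_graded_algebra) (simp_all add: word_degree_simps)

lemma \<sigma>_iso: "\<sigma> i \<in> alg_iso R R"
  and t_center: "t i \<in> ring_center R"
  using datum by (auto simp: tgw_datum_def)

lemma t_closed: "t i \<in> carrier R"
  using t_center by (simp add: ring_center_def)

lemma \<sigma>_ring_iso: "\<sigma> i \<in> ring_iso R R"
  using \<sigma>_iso[of i] by (simp add: alg_iso_def)

lemmas \<sigma>_closed = ring_iso_memE(1)[OF \<sigma>_ring_iso]
  and \<sigma>_bij = ring_iso_memE(5)[OF \<sigma>_ring_iso]

abbreviation \<sigma>_inv :: "'n \<Rightarrow> 'r \<Rightarrow> 'r" where
  "\<sigma>_inv i \<equiv> inv_into (carrier R) (\<sigma> i)"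

lemma \<sigma>_inv_closed: "r \<in> carrier R \<Longrightarrow> \<sigma>_inv i r \<in> carrier R"
  using \<sigma>_bij[of i] by (metis bij_betw_def inv_into_into)

lemma \<sigma>_\<sigma>_inv: "r \<in> carrier R \<Longrightarrow> \<sigma> i (\<sigma>_inv i r) = r"
  using \<sigma>_bij[of i] by (metis bij_betw_def f_inv_into_f)

lemma letters_closed:
  "r \<in> carrier R \<Longrightarrow> Coef r \<in> tgw_letters R" "Xp i \<in> tgw_letters R" "Xm i \<in> tgw_letters R"
  by (simp_all add: tgw_letters_def)

lemma single_part:
  assumes "set w \<subseteq> tgw_letters R" "word_degree w = \<alpha>"
  shows "Poly_Mapping.single w c \<in> F_part \<alpha>"
  using assms by (simp add: free_part_def free_algebra_simps lists_eq_set)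

lemma diff_part:
  assumes "f \<in> F_part \<alpha>" "g \<in> F_part \<alpha>"
  shows "f - g \<in> F_part \<alpha>"
  using F.part_add[OF assms(1) F.part_smult[OF assms(2), of "- 1"]]
  by (simp add: free_algebra_simps single_uminus single_Nil_1)

lemmas word_simps = letter_def single_mult

lemma relations_homogeneous:
  assumes "f \<in> tgw_relations R \<sigma> t \<mu>"
  shows "\<exists>\<alpha>. f \<in> F_part \<alpha>"
proof -
  note part = diff_part single_part F.part_add[unfolded free_algebra_simps]
  note closed = letters_closed \<sigma>_closed \<sigma>_inv_closed t_closed R.smult_closed
  show ?thesis
    using assms
  proof cases
    case (coef_one)
    then show ?thesis
      by (intro exI[of _ 0]) (auto simp: word_simps closed word_degree_simps simp flip: single_Nil_1 intro!: part)
  next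
    case (Xp_coef r i)
    then show ?thesis
      by (intro exI[of _ "axis i 1"]) (auto simp: word_simps closed word_degree_simps intro!: part)
  next
    case (Xm_coef r i)
    then show ?thesis
      by (intro exI[of _ "- axis i 1"]) (auto simp: word_simps closed word_degree_simps intro!: part)
  next
    case (Xp_Xm_swap i j)
    then show ?thesis
      by (intro exI[of _ "axis i 1 - axis j 1"]) (auto simp: word_simps closed word_degree_simps intro!: part)
  qed (intro exI[of _ 0]; auto simp: word_simps closed word_degree_simps intro!: part)+
qed

lemma relations_closed: "tgw_relations R \<sigma> t \<mu> \<subseteq> carrier F"
  using relations_homogeneous F.part_closed by blast

lemma tgwc_ideal_graded: "graded_ideal F F_part (tgwc_ideal R \<sigma> t \<mu>)"
  unfolding tgwc_ideal_def by (rule F.graded_ideal_genideal) (rule relations_homogeneous)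

lemma tgwc_ideal_ideal: "ideal (tgwc_ideal R \<sigma> t \<mu>) F"
  using tgwc_ideal_graded by (simp add: graded_ideal_def)

lemma tgwc_quotient: "quotient_algebra F (tgwc_ideal R \<sigma> t \<mu>)"
  by (intro quotient_algebra.intro F.k_algebra_axioms tgwc_ideal_ideal)

lemma tgwc_part_eq:
  "tgwc_part R \<sigma> t \<mu> = (\<lambda>\<alpha>. (\<lambda>f. tgwc_ideal R \<sigma> t \<mu> +>\<^bsub>F\<^esub> f) ` F_part \<alpha>)"
  by (simp add: tgwc_part_def tgwc_proj_def free_part_def fun_eq_iff)

lemma tgwc_graded: "graded_algebra (tgwc R \<sigma> t \<mu>) (tgwc_part R \<sigma> t \<mu>)"
  unfolding tgwc_def tgwc_part_eq by (rule F.quotient_graded_algebra[OF tgwc_ideal_graded])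

text \<open>
  The sum of the graded ideals without part of degree 0 is again such an ideal.
\<close>

lemma tgwa_ideal_eq: "tgwa_ideal R \<sigma> t \<mu> = graded_radical (tgwc R \<sigma> t \<mu>) (tgwc_part R \<sigma> t \<mu>)"
  unfolding tgwa_ideal_def by (rule graded_algebra.genideal_graded_radical[OF tgwc_graded])

lemma tgwa_ideal_graded:
  "graded_ideal (tgwc R \<sigma> t \<mu>) (tgwc_part R \<sigma> t \<mu>) (tgwa_ideal R \<sigma> t \<mu>)"
  unfolding tgwa_ideal_eq by (rule graded_algebra.graded_radical_graded_ideal[OF tgwc_graded])

lemma tgwa_ideal_ideal: "ideal (tgwa_ideal R \<sigma> t \<mu>) (tgwc R \<sigma> t \<mu>)"
  using tgwa_ideal_graded by (simp add: graded_ideal_def)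

lemma tgwa_part_eq:
  "tgwa_part R \<sigma> t \<mu> =
    (\<lambda>\<alpha>. (\<lambda>x. tgwa_ideal R \<sigma> t \<mu> +>\<^bsub>tgwc R \<sigma> t \<mu>\<^esub> x) ` tgwc_part R \<sigma> t \<mu> \<alpha>)"
  by (simp add: tgwa_part_def tgwa_proj_def fun_eq_iff)

lemma tgwa_graded: "graded_algebra (tgwa R \<sigma> t \<mu>) (tgwa_part R \<sigma> t \<mu>)"
  unfolding tgwa_def tgwa_part_eq
  by (rule graded_algebra.quotient_graded_algebra[OF tgwc_graded tgwa_ideal_graded])

text \<open>
  A twisted isomorphism between the constructions matches their radicals, so it descends.
\<close>

lemma tgwa_twisted_iso:
  assumes \<xi>: "\<And>\<alpha>. \<xi> \<alpha> \<in> graded_iso (tgwc R \<sigma> t \<mu>) (tgwc_part R \<sigma> t \<mu>)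
      (tgwc R \<sigma> t \<mu>) (tgwc_part R \<sigma> t \<mu>)"
    and h: "h \<in> graded_iso (tgwc R \<sigma> t \<nu>) (tgwc_part R \<sigma> t \<nu>)
      (twisted_tgwc R \<sigma> t \<mu> \<xi>) (tgwc_part R \<sigma> t \<mu>)"
  shows "(`) h \<in> graded_iso (tgwa R \<sigma> t \<nu>) (tgwa_part R \<sigma> t \<nu>)
      (twisted_tgwa R \<sigma> t \<mu> \<xi>) (tgwa_part R \<sigma> t \<mu>)"
  unfolding twisted_tgwa_def unfolding tgwa_def tgwa_part_eq
proof (rule quotient_twisted_graded_iso[OF tgwc_graded tgwc_graded tgwa_ideal_ideal tgwa_ideal_graded _ _ \<xi>])
  show "h \<in> graded_iso (tgwc R \<sigma> t \<nu>) (tgwc_part R \<sigma> t \<nu>)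
      (graded_twist (tgwc R \<sigma> t \<mu>) (tgwc_part R \<sigma> t \<mu>) \<xi>) (tgwc_part R \<sigma> t \<mu>)"
    using h by (simp add: twisted_tgwc_def)
  then show "h ` tgwa_ideal R \<sigma> t \<nu> = tgwa_ideal R \<sigma> t \<mu>"
    unfolding tgwa_ideal_eq by (rule graded_radical_twisted_iso[OF tgwc_graded tgwc_graded _ \<xi>])
  show "\<xi> \<alpha> ` tgwa_ideal R \<sigma> t \<mu> = tgwa_ideal R \<sigma> t \<mu>" for \<alpha>
    unfolding tgwa_ideal_eq by (rule graded_algebra.graded_radical_automorphism[OF tgwc_graded \<xi>])
qed

lemma descended_graded_iso:
  assumes "\<xi> \<alpha> \<in> graded_iso (tgwc R \<sigma> t \<mu>) (tgwc_part R \<sigma> t \<mu>)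
      (tgwc R \<sigma> t \<mu>) (tgwc_part R \<sigma> t \<mu>)"
  shows "descended_twisting \<xi> \<alpha> \<in> graded_iso (tgwa R \<sigma> t \<mu>) (tgwa_part R \<sigma> t \<mu>)
      (tgwa R \<sigma> t \<mu>) (tgwa_part R \<sigma> t \<mu>)"
proof -
  have "descended_twisting \<xi> \<alpha> = (`) (\<xi> \<alpha>)"
    by (simp add: descended_twisting_def fun_eq_iff)
  then show ?thesis
    unfolding tgwa_def tgwa_part_eq
    using quotient_graded_automorphism[OF tgwc_graded tgwa_ideal_ideal assms]
      graded_algebra.graded_radical_automorphism[OF tgwc_graded assms]
    by (simp add: tgwa_ideal_eq)
qed


section \<open>Changing the parameters by a twist\<close>

lemma degree_scaling_graded_iso:
  assumes "\<And>\<alpha> \<beta>. \<phi> (\<alpha> + \<beta>) = \<phi> \<alpha> * \<phi> \<beta>" "\<And>\<alpha>. \<phi> \<alpha> \<noteq> 0"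
  shows "diag (\<lambda>w. \<phi> (word_degree w)) \<in> graded_iso F F_part F F_part"
proof (rule graded_isoI)
  have "\<phi> 0 = 1"
    using assms(1)[of 0 0] assms(2)[of 0] by simp
  then show "diag (\<lambda>w. \<phi> (word_degree w)) \<one>\<^bsub>F\<^esub> = \<one>\<^bsub>F\<^esub>"
    by (simp add: free_algebra_simps(2) diag_single word_degree_simps flip: single_Nil_1)
qed (simp_all add: free_algebra_simps(3-5) assms bij_betw_diag diag_add diag_scalar_mult
    diag_free_part diag_mult word_degree_simps)

text \<open>
  The scaling with inverse scalars gives the reverse inclusion.
\<close>

lemma degree_scaling_ideal:
  assumes "\<And>\<alpha>. \<phi> \<alpha> \<noteq> 0"
  shows "diag (\<lambda>w. \<phi> (word_degree w)) ` tgwc_ideal R \<sigma> t \<mu> = tgwc_ideal R \<sigma> t \<mu>"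
proof -
  have sub: "diag (\<lambda>w. \<phi> (word_degree w)) f \<in> tgwc_ideal R \<sigma> t \<mu>"
    if "f \<in> tgwc_ideal R \<sigma> t \<mu>" for f and \<phi> :: "int ^ 'n \<Rightarrow> 'k"
    by (rule graded_ideal_diag[OF _ _ tgwc_ideal_graded that]) (simp_all add: word_degree_simps)
  have "f \<in> diag (\<lambda>w. \<phi> (word_degree w)) ` tgwc_ideal R \<sigma> t \<mu>" if "f \<in> tgwc_ideal R \<sigma> t \<mu>" for f
  proof (rule image_eqI)
    show "f = diag (\<lambda>w. \<phi> (word_degree w)) (diag (\<lambda>w. inverse (\<phi> (word_degree w))) f)"
      using assms by (simp add: diag_diag diag_one)
    show "diag (\<lambda>w. inverse (\<phi> (word_degree w))) f \<in> tgwc_ideal R \<sigma> t \<mu>"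
      by (rule sub[OF that, of "\<lambda>\<alpha>. inverse (\<phi> \<alpha>)"])
  qed
  with sub show ?thesis by blast
qed

context
  fixes L :: "'n \<Rightarrow> 'n \<Rightarrow> 'k"
  assumes L: "\<And>i j. L i j \<noteq> 0"
begin

lemma twist_factor_graded_iso:
  "diag (twist_factor L) \<in> graded_iso F F_part
     (graded_twist F F_part (\<lambda>\<beta>. diag (\<lambda>w. bichar L \<beta> (word_degree w)))) F_part"
    (is "?T \<in> graded_iso F F_part (graded_twist F F_part ?\<xi>) F_part")
proof (rule graded_isoI)
  fix f g assume f: "f \<in> carrier F" and g: "g \<in> carrier F"
  note closed = diag_closed[OF f]
  from g have "?T (f * g) = F.twisted_mult ?\<xi> (?T f) (?T g)"
  proof (induction g rule: F.homogeneous_induct)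
    case zero
    then show ?case
      using F.twisted_mult_zero[of ?\<xi> "?T f"] by (simp add: free_algebra_simps(1) diag_zero)
  next
    case (homogeneous \<beta> g)
    have "?T g \<in> F_part \<beta>"
      using diag_free_part[of "twist_factor L" "tgw_letters R" word_degree \<beta>]
        twist_factor_nonzero[of L, OF L] homogeneous by blast
    then have "F.twisted_mult ?\<xi> (?T f) (?T g) = ?\<xi> \<beta> (?T f) * ?T g"
      by (subst F.twisted_mult_homogeneous) (simp_all add: closed diag_closed free_algebra_simps(4))
    also have "\<dots> = ?T (f * g)"
      unfolding diag_diag
    proof (rule diag_mult[symmetric])
      fix u v assume "v \<in> Poly_Mapping.keys g"
      then have "word_degree v = \<beta>"
        using homogeneous by (simp add: free_part_def)
      then show "twist_factor L (u @ v) = bichar L \<beta> (word_degree u) * twist_factor L u * twist_factor L v"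
        by (simp add: twist_factor_append L)
    qed
    finally show ?case by simp
  next
    case (add g g')
    have "F.twisted_mult ?\<xi> (?T f) (?T g \<oplus>\<^bsub>F\<^esub> ?T g') =
        F.twisted_mult ?\<xi> (?T f) (?T g) \<oplus>\<^bsub>F\<^esub> F.twisted_mult ?\<xi> (?T f) (?T g')"
      by (rule F.twisted_mult_add) (simp_all add: closed diag_closed add)
    then show ?case
      using add by (simp add: free_algebra_simps(3) diag_add distrib_left)
  qed
  then show "?T (f \<otimes>\<^bsub>F\<^esub> g) = ?T f \<otimes>\<^bsub>graded_twist F F_part ?\<xi>\<^esub> ?T g"
    by (simp add: free_algebra_simps(4))
next
  show "?T \<one>\<^bsub>F\<^esub> = \<one>\<^bsub>graded_twist F F_part ?\<xi>\<^esub>"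
    by (simp add: graded_twist_simps free_algebra_simps(2) diag_single flip: single_Nil_1)
qed (simp_all add: graded_twist_simps free_algebra_simps(3,5) bij_betw_diag twist_factor_nonzero L
    diag_add diag_scalar_mult diag_free_part)

text \<open>
  Only the relation between \<open>X\<^sub>i\<^sup>+\<close> and \<open>X\<^sub>j\<^sup>-\<close> for \<open>i \<noteq> j\<close> involves the parameters. In every other relation
  all words receive the factor 1: two factors of which one has degree 0 contribute 1, and so do
  \<open>X\<^sub>i\<^sup>+\<close> and \<open>X\<^sub>i\<^sup>-\<close>, because the bicharacter is 1 at \<open>(e\<^sub>i, e\<^sub>i)\<close>.
\<close>

lemma twist_factor_relation:
  assumes diagonal: "\<And>i. L i i = 1"
    and ratio: "\<And>i j. i \<noteq> j \<Longrightarrow> \<mu> $ i $ j * L i j = \<nu> $ i $ j * L j i"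
    and f: "f \<in> tgw_relations R \<sigma> t \<nu>"
  shows "\<exists>c. \<exists>g \<in> tgw_relations R \<sigma> t \<mu>. diag (twist_factor L) f = Poly_Mapping.single [] c * g"
proof -
  define swap :: "'k ^ 'n ^ 'n \<Rightarrow> 'n \<Rightarrow> 'n \<Rightarrow> ('k, 'r, 'n) tgw_free"
    where "swap = (\<lambda>\<mu> i j. letter (Xp i) * letter (Xm j) -
      Poly_Mapping.single [] (\<mu> $ i $ j) * letter (Xm j) * letter (Xp i))"
  have fixed: "diag (twist_factor L) f = f \<or> (\<exists>i j. i \<noteq> j \<and> f = swap \<nu> i j)"
    using f
  proof cases
    case (Xp_Xm_swap i j)
    then show ?thesis by (auto simp: swap_def)
  qed (simp_all add: word_simps diag_diff diag_add diag_single word_degree_simps bichar_zero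
      bichar_minus bichar_axis diagonal flip: single_Nil_1)
  have common: "f \<in> tgw_relations R \<sigma> t \<mu> \<or> (\<exists>i j. i \<noteq> j \<and> f = swap \<nu> i j)"
    using f unfolding swap_def by cases (blast intro: tgw_relations.intros)+
  show ?thesis
  proof (cases "\<exists>i j. i \<noteq> j \<and> f = swap \<nu> i j")
    case True
    then obtain i j where ij: "i \<noteq> j" and f: "f = swap \<nu> i j"
      by blast
    have "\<nu> $ i $ j * inverse (L i j) = inverse (L j i) * \<mu> $ i $ j"
      using ratio[OF ij] L[of i j] L[of j i] by (simp add: field_simps)
    then have "diag (twist_factor L) f = Poly_Mapping.single [] (inverse (L j i)) * swap \<mu> i j"
      by (simp add: f swap_def word_simps diag_diff diag_single word_degree_simps bichar_zero
          bichar_minus bichar_axis right_diff_distrib mult_ac)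
    moreover have "swap \<mu> i j \<in> tgw_relations R \<sigma> t \<mu>"
      unfolding swap_def using ij by (rule tgw_relations.Xp_Xm_swap)
    ultimately show ?thesis by blast
  next
    case False
    then have "diag (twist_factor L) f = Poly_Mapping.single [] 1 * f"
      using fixed by (auto simp: single_Nil_1)
    then show ?thesis
      using False common by blast
  qed
qed

text \<open>
  The preimage of the ideal under the rescaling of words is not an ideal for formal reasons, since the
  rescaling is multiplicative only up to the twist. Multiplying by a homogeneous element on either
  side introduces an additional degreewise scaling of the other factor, which a graded ideal
  tolerates.
\<close>

lemma twist_factor_ideal_subset:
  assumes diagonal: "\<And>i. L i i = 1"
    and ratio: "\<And>i j. i \<noteq> j \<Longrightarrow> \<mu> $ i $ j * L i j = \<nu> $ i $ j * L j i"
  shows "diag (twist_factor L) ` tgwc_ideal R \<sigma> t \<nu> \<subseteq> tgwc_ideal R \<sigma> t \<mu>"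
proof -
  let ?T = "diag (twist_factor L)"
  interpret I: ideal "tgwc_ideal R \<sigma> t \<mu>" F by (rule tgwc_ideal_ideal)
  have scaling: "diag (\<lambda>w. \<phi> (word_degree w)) f \<in> tgwc_ideal R \<sigma> t \<mu>"
    if "f \<in> tgwc_ideal R \<sigma> t \<mu>" for f and \<phi> :: "int ^ 'n \<Rightarrow> 'k"
    by (rule graded_ideal_diag[OF _ _ tgwc_ideal_graded that]) (simp_all add: word_degree_simps)
  have "ideal {f \<in> carrier F. ?T f \<in> tgwc_ideal R \<sigma> t \<mu>} F" (is "ideal ?K F")
  proof (rule F.ideal_homogeneous_criterion)
    show "\<zero>\<^bsub>F\<^esub> \<in> ?K"
      using I.zero_closed F.zero_closed by (simp add: free_algebra_simps(1) diag_zero)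
    show "f \<oplus>\<^bsub>F\<^esub> g \<in> ?K" if "f \<in> ?K" "g \<in> ?K" for f g
      using that I.a_closed[of "?T f" "?T g"] F.a_closed[of f g]
      by (simp add: free_algebra_simps(3) diag_add)
  next
    fix \<alpha> a f assume a: "a \<in> F_part \<alpha>" and f: "f \<in> ?K"
    have ac: "a \<in> carrier F" and deg: "\<And>w. w \<in> Poly_Mapping.keys a \<Longrightarrow> word_degree w = \<alpha>"
      using a by (simp_all add: free_part_def)
    have "?T (a * f) = ?T a * diag (\<lambda>w. bichar L (word_degree w) \<alpha>) (?T f)"
      unfolding diag_diag by (rule diag_mult) (simp add: twist_factor_append L deg)
    moreover have "diag (\<lambda>w. bichar L (word_degree w) \<alpha>) (?T f) \<in> tgwc_ideal R \<sigma> t \<mu>"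
      by (rule scaling[of "?T f" "\<lambda>\<beta>. bichar L \<beta> \<alpha>"]) (use f in simp)
    ultimately show "a \<otimes>\<^bsub>F\<^esub> f \<in> ?K"
      using f I.I_l_closed[OF _ diag_closed[OF ac]] F.m_closed[OF ac, of f]
      by (simp add: free_algebra_simps(4))
    have "?T (f * a) = diag (\<lambda>w. bichar L \<alpha> (word_degree w)) (?T f) * ?T a"
      unfolding diag_diag by (rule diag_mult) (simp add: twist_factor_append L deg)
    moreover have "diag (\<lambda>w. bichar L \<alpha> (word_degree w)) (?T f) \<in> tgwc_ideal R \<sigma> t \<mu>"
      by (rule scaling) (use f in simp)
    ultimately show "f \<otimes>\<^bsub>F\<^esub> a \<in> ?K"
      using f I.I_r_closed[OF _ diag_closed[OF ac]] F.m_closed[OF _ ac, of f]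
      by (simp add: free_algebra_simps(4))
  qed simp
  moreover have "tgw_relations R \<sigma> t \<nu> \<subseteq> ?K"
  proof
    fix f assume f: "f \<in> tgw_relations R \<sigma> t \<nu>"
    obtain c g where g: "g \<in> tgw_relations R \<sigma> t \<mu>" "?T f = Poly_Mapping.single [] c * g"
      using twist_factor_relation[OF diagonal ratio f] by blast
    have "g \<in> tgwc_ideal R \<sigma> t \<mu>"
      unfolding tgwc_ideal_def using F.genideal_self[OF relations_closed] g(1) by blast
    then have "?T f \<in> tgwc_ideal R \<sigma> t \<mu>"
      using F.ideal_smult_closed[OF tgwc_ideal_ideal, of g \<mu> c] g(2) by (simp add: free_algebra_simps(5))
    then show "f \<in> ?K"
      using relations_closed f by blast
  qed
  ultimately have "tgwc_ideal R \<sigma> t \<nu> \<subseteq> ?K"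
    unfolding tgwc_ideal_def by (rule F.genideal_minimal)
  then show ?thesis by blast
qed

end

text \<open>
  Inverting all entries of \<open>L\<close> inverts the rescaling and exchanges the roles of \<open>\<mu>\<close> and \<open>\<nu>\<close>.
\<close>

lemma twist_factor_ideal:
  assumes L: "\<And>i j. L i j \<noteq> 0" and diagonal: "\<And>i. L i i = 1"
    and ratio: "\<And>i j. i \<noteq> j \<Longrightarrow> \<mu> $ i $ j * L i j = \<nu> $ i $ j * L j i"
  shows "diag (twist_factor L) ` tgwc_ideal R \<sigma> t \<nu> = tgwc_ideal R \<sigma> t \<mu>"
proof
  show "diag (twist_factor L) ` tgwc_ideal R \<sigma> t \<nu> \<subseteq> tgwc_ideal R \<sigma> t \<mu>"
    by (rule twist_factor_ideal_subset[OF L diagonal ratio])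
  let ?L' = "\<lambda>i j. inverse (L i j)"
  have "\<nu> $ i $ j * ?L' i j = \<mu> $ i $ j * ?L' j i" if "i \<noteq> j" for i j
    using ratio[OF that] L[of i j] L[of j i] by (simp add: field_simps)
  then have sub: "diag (twist_factor ?L') ` tgwc_ideal R \<sigma> t \<mu> \<subseteq> tgwc_ideal R \<sigma> t \<nu>"
    by (intro twist_factor_ideal_subset) (simp_all add: L diagonal)
  show "tgwc_ideal R \<sigma> t \<mu> \<subseteq> diag (twist_factor L) ` tgwc_ideal R \<sigma> t \<nu>"
  proof
    fix f assume "f \<in> tgwc_ideal R \<sigma> t \<mu>"
    then have "diag (twist_factor ?L') f \<in> tgwc_ideal R \<sigma> t \<nu>"
      using sub by blast
    moreover have "f = diag (twist_factor L) (diag (twist_factor ?L') f)"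
      by (simp add: diag_diag twist_factor_inverse twist_factor_nonzero[of L, OF L] diag_one)
    ultimately show "f \<in> diag (twist_factor L) ` tgwc_ideal R \<sigma> t \<nu>"
      by (rule rev_image_eqI)
  qed
qed

text \<open>
  Every homogeneous element is an eigenvector of these automorphisms; the scalars at the generators
  are the values of the bicharacter at \<open>(\<plusminus>e\<^sub>i, \<plusminus>e\<^sub>j)\<close>.
\<close>

lemma descended_bichar_admissible:
  assumes L: "\<And>i j. L i j \<noteq> 0"
  shows "admissible_twisting R \<sigma> t \<mu> (descended_twisting (\<lambda>\<alpha>. diag (\<lambda>w. bichar L \<alpha> (word_degree w))))"
    (is "admissible_twisting R \<sigma> t \<mu> (descended_twisting ?\<xi>)")
proof -
  interpret Q: quotient_algebra F "tgwc_ideal R \<sigma> t \<mu>" by (rule tgwc_quotient)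
  have ideal: "?\<xi> \<alpha> ` tgwc_ideal R \<sigma> t \<mu> = tgwc_ideal R \<sigma> t \<mu>" for \<alpha>
    by (rule degree_scaling_ideal) (rule bichar_nonzero[OF L])
  have desc: "descended_twisting ?\<xi> \<alpha> = (`) (?\<xi> \<alpha>)" for \<alpha>
    by (simp add: descended_twisting_def fun_eq_iff)
  have iso: "descended_twisting ?\<xi> \<alpha> \<in> graded_iso (tgwc R \<sigma> t \<mu>) (tgwc_part R \<sigma> t \<mu>)
      (tgwc R \<sigma> t \<mu>) (tgwc_part R \<sigma> t \<mu>)" for \<alpha>
    unfolding desc tgwc_def tgwc_part_eq
    by (rule quotient_graded_automorphism[OF F.graded_algebra_axioms tgwc_ideal_ideal _ ideal])
      (rule degree_scaling_graded_iso, simp_all add: bichar_add[OF L] bichar_nonzero[OF L])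
  have hom: "descended_twisting ?\<xi> (\<alpha> + \<beta>) X = descended_twisting ?\<xi> \<alpha> (descended_twisting ?\<xi> \<beta> X)" for \<alpha> \<beta> X
    by (simp add: desc image_image diag_diag bichar_add[OF L])
  have letter: "descended_twisting ?\<xi> \<alpha> (tgwc_proj R \<sigma> t \<mu> (letter x)) =
      bichar L \<alpha> (letter_degree x) \<odot>\<^bsub>tgwc R \<sigma> t \<mu>\<^esub> tgwc_proj R \<sigma> t \<mu> (letter x)"
    if x: "x \<in> tgw_letters R" for \<alpha> x
  proof -
    have xc: "letter x \<in> carrier F"
      using x by (simp add: letter_def free_algebra_simps)
    have "?\<xi> \<alpha> ` (tgwc_ideal R \<sigma> t \<mu> +>\<^bsub>F\<^esub> letter x) = tgwc_ideal R \<sigma> t \<mu> +>\<^bsub>F\<^esub> ?\<xi> \<alpha> (letter x)"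
      by (rule Q.image_coset[OF _ ideal xc]) (simp add: free_algebra_simps(3) diag_add)
    also have "?\<xi> \<alpha> (letter x) = bichar L \<alpha> (letter_degree x) \<odot>\<^bsub>F\<^esub> letter x"
      by (simp add: letter_def diag_single free_algebra_simps(5) single_mult word_degree_simps)
    finally show ?thesis
      using xc by (simp add: desc tgwc_proj_def tgwc_def Q.coset_smult)
  qed
  define q where "q = (\<lambda>(x :: 'n \<Rightarrow> int ^ 'n) y. (\<chi> i j. bichar L (x i) (y j)) :: 'k ^ 'n ^ 'n)"
  show ?thesis
    unfolding admissible_twisting_def Let_def
    by (intro conjI allI ballI iso hom,
        rule exI[of _ "q (\<lambda>i. axis i 1) (\<lambda>j. axis j 1)"], rule exI[of _ "q (\<lambda>i. axis i 1) (\<lambda>j. - axis j 1)"],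
        rule exI[of _ "q (\<lambda>i. - axis i 1) (\<lambda>j. axis j 1)"], rule exI[of _ "q (\<lambda>i. - axis i 1) (\<lambda>j. - axis j 1)"])
      (simp add: letter letters_closed q_def bichar_nonzero[OF L])
qed

lemma twisted_iso_exists:
  assumes mu: "\<And>i j. \<mu> $ i $ j \<noteq> 0" and nu: "\<And>i j. \<nu> $ i $ j \<noteq> 0"
    and prod: "\<And>i j. i \<noteq> j \<Longrightarrow> \<nu> $ i $ j * \<nu> $ j $ i = \<mu> $ i $ j * \<mu> $ j $ i"
  shows "\<exists>\<xi>. admissible_twisting R \<sigma> t \<mu> \<xi> \<and>
    graded_isomorphic (tgwc R \<sigma> t \<nu>) (tgwc_part R \<sigma> t \<nu>)
      (twisted_tgwc R \<sigma> t \<mu> \<xi>) (tgwc_part R \<sigma> t \<mu>)"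
proof -
  obtain e :: "'n \<Rightarrow> nat" where e: "inj e"
    using finite_imp_inj_to_nat_seg[OF finite_class.finite_UNIV] by blast
  \<comment> \<open>Only the quotient \<open>L i j / L j i\<close> is prescribed, so one of the two can be taken to be 1.\<close>
  define L where "L = (\<lambda>i j. if e i < e j then \<nu> $ i $ j / \<mu> $ i $ j else 1)"
  have L: "L i j \<noteq> 0" for i j
    by (simp add: L_def mu nu)
  have diagonal: "L i i = 1" for i
    by (simp add: L_def)
  have ratio: "\<mu> $ i $ j * L i j = \<nu> $ i $ j * L j i" if "i \<noteq> j" for i j
  proof -
    have "e i < e j \<or> e j < e i"
      using e that by (metis injD linorder_neqE_nat)
    then show ?thesis
      using prod[OF that] mu[of i j] mu[of j i] by (auto simp: L_def field_simps)
  qed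
  define \<xi> where "\<xi> = (\<lambda>\<alpha> :: int ^ 'n. diag (\<lambda>w :: ('r, 'n) tgw_letter list. bichar L \<alpha> (word_degree w)))"
  have iso: "\<xi> \<alpha> \<in> graded_iso F F_part F F_part" for \<alpha>
    unfolding \<xi>_def by (rule degree_scaling_graded_iso) (simp_all add: bichar_add[OF L] bichar_nonzero[OF L])
  have ideal: "\<xi> \<alpha> ` tgwc_ideal R \<sigma> t \<mu> = tgwc_ideal R \<sigma> t \<mu>" for \<alpha>
    unfolding \<xi>_def by (rule degree_scaling_ideal) (rule bichar_nonzero[OF L])
  have "(`) (diag (twist_factor L)) \<in> graded_iso (tgwc R \<sigma> t \<nu>) (tgwc_part R \<sigma> t \<nu>)
      (twisted_tgwc R \<sigma> t \<mu> (descended_twisting \<xi>)) (tgwc_part R \<sigma> t \<mu>)"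
    unfolding twisted_tgwc_def unfolding tgwc_def tgwc_part_eq
    by (rule quotient_twisted_graded_iso[OF F.graded_algebra_axioms F.graded_algebra_axioms
          tgwc_ideal_ideal tgwc_ideal_graded _ twist_factor_ideal[OF L diagonal ratio] iso ideal])
      (simp_all add: \<xi>_def twist_factor_graded_iso[OF L])
  moreover have "admissible_twisting R \<sigma> t \<mu> (descended_twisting \<xi>)"
    unfolding \<xi>_def by (rule descended_bichar_admissible[OF L])
  ultimately show ?thesis
    by (auto simp: graded_isomorphic_def)
qed

end

section \<open>Normal forms of words\<close>

lemma count_list_remove1:
  "count_list (remove1 a xs) b = count_list xs b - (if a = b then 1 else 0)"
  by (induction xs) (auto simp: count_list_0_iff Suc_pred' dest: gr0I)

lemma eq_singleton_if_count_list:
  assumes "\<And>j. count_list v j = (if j = i then 1 else 0)"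
  shows "v = [i]"
proof (cases v)
  case Nil
  then show ?thesis using assms[of i] by simp
next
  case (Cons a v')
  have a: "a = i"
    using assms[of a] Cons by (simp split: if_splits)
  have "count_list v' j = 0" for j
    using assms[of j] Cons a by (simp split: if_splits)
  then have "set v' = {}"
    by (metis count_list_0_iff equals0I)
  then show ?thesis using Cons a by simp
qed

text \<open>
  What moving letters past each other requires of \<open>A'\<close>: \<open>D\<close> is the image of \<open>R\<close>, and \<open>P\<close> and \<open>M\<close> are the
  families of generators \<open>X\<^sub>i\<^sup>+\<close> and \<open>X\<^sub>i\<^sup>-\<close>. Only the existence of coefficients in \<open>D\<close> is recorded, which
  makes the conditions symmetric in \<open>P\<close> and \<open>M\<close>; every result below can then be used for both signs.
\<close>

locale crossing_generators = k_algebra A for A :: "('k::field, 'a) module" (structure) +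
  fixes D :: "'a set" and P M :: "'i \<Rightarrow> 'a"
  assumes D_closed: "d \<in> D \<Longrightarrow> d \<in> carrier A"
    and D_one: "\<one> \<in> D"
    and D_mult: "d \<in> D \<Longrightarrow> d' \<in> D \<Longrightarrow> d \<otimes> d' \<in> D"
    and P_closed: "P i \<in> carrier A" and M_closed: "M i \<in> carrier A"
    and P_coef: "d \<in> D \<Longrightarrow> \<exists>d'\<in>D. P i \<otimes> d = d' \<otimes> P i"
    and M_coef: "d \<in> D \<Longrightarrow> \<exists>d'\<in>D. M i \<otimes> d = d' \<otimes> M i"
    and PM: "P i \<otimes> M i \<in> D" and MP: "M i \<otimes> P i \<in> D"
    and PM_swap: "i \<noteq> j \<Longrightarrow> \<exists>d\<in>D. P i \<otimes> M j = d \<otimes> (M j \<otimes> P i)"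
    and MP_swap: "i \<noteq> j \<Longrightarrow> \<exists>d\<in>D. M i \<otimes> P j = d \<otimes> (P j \<otimes> M i)"
begin

lemma swapped: "crossing_generators A D M P"
  by (intro crossing_generators.intro k_algebra_axioms crossing_generators_axioms.intro)
    (fact D_closed D_one D_mult P_closed M_closed P_coef M_coef PM MP PM_swap MP_swap)+

definition monomial :: "('i \<Rightarrow> 'a) \<Rightarrow> 'i list \<Rightarrow> 'a" where
  "monomial X w = foldr (\<lambda>i y. X i \<otimes> y) w \<one>"

lemma monomial_simps: "monomial X [] = \<one>" "monomial X (i # w) = X i \<otimes> monomial X w"
  by (simp_all add: monomial_def)

lemma monomial_closed: "monomial P w \<in> carrier A" "monomial M w \<in> carrier A"
  by (induction w) (simp_all add: monomial_simps P_closed M_closed)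

lemma monomial_M_snoc: "monomial M (w @ [i]) = monomial M w \<otimes> M i"
  by (induction w) (simp_all add: monomial_simps M_closed monomial_closed m_assoc)

lemma P_left_coef:
  assumes "d \<in> D" "y \<in> carrier A"
  shows "\<exists>d'\<in>D. P i \<otimes> (d \<otimes> y) = d' \<otimes> (P i \<otimes> y)"
proof -
  obtain d' where d': "d' \<in> D" "P i \<otimes> d = d' \<otimes> P i" using P_coef[OF assms(1)] by blast
  then have "P i \<otimes> (d \<otimes> y) = d' \<otimes> (P i \<otimes> y)"
    using assms D_closed P_closed by (metis m_assoc)
  with d' show ?thesis by blast
qed

lemma M_left_coef:
  assumes "d \<in> D" "y \<in> carrier A"
  shows "\<exists>d'\<in>D. M i \<otimes> (d \<otimes> y) = d' \<otimes> (M i \<otimes> y)"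
  by (rule crossing_generators.P_left_coef[OF swapped assms])

lemma monomial_M_left_coef:
  assumes "d \<in> D" "y \<in> carrier A"
  shows "\<exists>d'\<in>D. monomial M w \<otimes> (d \<otimes> y) = d' \<otimes> (monomial M w \<otimes> y)"
proof (induction w)
  case Nil
  then show ?case using assms D_closed by (auto simp: monomial_simps)
next
  case (Cons i w)
  then obtain d' where d': "d' \<in> D" "monomial M w \<otimes> (d \<otimes> y) = d' \<otimes> (monomial M w \<otimes> y)" by blast
  obtain d'' where d'': "d'' \<in> D" "M i \<otimes> (d' \<otimes> (monomial M w \<otimes> y)) = d'' \<otimes> (M i \<otimes> (monomial M w \<otimes> y))"
    using M_left_coef[OF d'(1), of "monomial M w \<otimes> y" i] assms monomial_closed by blast
  have "monomial M (i # w) \<otimes> (d \<otimes> y) = d'' \<otimes> (monomial M (i # w) \<otimes> y)"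
    using d' d'' assms D_closed[OF assms(1)] D_closed[OF d''(1)] monomial_closed M_closed
    by (simp add: monomial_simps m_assoc)
  with d'' show ?case by blast
qed

text \<open>
  The letter \<open>P i\<close> moves to the right through a product of letters \<open>M j\<close> until it meets
  \<open>M i\<close>, with which it cancels.
\<close>

lemma P_monomial_M:
  "\<exists>d\<in>D. P i \<otimes> monomial M w =
     d \<otimes> (if i \<in> set w then monomial M (remove1 i w) else monomial M w \<otimes> P i)"
proof (induction w)
  case Nil
  then show ?case
    using D_one P_closed by (intro bexI[of _ \<one>]) (simp_all add: monomial_simps)
next
  case (Cons j w)
  let ?y = "if i \<in> set w then monomial M (remove1 i w) else monomial M w \<otimes> P i"
  have y: "?y \<in> carrier A" using monomial_closed P_closed by simp
  show ?case
  proof (cases "j = i")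
    case True
    then have "P i \<otimes> monomial M (j # w) = (P i \<otimes> M i) \<otimes> monomial M w"
      using P_closed M_closed monomial_closed by (simp add: monomial_simps m_assoc)
    with True show ?thesis using PM[of i] by auto
  next
    case False
    obtain d where d: "d \<in> D" "P i \<otimes> monomial M w = d \<otimes> ?y" using Cons by blast
    obtain c where c: "c \<in> D" "P i \<otimes> M j = c \<otimes> (M j \<otimes> P i)" using PM_swap[of i j] False by blast
    obtain d' where d': "d' \<in> D" "M j \<otimes> (d \<otimes> ?y) = d' \<otimes> (M j \<otimes> ?y)"
      using M_left_coef[OF d(1) y] by blast
    note cl = P_closed M_closed monomial_closed y D_closed[OF c(1)] D_closed[OF d(1)] D_closed[OF d'(1)]
    have "P i \<otimes> monomial M (j # w) = (P i \<otimes> M j) \<otimes> monomial M w"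
      using cl by (simp add: monomial_simps m_assoc)
    also have "\<dots> = c \<otimes> (M j \<otimes> (P i \<otimes> monomial M w))"
      unfolding c(2) using cl by (simp add: m_assoc)
    also have "\<dots> = (c \<otimes> d') \<otimes> (M j \<otimes> ?y)"
      unfolding d(2) d'(2) using cl by (simp add: m_assoc)
    also have "M j \<otimes> ?y = (if i \<in> set (j # w) then monomial M (remove1 i (j # w))
        else monomial M (j # w) \<otimes> P i)"
      using False cl by (simp add: monomial_simps m_assoc)
    finally show ?thesis
      using D_mult[OF c(1) d'(1)] by blast
  qed
qed

lemma M_monomial_P:
  "\<exists>d\<in>D. M i \<otimes> monomial P w =
     d \<otimes> (if i \<in> set w then monomial P (remove1 i w) else monomial P w \<otimes> M i)"
  using crossing_generators.P_monomial_M[OF swapped, of i w]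
  by (simp add: crossing_generators.monomial_def[OF swapped] monomial_def)

text \<open>
  A coefficient, then letters \<open>M\<close>, then letters \<open>P\<close>, with \<open>f\<close> the degree: \<open>P i\<close> counts \<open>1\<close> and
  \<open>M i\<close> counts \<open>-1\<close> at \<open>i\<close>. Letters of both kinds with the same index may still be present.
\<close>

definition ordered_form :: "'a \<Rightarrow> ('i \<Rightarrow> int) \<Rightarrow> bool" where
  "ordered_form x f \<longleftrightarrow> (\<exists>d\<in>D. \<exists>w v. x = d \<otimes> (monomial M w \<otimes> monomial P v) \<and>
     (\<forall>j. int (count_list v j) - int (count_list w j) = f j))"

lemma ordered_form_one: "ordered_form \<one> (\<lambda>_. 0)"
  unfolding ordered_form_def using D_one
  by (intro bexI[of _ \<one>] exI[of _ "[]"]) (simp_all add: monomial_simps)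

lemma ordered_form_coef:
  assumes "ordered_form x f" "d \<in> D"
  shows "ordered_form (d \<otimes> x) f"
proof -
  obtain d' w v where x: "d' \<in> D" "x = d' \<otimes> (monomial M w \<otimes> monomial P v)"
    "\<forall>j. int (count_list v j) - int (count_list w j) = f j"
    using assms(1) unfolding ordered_form_def by blast
  have "d \<otimes> x = (d \<otimes> d') \<otimes> (monomial M w \<otimes> monomial P v)"
    using x(1,2) assms(2) D_closed monomial_closed by (simp add: m_assoc)
  then show ?thesis
    unfolding ordered_form_def using D_mult[OF assms(2) x(1)] x(3) by blast
qed

lemma ordered_form_M:
  assumes "ordered_form x f"
  shows "ordered_form (M i \<otimes> x) (\<lambda>j. f j - (if j = i then 1 else 0))"
proof -
  obtain d w v where x: "d \<in> D" "x = d \<otimes> (monomial M w \<otimes> monomial P v)"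
    "\<forall>j. int (count_list v j) - int (count_list w j) = f j"
    using assms unfolding ordered_form_def by blast
  obtain d' where d': "d' \<in> D"
    "M i \<otimes> (d \<otimes> (monomial M w \<otimes> monomial P v)) = d' \<otimes> (M i \<otimes> (monomial M w \<otimes> monomial P v))"
    using M_left_coef[OF x(1), of "monomial M w \<otimes> monomial P v" i] monomial_closed by blast
  have "M i \<otimes> x = d' \<otimes> (monomial M (i # w) \<otimes> monomial P v)"
    using x(2) d'(2) M_closed monomial_closed by (simp add: monomial_simps m_assoc)
  moreover have "\<forall>j. int (count_list v j) - int (count_list (i # w) j) = f j - (if j = i then 1 else 0)"
    using x(3) by auto
  ultimately show ?thesis
    unfolding ordered_form_def using d'(1) by blast
qed

text \<open>
  The new letter passes through the letters \<open>M\<close>. Either it cancels one of them or it arrives in front of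
  the letters \<open>P\<close>; the degree grows by 1 at \<open>i\<close> in both cases.
\<close>

lemma ordered_form_P:
  assumes "ordered_form x f"
  shows "ordered_form (P i \<otimes> x) (\<lambda>j. f j + (if j = i then 1 else 0))"
proof -
  obtain d w v where x: "d \<in> D" "x = d \<otimes> (monomial M w \<otimes> monomial P v)"
    "\<forall>j. int (count_list v j) - int (count_list w j) = f j"
    using assms unfolding ordered_form_def by blast
  note cl = P_closed M_closed monomial_closed
  obtain d' where d': "d' \<in> D"
    "P i \<otimes> (d \<otimes> (monomial M w \<otimes> monomial P v)) = d' \<otimes> (P i \<otimes> (monomial M w \<otimes> monomial P v))"
    using P_left_coef[OF x(1), of "monomial M w \<otimes> monomial P v" i] monomial_closed by blast
  obtain e where e: "e \<in> D" "P i \<otimes> monomial M w =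
      e \<otimes> (if i \<in> set w then monomial M (remove1 i w) else monomial M w \<otimes> P i)"
    using P_monomial_M by blast
  note Dc = D_closed[OF d'(1)] D_closed[OF e(1)]
  have "P i \<otimes> x = d' \<otimes> ((P i \<otimes> monomial M w) \<otimes> monomial P v)"
    using x(2) d'(2) cl by (simp add: m_assoc)
  also have "\<dots> = (d' \<otimes> e) \<otimes> (if i \<in> set w then monomial M (remove1 i w) \<otimes> monomial P v
      else monomial M w \<otimes> monomial P (i # v))"
    unfolding e(2) using cl Dc by (simp add: monomial_simps m_assoc)
  finally have Px: "P i \<otimes> x = (d' \<otimes> e) \<otimes> (if i \<in> set w
      then monomial M (remove1 i w) \<otimes> monomial P v else monomial M w \<otimes> monomial P (i # v))" .
  show ?thesis
  proof (cases "i \<in> set w")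
    case True
    then have "count_list w i > 0"
      by (simp add: count_list_0_iff zero_less_iff_neq_zero)
    then have "\<forall>j. int (count_list v j) - int (count_list (remove1 i w) j) = f j + (if j = i then 1 else 0)"
      using x(3) by (auto simp: count_list_remove1 of_nat_diff)
    moreover have "P i \<otimes> x = (d' \<otimes> e) \<otimes> (monomial M (remove1 i w) \<otimes> monomial P v)"
      using Px True by simp
    ultimately show ?thesis
      unfolding ordered_form_def using D_mult[OF d'(1) e(1)] by blast
  next
    case False
    have "\<forall>j. int (count_list (i # v) j) - int (count_list w j) = f j + (if j = i then 1 else 0)"
      using x(3) by auto
    moreover have "P i \<otimes> x = (d' \<otimes> e) \<otimes> (monomial M w \<otimes> monomial P (i # v))"
      using Px False by simp
    ultimately show ?thesis
      unfolding ordered_form_def using D_mult[OF d'(1) e(1)] by blast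
  qed
qed

text \<open>
  The last letter \<open>M\<close> moves to the right and cancels; its partner exists by the assumption on the
  numbers of letters. The letters \<open>P\<close> do not commute with each other, so the first partner met
  is the one removed.
\<close>

lemma monomial_cancel:
  assumes "\<And>j. count_list w j \<le> count_list v j"
  shows "\<exists>d\<in>D. \<exists>v'. monomial M w \<otimes> monomial P v = d \<otimes> monomial P v' \<and>
    (\<forall>j. count_list v' j = count_list v j - count_list w j)"
  using assms
proof (induction w arbitrary: v rule: rev_induct)
  case Nil
  then show ?case
    using D_one monomial_closed by (intro bexI[of _ \<one>] exI[of _ v]) (simp_all add: monomial_simps)
next
  case (snoc i w)
  have "count_list v i \<noteq> 0"
    using snoc.prems[of i] by simp
  then have iv: "i \<in> set v"
    by (simp add: count_list_0_iff)
  obtain d where d: "d \<in> D" "M i \<otimes> monomial P v = d \<otimes> monomial P (remove1 i v)"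
    using M_monomial_P[of i v] iv by auto
  have "count_list w j \<le> count_list (remove1 i v) j" for j
    using snoc.prems[of j] by (auto simp: count_list_remove1)
  then obtain e v' where e: "e \<in> D" "monomial M w \<otimes> monomial P (remove1 i v) = e \<otimes> monomial P v'"
    "\<forall>j. count_list v' j = count_list (remove1 i v) j - count_list w j"
    using snoc.IH by blast
  obtain d' where d': "d' \<in> D" "monomial M w \<otimes> (d \<otimes> monomial P (remove1 i v)) =
      d' \<otimes> (monomial M w \<otimes> monomial P (remove1 i v))"
    using monomial_M_left_coef[OF d(1) monomial_closed(1)] by blast
  have "monomial M (w @ [i]) \<otimes> monomial P v = monomial M w \<otimes> (M i \<otimes> monomial P v)"
    using M_closed monomial_closed by (simp add: monomial_M_snoc m_assoc)
  also have "\<dots> = (d' \<otimes> e) \<otimes> monomial P v'"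
    unfolding d(2) d'(2) e(2)
    using D_closed[OF d'(1)] D_closed[OF e(1)] monomial_closed by (simp add: m_assoc)
  finally have "monomial M (w @ [i]) \<otimes> monomial P v = (d' \<otimes> e) \<otimes> monomial P v'" .
  moreover have "\<forall>j. count_list v' j = count_list v j - count_list (w @ [i]) j"
    using e(3) by (simp add: count_list_remove1)
  ultimately show ?case
    using D_mult[OF d'(1) e(1)] by blast
qed

text \<open>
  In degree \<open>e\<^sub>i\<close> every letter \<open>M\<close> finds a partner, and after cancellation a single \<open>P i\<close> is left.
\<close>

lemma ordered_form_axis:
  assumes "ordered_form x (\<lambda>j. if j = i then 1 else 0)"
  shows "\<exists>d\<in>D. x = d \<otimes> P i"
proof -
  obtain d w v where x: "d \<in> D" "x = d \<otimes> (monomial M w \<otimes> monomial P v)"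
    "\<And>j. int (count_list v j) - int (count_list w j) = (if j = i then 1 else 0)"
    using assms unfolding ordered_form_def by blast
  have count: "count_list v j = count_list w j + (if j = i then 1 else 0)" for j
    using x(3)[of j] by (auto split: if_splits)
  then have "count_list w j \<le> count_list v j" for j
    by simp
  from monomial_cancel[of w v, OF this] obtain e v' where
    e: "e \<in> D" "monomial M w \<otimes> monomial P v = e \<otimes> monomial P v'"
    "\<forall>j. count_list v' j = count_list v j - count_list w j"
    by blast
  have "v' = [i]"
    by (rule eq_singleton_if_count_list) (simp add: e(3) count)
  then have "x = (d \<otimes> e) \<otimes> P i"
    using x(2) e(2) D_closed[OF x(1)] D_closed[OF e(1)] P_closed
    by (simp add: monomial_simps m_assoc)
  then show ?thesis
    using D_mult[OF x(1) e(1)] by blast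
qed

lemma P_product:
  assumes "\<exists>d\<in>D. x = d \<otimes> P i" "\<exists>d\<in>D. y = d \<otimes> z" "z \<in> carrier A"
  shows "\<exists>d\<in>D. x \<otimes> y = d \<otimes> (P i \<otimes> z)"
proof -
  obtain d e where d: "d \<in> D" "x = d \<otimes> P i" and e: "e \<in> D" "y = e \<otimes> z"
    using assms(1,2) by blast
  obtain e' where e': "e' \<in> D" "P i \<otimes> (e \<otimes> z) = e' \<otimes> (P i \<otimes> z)"
    using P_left_coef[OF e(1) assms(3)] by blast
  have "x \<otimes> y = d \<otimes> (P i \<otimes> (e \<otimes> z))"
    using d e assms(3) D_closed P_closed by (simp add: m_assoc)
  also have "\<dots> = (d \<otimes> e') \<otimes> (P i \<otimes> z)"
    unfolding e'(2) using D_closed[OF d(1)] D_closed[OF e'(1)] P_closed assms(3) by (simp add: m_assoc)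
  finally show ?thesis
    using D_mult[OF d(1) e'(1)] by blast
qed

lemma M_product:
  assumes "\<exists>d\<in>D. x = d \<otimes> M i" "\<exists>d\<in>D. y = d \<otimes> z" "z \<in> carrier A"
  shows "\<exists>d\<in>D. x \<otimes> y = d \<otimes> (M i \<otimes> z)"
  by (rule crossing_generators.P_product[OF swapped assms])

end

section \<open>The parameters determined by the algebra\<close>

text \<open>
  If \<open>x'\<close> has degree \<open>\<beta>\<close>, then \<open>h (x x') = \<xi> \<beta> (h x) h x'\<close>, and \<open>x\<close> can be chosen with
  \<open>\<xi> \<beta> (h x) = y\<close>. Iterating this from the right, every product of homogeneous elements of the
  target is the image of a product of elements of the same degrees.
\<close>

lemma twisted_iso_lift_product:
  assumes "graded_algebra A gr" "graded_algebra B gr'"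
    and h: "h \<in> graded_iso A gr (graded_twist B gr' \<xi>) gr'"
    and \<xi>: "\<And>\<alpha>. \<xi> \<alpha> \<in> graded_iso B gr' B gr'"
    and y: "y \<in> gr' \<alpha>" and x': "x' \<in> gr \<beta>"
  shows "\<exists>x\<in>gr \<alpha>. h (x \<otimes>\<^bsub>A\<^esub> x') = y \<otimes>\<^bsub>B\<^esub> h x'"
proof -
  interpret A: graded_algebra A gr by fact
  interpret B: graded_algebra B gr' by fact
  note hD = graded_isoD[OF h, unfolded graded_twist_simps]
  have "y \<in> \<xi> \<beta> ` gr' \<alpha>"
    using y graded_isoD(7)[OF \<xi>] by simp
  then obtain z where z: "z \<in> gr' \<alpha>" "y = \<xi> \<beta> z"
    by (rule imageE) blast
  have "z \<in> h ` gr \<alpha>"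
    using z(1) hD(7) by simp
  then obtain x where x: "x \<in> gr \<alpha>" "z = h x"
    by (rule imageE) blast
  have xc: "x \<in> carrier A" "x' \<in> carrier A"
    using A.part_closed[OF x(1)] A.part_closed[OF x'] by simp_all
  have "h x' \<in> h ` gr \<beta>"
    using x' by (rule imageI)
  then have hx': "h x' \<in> gr' \<beta>"
    by (simp add: hD(7))
  have "h (x \<otimes>\<^bsub>A\<^esub> x') = B.twisted_mult \<xi> (h x) (h x')"
    using xc by (rule hD(4))
  also have "\<dots> = \<xi> \<beta> (h x) \<otimes>\<^bsub>B\<^esub> h x'"
    using xc hx' by (intro B.twisted_mult_homogeneous hD(2) graded_isoD(2)[OF \<xi>])
  finally show ?thesis
    using x z by blast
qed

context twisted_weyl_datum
begin

abbreviation A :: "'k ^ 'n ^ 'n \<Rightarrow> ('k, ('k, 'r, 'n) tgw_free set set) module" where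
  "A \<mu> \<equiv> tgwa R \<sigma> t \<mu>"

definition proj :: "'k ^ 'n ^ 'n \<Rightarrow> ('k, 'r, 'n) tgw_free \<Rightarrow> ('k, 'r, 'n) tgw_free set set" where
  "proj \<mu> f = tgwa_proj R \<sigma> t \<mu> (tgwc_proj R \<sigma> t \<mu> f)"

definition coef :: "'k ^ 'n ^ 'n \<Rightarrow> 'r \<Rightarrow> ('k, 'r, 'n) tgw_free set set" where
  "coef \<mu> r = proj \<mu> (letter (Coef r))"

definition xp :: "'k ^ 'n ^ 'n \<Rightarrow> 'n \<Rightarrow> ('k, 'r, 'n) tgw_free set set" where
  "xp \<mu> i = proj \<mu> (letter (Xp i))"

definition xm :: "'k ^ 'n ^ 'n \<Rightarrow> 'n \<Rightarrow> ('k, 'r, 'n) tgw_free set set" where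
  "xm \<mu> i = proj \<mu> (letter (Xm i))"

lemma tgwa_quotient: "quotient_algebra (tgwc R \<sigma> t \<mu>) (tgwa_ideal R \<sigma> t \<mu>)"
proof -
  interpret C: graded_algebra "tgwc R \<sigma> t \<mu>" "tgwc_part R \<sigma> t \<mu>" by (rule tgwc_graded)
  show ?thesis
    by (intro quotient_algebra.intro C.k_algebra_axioms tgwa_ideal_ideal)
qed

lemma tgwa_k_algebra: "k_algebra (A \<mu>)"
  using tgwa_graded[of \<mu>] by (simp add: graded_algebra_def)

lemma
  assumes f: "f \<in> carrier F"
  shows proj_closed: "proj \<mu> f \<in> carrier (A \<mu>)"
    and proj_smult: "proj \<mu> (Poly_Mapping.single [] c * f) = c \<odot>\<^bsub>A \<mu>\<^esub> proj \<mu> f"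
    and proj_add: "g \<in> carrier F \<Longrightarrow> proj \<mu> (f + g) = proj \<mu> f \<oplus>\<^bsub>A \<mu>\<^esub> proj \<mu> g"
    and proj_mult: "g \<in> carrier F \<Longrightarrow> proj \<mu> (f * g) = proj \<mu> f \<otimes>\<^bsub>A \<mu>\<^esub> proj \<mu> g"
proof -
  interpret C: quotient_algebra F "tgwc_ideal R \<sigma> t \<mu>" by (rule tgwc_quotient)
  interpret Q: quotient_algebra "tgwc R \<sigma> t \<mu>" "tgwa_ideal R \<sigma> t \<mu>" by (rule tgwa_quotient)
  have c: "tgwc_proj R \<sigma> t \<mu> h \<in> carrier (tgwc R \<sigma> t \<mu>)" if "h \<in> carrier F" for h
    using C.coset_closed[OF that] by (simp add: tgwc_proj_def tgwc_def)
  note unfolds = proj_def tgwa_proj_def tgwa_def tgwc_proj_def tgwc_def free_algebra_simps(3-5)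
  show "proj \<mu> f \<in> carrier (A \<mu>)"
    using Q.coset_closed[OF c[OF f]] by (simp add: proj_def tgwa_proj_def tgwa_def)
  show "proj \<mu> (Poly_Mapping.single [] c * f) = c \<odot>\<^bsub>A \<mu>\<^esub> proj \<mu> f"
    using C.coset_smult[OF f, of c] Q.coset_smult[OF c[OF f], of c] by (simp add: unfolds)
  assume g: "g \<in> carrier F"
  show "proj \<mu> (f + g) = proj \<mu> f \<oplus>\<^bsub>A \<mu>\<^esub> proj \<mu> g"
    using C.coset_add[OF f g] Q.coset_add[OF c[OF f] c[OF g]] by (simp add: unfolds)
  show "proj \<mu> (f * g) = proj \<mu> f \<otimes>\<^bsub>A \<mu>\<^esub> proj \<mu> g"
    using C.coset_mult[OF f g] Q.coset_mult[OF c[OF f] c[OF g]] by (simp add: unfolds)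
qed

lemma proj_one: "proj \<mu> 1 = \<one>\<^bsub>A \<mu>\<^esub>"
proof -
  interpret C: quotient_algebra F "tgwc_ideal R \<sigma> t \<mu>" by (rule tgwc_quotient)
  interpret Q: quotient_algebra "tgwc R \<sigma> t \<mu>" "tgwa_ideal R \<sigma> t \<mu>" by (rule tgwa_quotient)
  show ?thesis
    using C.coset_one Q.coset_one
    by (simp add: proj_def tgwa_proj_def tgwa_def tgwc_proj_def tgwc_def free_algebra_simps(2))
qed

lemma proj_relation:
  assumes "f - g \<in> tgw_relations R \<sigma> t \<mu>" "g \<in> carrier F"
  shows "proj \<mu> f = proj \<mu> g"
proof -
  interpret C: quotient_algebra F "tgwc_ideal R \<sigma> t \<mu>" by (rule tgwc_quotient)
  have fg: "f - g \<in> carrier F"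
    using assms(1) relations_closed by blast
  then have f: "f \<in> carrier F"
    using F.a_closed[OF fg assms(2)] by (simp add: free_algebra_simps(3))
  have "f \<ominus>\<^bsub>F\<^esub> g = f - g"
    using F.smult_minus_one[OF assms(2)]
    by (simp add: a_minus_def free_algebra_simps(3,5) single_uminus single_Nil_1 flip: F.smult_minus_one)
  moreover have "f - g \<in> tgwc_ideal R \<sigma> t \<mu>"
    unfolding tgwc_ideal_def using F.genideal_self[OF relations_closed] assms(1) by blast
  ultimately have "tgwc_proj R \<sigma> t \<mu> f = tgwc_proj R \<sigma> t \<mu> g"
    using C.coset_eq_iff[OF f assms(2)] by (simp add: tgwc_proj_def)
  then show ?thesis
    by (simp add: proj_def)
qed

lemma letter_carrier:
  "r \<in> carrier R \<Longrightarrow> letter (Coef r) \<in> carrier F" "letter (Xp i) \<in> carrier F" "letter (Xm i) \<in> carrier F"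
  by (simp_all add: letter_def free_algebra_simps letters_closed)

lemma F_closed:
  "f \<in> carrier F \<Longrightarrow> g \<in> carrier F \<Longrightarrow> f * g \<in> carrier F"
  "f \<in> carrier F \<Longrightarrow> g \<in> carrier F \<Longrightarrow> f + g \<in> carrier F"
  "f \<in> carrier F \<Longrightarrow> Poly_Mapping.single [] c * f \<in> carrier F"
  "1 \<in> carrier F"
  using F.m_closed F.a_closed F.smult_closed F.one_closed by (simp_all add: free_algebra_simps(2-5))

lemmas proj_simps = proj_add proj_mult proj_smult letter_carrier F_closed
  \<sigma>_closed \<sigma>_inv_closed t_closed R.smult_closed

lemma coef_closed: "r \<in> carrier R \<Longrightarrow> coef \<mu> r \<in> carrier (A \<mu>)"
  and xp_closed: "xp \<mu> i \<in> carrier (A \<mu>)"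
  and xm_closed: "xm \<mu> i \<in> carrier (A \<mu>)"
  by (simp_all add: coef_def xp_def xm_def proj_closed letter_carrier)

lemma coef_add: "r \<in> carrier R \<Longrightarrow> s \<in> carrier R \<Longrightarrow> coef \<mu> (r \<oplus>\<^bsub>R\<^esub> s) = coef \<mu> r \<oplus>\<^bsub>A \<mu>\<^esub> coef \<mu> s"
  using proj_relation[OF tgw_relations.coef_add] by (simp add: coef_def proj_simps)

lemma coef_mult: "r \<in> carrier R \<Longrightarrow> s \<in> carrier R \<Longrightarrow> coef \<mu> (r \<otimes>\<^bsub>R\<^esub> s) = coef \<mu> r \<otimes>\<^bsub>A \<mu>\<^esub> coef \<mu> s"
  using proj_relation[OF tgw_relations.coef_mult] by (simp add: coef_def proj_simps)

lemma coef_one: "coef \<mu> \<one>\<^bsub>R\<^esub> = \<one>\<^bsub>A \<mu>\<^esub>"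
  using proj_relation[OF tgw_relations.coef_one] by (simp add: coef_def proj_simps proj_one)

lemma coef_smult: "r \<in> carrier R \<Longrightarrow> coef \<mu> (c \<odot>\<^bsub>R\<^esub> r) = c \<odot>\<^bsub>A \<mu>\<^esub> coef \<mu> r"
  using proj_relation[OF tgw_relations.coef_smult] by (simp add: coef_def proj_simps)

lemma coef_zero: "coef \<mu> \<zero>\<^bsub>R\<^esub> = \<zero>\<^bsub>A \<mu>\<^esub>"
proof -
  interpret A: k_algebra "A \<mu>" by (rule tgwa_k_algebra)
  show ?thesis
    using coef_smult[of "\<zero>\<^bsub>R\<^esub>" \<mu> 0] coef_closed[of "\<zero>\<^bsub>R\<^esub>" \<mu>]
    by (simp add: R.smult_zero_right A.smult_zero_left)
qed

lemma xp_coef: "r \<in> carrier R \<Longrightarrow> xp \<mu> i \<otimes>\<^bsub>A \<mu>\<^esub> coef \<mu> r = coef \<mu> (\<sigma> i r) \<otimes>\<^bsub>A \<mu>\<^esub> xp \<mu> i"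
  using proj_relation[OF tgw_relations.Xp_coef] by (simp add: coef_def xp_def proj_simps)

lemma xm_coef: "r \<in> carrier R \<Longrightarrow> xm \<mu> i \<otimes>\<^bsub>A \<mu>\<^esub> coef \<mu> r = coef \<mu> (\<sigma>_inv i r) \<otimes>\<^bsub>A \<mu>\<^esub> xm \<mu> i"
  using proj_relation[OF tgw_relations.Xm_coef] by (simp add: coef_def xm_def proj_simps)

lemma xm_xp: "xm \<mu> i \<otimes>\<^bsub>A \<mu>\<^esub> xp \<mu> i = coef \<mu> (t i)"
  using proj_relation[OF tgw_relations.Xm_Xp] by (simp add: coef_def xp_def xm_def proj_simps)

lemma xp_xm: "xp \<mu> i \<otimes>\<^bsub>A \<mu>\<^esub> xm \<mu> i = coef \<mu> (\<sigma> i (t i))"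
  using proj_relation[OF tgw_relations.Xp_Xm] by (simp add: coef_def xp_def xm_def proj_simps)

lemma xp_xm_swap:
  "i \<noteq> j \<Longrightarrow> xp \<mu> i \<otimes>\<^bsub>A \<mu>\<^esub> xm \<mu> j = (\<mu> $ i $ j) \<odot>\<^bsub>A \<mu>\<^esub> (xm \<mu> j \<otimes>\<^bsub>A \<mu>\<^esub> xp \<mu> i)"
  using proj_relation[OF tgw_relations.Xp_Xm_swap] by (simp add: xp_def xm_def proj_simps mult.assoc)

lemma crossing:
  assumes nonzero: "\<And>i j. \<mu> $ i $ j \<noteq> 0"
  shows "crossing_generators (A \<mu>) (coef \<mu> ` carrier R) (xp \<mu>) (xm \<mu>)"
proof -
  interpret A: k_algebra "A \<mu>" by (rule tgwa_k_algebra)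
  have scalar: "\<exists>d\<in>coef \<mu> ` carrier R. c \<odot>\<^bsub>A \<mu>\<^esub> x = d \<otimes>\<^bsub>A \<mu>\<^esub> x" if "x \<in> carrier (A \<mu>)" for c x
    using that by (intro bexI[of _ "coef \<mu> (c \<odot>\<^bsub>R\<^esub> \<one>\<^bsub>R\<^esub>)"] imageI R.smult_closed)
      (simp_all add: coef_smult coef_one A.smult_one_mult)
  have xm_xp_swap: "xm \<mu> i \<otimes>\<^bsub>A \<mu>\<^esub> xp \<mu> j = inverse (\<mu> $ j $ i) \<odot>\<^bsub>A \<mu>\<^esub> (xp \<mu> j \<otimes>\<^bsub>A \<mu>\<^esub> xm \<mu> i)"
    if "i \<noteq> j" for i j
    using that nonzero[of j i] xp_closed xm_closed
    by (simp add: xp_xm_swap A.smult_one flip: A.smult_assoc)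
  show ?thesis
  proof (intro crossing_generators.intro A.k_algebra_axioms crossing_generators_axioms.intro)
    show "\<one>\<^bsub>A \<mu>\<^esub> \<in> coef \<mu> ` carrier R"
      by (metis coef_one R.one_closed imageI)
    fix d d' assume "d \<in> coef \<mu> ` carrier R" "d' \<in> coef \<mu> ` carrier R"
    then obtain r r' where "r \<in> carrier R" "r' \<in> carrier R" "d = coef \<mu> r" "d' = coef \<mu> r'" by blast
    then show "d \<otimes>\<^bsub>A \<mu>\<^esub> d' \<in> coef \<mu> ` carrier R"
      by (simp flip: coef_mult)
  next
    fix i j :: 'n assume "i \<noteq> j"
    then show "\<exists>d\<in>coef \<mu> ` carrier R. xp \<mu> i \<otimes>\<^bsub>A \<mu>\<^esub> xm \<mu> j = d \<otimes>\<^bsub>A \<mu>\<^esub> (xm \<mu> j \<otimes>\<^bsub>A \<mu>\<^esub> xp \<mu> i)"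
      unfolding xp_xm_swap[OF \<open>i \<noteq> j\<close>] by (intro scalar A.m_closed xp_closed xm_closed)
    show "\<exists>d\<in>coef \<mu> ` carrier R. xm \<mu> i \<otimes>\<^bsub>A \<mu>\<^esub> xp \<mu> j = d \<otimes>\<^bsub>A \<mu>\<^esub> (xp \<mu> j \<otimes>\<^bsub>A \<mu>\<^esub> xm \<mu> i)"
      unfolding xm_xp_swap[OF \<open>i \<noteq> j\<close>] by (intro scalar A.m_closed xp_closed xm_closed)
  qed (auto simp: coef_closed xp_closed xm_closed xp_coef xm_coef xp_xm xm_xp
      intro: \<sigma>_closed \<sigma>_inv_closed t_closed)
qed

lemma tgwa_part_proj: "tgwa_part R \<sigma> t \<mu> \<alpha> = proj \<mu> ` F_part \<alpha>"
  by (simp add: tgwa_part_def tgwc_part_def free_part_def proj_def image_image)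

text \<open>
  The second form, with the letters \<open>X\<^sup>+\<close> first, serves the negative degrees. A degree is then
  counted with the opposite sign, because the two families of generators are exchanged.
\<close>

lemma word_ordered_form:
  assumes nonzero: "\<And>i j. \<mu> $ i $ j \<noteq> 0" and "set w \<subseteq> tgw_letters R"
  shows "crossing_generators.ordered_form (A \<mu>) (coef \<mu> ` carrier R) (xp \<mu>) (xm \<mu>)
      (proj \<mu> (Poly_Mapping.single w 1)) (\<lambda>j. word_degree w $ j)"
    and "crossing_generators.ordered_form (A \<mu>) (coef \<mu> ` carrier R) (xm \<mu>) (xp \<mu>)
      (proj \<mu> (Poly_Mapping.single w 1)) (\<lambda>j. - (word_degree w $ j))"
proof -
  interpret PM: crossing_generators "A \<mu>" "coef \<mu> ` carrier R" "xp \<mu>" "xm \<mu>"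
    by (rule crossing[OF nonzero])
  interpret MP: crossing_generators "A \<mu>" "coef \<mu> ` carrier R" "xm \<mu>" "xp \<mu>"
    by (rule PM.swapped)
  have "PM.ordered_form (proj \<mu> (Poly_Mapping.single w 1)) (\<lambda>j. word_degree w $ j) \<and>
      MP.ordered_form (proj \<mu> (Poly_Mapping.single w 1)) (\<lambda>j. - (word_degree w $ j))"
    using assms(2)
  proof (induction w)
    case Nil
    then show ?case
      using PM.ordered_form_one MP.ordered_form_one
      by (simp add: single_Nil_1 proj_one word_degree_simps)
  next
    case (Cons x w)
    have step: "proj \<mu> (Poly_Mapping.single (x # w) 1) = proj \<mu> (letter x) \<otimes>\<^bsub>A \<mu>\<^esub> proj \<mu> (Poly_Mapping.single w 1)"
    proof -
      have "Poly_Mapping.single (x # w) 1 = letter x * (Poly_Mapping.single w 1 :: ('k, 'r, 'n) tgw_free)"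
        by (simp add: letter_def single_mult)
      moreover have "letter x \<in> carrier F" "Poly_Mapping.single w 1 \<in> carrier F"
        using Cons.prems by (auto simp: letter_def free_algebra_simps)
      ultimately show ?thesis
        by (simp only: proj_mult)
    qed
    have IH: "PM.ordered_form (proj \<mu> (Poly_Mapping.single w 1)) (\<lambda>j. word_degree w $ j)"
      "MP.ordered_form (proj \<mu> (Poly_Mapping.single w 1)) (\<lambda>j. - (word_degree w $ j))"
      using Cons by simp_all
    show ?case
    proof (cases x)
      case (Coef r)
      then have r: "coef \<mu> r \<in> coef \<mu> ` carrier R"
        using Cons.prems by (auto simp: tgw_letters_def)
      show ?thesis
        using PM.ordered_form_coef[OF IH(1) r] MP.ordered_form_coef[OF IH(2) r]
        by (simp add: step[unfolded Coef] Coef word_degree_simps flip: coef_def)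
    next
      case (Xp i)
      have "(\<lambda>j. word_degree (x # w) $ j) = (\<lambda>j. word_degree w $ j + (if j = i then 1 else 0))"
        "(\<lambda>j. - (word_degree (x # w) $ j)) = (\<lambda>j. - (word_degree w $ j) - (if j = i then 1 else 0))"
        by (auto simp: Xp word_degree_simps axis_def)
      then show ?thesis
        using PM.ordered_form_P[OF IH(1), of i] MP.ordered_form_M[OF IH(2), of i]
        by (simp add: step[unfolded Xp] Xp flip: xp_def)
    next
      case (Xm i)
      have "(\<lambda>j. word_degree (x # w) $ j) = (\<lambda>j. word_degree w $ j - (if j = i then 1 else 0))"
        "(\<lambda>j. - (word_degree (x # w) $ j)) = (\<lambda>j. - (word_degree w $ j) + (if j = i then 1 else 0))"
        by (auto simp: Xm word_degree_simps axis_def)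
      then show ?thesis
        using PM.ordered_form_M[OF IH(1), of i] MP.ordered_form_P[OF IH(2), of i]
        by (simp add: step[unfolded Xm] Xm flip: xm_def)
    qed
  qed
  then show "PM.ordered_form (proj \<mu> (Poly_Mapping.single w 1)) (\<lambda>j. word_degree w $ j)"
    "MP.ordered_form (proj \<mu> (Poly_Mapping.single w 1)) (\<lambda>j. - (word_degree w $ j))"
    by simp_all
qed

text \<open>
  A homogeneous element is a combination of words of its degree, and the multiples of \<open>z\<close> by
  coefficients from \<open>R\<close> are closed under linear combinations.
\<close>

lemma part_generated:
  assumes words: "\<And>w. set w \<subseteq> tgw_letters R \<Longrightarrow> word_degree w = \<alpha> \<Longrightarrow>
      \<exists>d\<in>coef \<mu> ` carrier R. proj \<mu> (Poly_Mapping.single w 1) = d \<otimes>\<^bsub>A \<mu>\<^esub> z"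
    and z: "z \<in> carrier (A \<mu>)" and x: "x \<in> tgwa_part R \<sigma> t \<mu> \<alpha>"
  shows "\<exists>d\<in>coef \<mu> ` carrier R. x = d \<otimes>\<^bsub>A \<mu>\<^esub> z"
proof -
  interpret A: k_algebra "A \<mu>" by (rule tgwa_k_algebra)
  define W where "W = {w. set w \<subseteq> tgw_letters R \<and> word_degree w = \<alpha>}"
  obtain f where f: "f \<in> F_part \<alpha>" "x = proj \<mu> f"
    using x by (auto simp: tgwa_part_proj)
  have W: "g \<in> carrier F" if "Poly_Mapping.keys g \<subseteq> W" for g :: "('k, 'r, 'n) tgw_free"
    using that by (auto simp: W_def free_algebra_simps)
  have zero: "proj \<mu> 0 = \<zero>\<^bsub>A \<mu>\<^esub>"
    using proj_smult[of 0 \<mu> 0] F.zero_closed A.smult_zero_left[OF proj_closed, of 0]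
    by (simp add: free_algebra_simps(1))
  have "Poly_Mapping.keys f \<subseteq> W"
    using f(1) by (auto simp: free_part_def free_algebra_simps W_def)
  then have "\<exists>r\<in>carrier R. proj \<mu> f = coef \<mu> r \<otimes>\<^bsub>A \<mu>\<^esub> z"
  proof (induction f rule: support_induct)
    case zero
    show ?case
      using z by (intro bexI[of _ "\<zero>\<^bsub>R\<^esub>"]) (simp_all add: \<open>proj \<mu> 0 = \<zero>\<^bsub>A \<mu>\<^esub>\<close> coef_zero)
  next
    case (single w a)
    then obtain r where r: "r \<in> carrier R" "proj \<mu> (Poly_Mapping.single w 1) = coef \<mu> r \<otimes>\<^bsub>A \<mu>\<^esub> z"
      using words[of w] by (auto simp: W_def)
    have "Poly_Mapping.single w a = Poly_Mapping.single [] a * (Poly_Mapping.single w 1 :: ('k, 'r, 'n) tgw_free)"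
      by (simp add: single_mult)
    moreover have "Poly_Mapping.single w 1 \<in> carrier F"
      using single by (intro W) simp
    ultimately have "proj \<mu> (Poly_Mapping.single w a) = coef \<mu> (a \<odot>\<^bsub>R\<^esub> r) \<otimes>\<^bsub>A \<mu>\<^esub> z"
      using r z by (simp add: proj_smult coef_smult A.smult_mult_left coef_closed)
    then show ?case
      using R.smult_closed[OF r(1)] by blast
  next
    case (add f g)
    then obtain r s where r: "r \<in> carrier R" "proj \<mu> f = coef \<mu> r \<otimes>\<^bsub>A \<mu>\<^esub> z"
      and s: "s \<in> carrier R" "proj \<mu> g = coef \<mu> s \<otimes>\<^bsub>A \<mu>\<^esub> z" by blast
    have "proj \<mu> (f + g) = coef \<mu> (r \<oplus>\<^bsub>R\<^esub> s) \<otimes>\<^bsub>A \<mu>\<^esub> z"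
      using W[OF add(1)] W[OF add(2)] r s z
      by (simp add: proj_add coef_add A.l_distr coef_closed)
    then show ?case
      using r s by blast
  qed
  then show ?thesis
    using f(2) by blast
qed

lemma part_axis:
  assumes nonzero: "\<And>i j. \<mu> $ i $ j \<noteq> 0"
  shows "x \<in> tgwa_part R \<sigma> t \<mu> (axis i 1) \<Longrightarrow> \<exists>d\<in>coef \<mu> ` carrier R. x = d \<otimes>\<^bsub>A \<mu>\<^esub> xp \<mu> i"
    and "x \<in> tgwa_part R \<sigma> t \<mu> (- axis i 1) \<Longrightarrow> \<exists>d\<in>coef \<mu> ` carrier R. x = d \<otimes>\<^bsub>A \<mu>\<^esub> xm \<mu> i"
proof -
  interpret PM: crossing_generators "A \<mu>" "coef \<mu> ` carrier R" "xp \<mu>" "xm \<mu>"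
    by (rule crossing[OF nonzero])
  interpret MP: crossing_generators "A \<mu>" "coef \<mu> ` carrier R" "xm \<mu>" "xp \<mu>"
    by (rule PM.swapped)
  have axis: "(\<lambda>j. axis i 1 $ j) = (\<lambda>j. if j = i then 1 else (0::int))"
    by (auto simp: axis_def)
  show "\<exists>d\<in>coef \<mu> ` carrier R. x = d \<otimes>\<^bsub>A \<mu>\<^esub> xp \<mu> i" if "x \<in> tgwa_part R \<sigma> t \<mu> (axis i 1)"
    by (rule part_generated[OF _ xp_closed that], rule PM.ordered_form_axis)
      (use word_ordered_form(1)[OF nonzero] axis in fastforce)
  show "\<exists>d\<in>coef \<mu> ` carrier R. x = d \<otimes>\<^bsub>A \<mu>\<^esub> xm \<mu> i" if "x \<in> tgwa_part R \<sigma> t \<mu> (- axis i 1)"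
    by (rule part_generated[OF _ xm_closed that], rule MP.ordered_form_axis)
      (use word_ordered_form(2)[OF nonzero] axis in fastforce)
qed

text \<open>
  Moving \<open>X\<^sub>i\<^sup>+\<close> to the right end of \<open>X\<^sub>i\<^sup>- X\<^sub>j\<^sup>+ X\<^sub>i\<^sup>+ X\<^sub>j\<^sup>-\<close> brings \<open>X\<^sub>j\<^sup>+\<close> next to \<open>X\<^sub>j\<^sup>-\<close>; moving \<open>X\<^sub>j\<^sup>+\<close> to the
  left end brings \<open>X\<^sub>i\<^sup>-\<close> next to \<open>X\<^sub>i\<^sup>+\<close>.
\<close>

lemma crossed_product:
  assumes nonzero: "\<And>i j. \<mu> $ i $ j \<noteq> 0" and ij: "i \<noteq> j"
  defines "W \<equiv> xm \<mu> i \<otimes>\<^bsub>A \<mu>\<^esub> (xp \<mu> j \<otimes>\<^bsub>A \<mu>\<^esub> (xp \<mu> i \<otimes>\<^bsub>A \<mu>\<^esub> xm \<mu> j))"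
  shows "W = (\<mu> $ i $ j) \<odot>\<^bsub>A \<mu>\<^esub> coef \<mu> (\<sigma>_inv i (\<sigma> j (t j)) \<otimes>\<^bsub>R\<^esub> t i)"
    and "(\<mu> $ j $ i) \<odot>\<^bsub>A \<mu>\<^esub> W = coef \<mu> (\<sigma> j (t i) \<otimes>\<^bsub>R\<^esub> \<sigma> j (t j))"
proof -
  interpret A: k_algebra "A \<mu>" by (rule tgwa_k_algebra)
  note cl = xp_closed xm_closed coef_closed \<sigma>_closed \<sigma>_inv_closed t_closed A.smult_closed
  have "W = (\<mu> $ i $ j) \<odot>\<^bsub>A \<mu>\<^esub> (xm \<mu> i \<otimes>\<^bsub>A \<mu>\<^esub> ((xp \<mu> j \<otimes>\<^bsub>A \<mu>\<^esub> xm \<mu> j) \<otimes>\<^bsub>A \<mu>\<^esub> xp \<mu> i))"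
    unfolding W_def xp_xm_swap[OF ij] by (simp add: cl A.smult_mult_right A.m_assoc)
  also have "xm \<mu> i \<otimes>\<^bsub>A \<mu>\<^esub> ((xp \<mu> j \<otimes>\<^bsub>A \<mu>\<^esub> xm \<mu> j) \<otimes>\<^bsub>A \<mu>\<^esub> xp \<mu> i) =
      (xm \<mu> i \<otimes>\<^bsub>A \<mu>\<^esub> coef \<mu> (\<sigma> j (t j))) \<otimes>\<^bsub>A \<mu>\<^esub> xp \<mu> i"
    unfolding xp_xm by (simp add: cl A.m_assoc)
  also have "\<dots> = coef \<mu> (\<sigma>_inv i (\<sigma> j (t j))) \<otimes>\<^bsub>A \<mu>\<^esub> (xm \<mu> i \<otimes>\<^bsub>A \<mu>\<^esub> xp \<mu> i)"
    by (simp add: cl xm_coef A.m_assoc)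
  also have "\<dots> = coef \<mu> (\<sigma>_inv i (\<sigma> j (t j)) \<otimes>\<^bsub>R\<^esub> t i)"
    by (simp add: xm_xp coef_mult cl)
  finally show "W = (\<mu> $ i $ j) \<odot>\<^bsub>A \<mu>\<^esub> coef \<mu> (\<sigma>_inv i (\<sigma> j (t j)) \<otimes>\<^bsub>R\<^esub> t i)" .
  have "(\<mu> $ j $ i) \<odot>\<^bsub>A \<mu>\<^esub> W = ((\<mu> $ j $ i) \<odot>\<^bsub>A \<mu>\<^esub> (xm \<mu> i \<otimes>\<^bsub>A \<mu>\<^esub> xp \<mu> j)) \<otimes>\<^bsub>A \<mu>\<^esub> (xp \<mu> i \<otimes>\<^bsub>A \<mu>\<^esub> xm \<mu> j)"
    unfolding W_def by (simp add: cl A.smult_mult_left A.m_assoc)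
  also have "\<dots> = (xp \<mu> j \<otimes>\<^bsub>A \<mu>\<^esub> xm \<mu> i) \<otimes>\<^bsub>A \<mu>\<^esub> (xp \<mu> i \<otimes>\<^bsub>A \<mu>\<^esub> xm \<mu> j)"
    using ij by (simp add: xp_xm_swap)
  also have "\<dots> = (xp \<mu> j \<otimes>\<^bsub>A \<mu>\<^esub> (xm \<mu> i \<otimes>\<^bsub>A \<mu>\<^esub> xp \<mu> i)) \<otimes>\<^bsub>A \<mu>\<^esub> xm \<mu> j"
    by (simp add: cl A.m_assoc)
  also have "\<dots> = coef \<mu> (\<sigma> j (t i)) \<otimes>\<^bsub>A \<mu>\<^esub> (xp \<mu> j \<otimes>\<^bsub>A \<mu>\<^esub> xm \<mu> j)"
    by (simp add: xm_xp xp_coef cl A.m_assoc)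
  also have "\<dots> = coef \<mu> (\<sigma> j (t i) \<otimes>\<^bsub>R\<^esub> \<sigma> j (t j))"
    by (simp add: xp_xm coef_mult cl)
  finally show "(\<mu> $ j $ i) \<odot>\<^bsub>A \<mu>\<^esub> W = coef \<mu> (\<sigma> j (t i) \<otimes>\<^bsub>R\<^esub> \<sigma> j (t j))" .
qed

text \<open>
  The two values of the crossed product give an equation between images of elements of \<open>R\<close> in the
  algebra, and consistency is injectivity of that map.
\<close>

lemma consistent_relation:
  assumes nonzero: "\<And>i j. \<mu> $ i $ j \<noteq> 0" and consistent: "consistent_datum R \<sigma> t \<mu>" and ij: "i \<noteq> j"
  shows "\<sigma> j (t i) \<otimes>\<^bsub>R\<^esub> \<sigma> j (t j) =
    (\<mu> $ j $ i * \<mu> $ i $ j) \<odot>\<^bsub>R\<^esub> (\<sigma>_inv i (\<sigma> j (t j)) \<otimes>\<^bsub>R\<^esub> t i)"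
proof -
  interpret A: k_algebra "A \<mu>" by (rule tgwa_k_algebra)
  note cl = \<sigma>_closed \<sigma>_inv_closed t_closed R.smult_closed coef_closed
  have "inj_on (coef \<mu>) (carrier R)"
    using consistent by (simp add: consistent_datum_def coef_def[abs_def] proj_def)
  then show ?thesis
  proof (rule inj_onD)
    show "coef \<mu> (\<sigma> j (t i) \<otimes>\<^bsub>R\<^esub> \<sigma> j (t j)) =
        coef \<mu> ((\<mu> $ j $ i * \<mu> $ i $ j) \<odot>\<^bsub>R\<^esub> (\<sigma>_inv i (\<sigma> j (t j)) \<otimes>\<^bsub>R\<^esub> t i))"
      using crossed_product[OF nonzero ij] by (simp add: coef_smult A.smult_assoc cl)
  qed (simp_all add: cl)
qed

text \<open>
  The relation in \<open>R\<close> obtained from \<open>\<mu>\<close> is mapped to the algebra with parameters \<open>\<nu>\<close>, where it meets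
  the one obtained from \<open>\<nu>\<close>. Their difference is a nonzero multiple of the crossed product \<open>W\<close>, so \<open>W\<close>
  vanishes; the general product is a multiple of \<open>W\<close> by a coefficient.
\<close>

lemma crossed_products_vanish:
  assumes mu: "\<And>i j. \<mu> $ i $ j \<noteq> 0" and nu: "\<And>i j. \<nu> $ i $ j \<noteq> 0"
    and consistent: "consistent_datum R \<sigma> t \<mu>"
    and ij: "i \<noteq> j" and differ: "\<nu> $ i $ j * \<nu> $ j $ i \<noteq> \<mu> $ i $ j * \<mu> $ j $ i"
    and x: "x1 \<in> tgwa_part R \<sigma> t \<nu> (- axis i 1)" "x2 \<in> tgwa_part R \<sigma> t \<nu> (axis j 1)"
      "x3 \<in> tgwa_part R \<sigma> t \<nu> (axis i 1)" "x4 \<in> tgwa_part R \<sigma> t \<nu> (- axis j 1)"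
  shows "x1 \<otimes>\<^bsub>A \<nu>\<^esub> (x2 \<otimes>\<^bsub>A \<nu>\<^esub> (x3 \<otimes>\<^bsub>A \<nu>\<^esub> x4)) = \<zero>\<^bsub>A \<nu>\<^esub>"
proof -
  interpret crossing_generators "A \<nu>" "coef \<nu> ` carrier R" "xp \<nu>" "xm \<nu>"
    by (rule crossing[OF nu])
  note cl = \<sigma>_closed \<sigma>_inv_closed t_closed R.smult_closed coef_closed
  define W where "W = xm \<nu> i \<otimes>\<^bsub>A \<nu>\<^esub> (xp \<nu> j \<otimes>\<^bsub>A \<nu>\<^esub> (xp \<nu> i \<otimes>\<^bsub>A \<nu>\<^esub> xm \<nu> j))"
  define s where "s = \<sigma>_inv i (\<sigma> j (t j)) \<otimes>\<^bsub>R\<^esub> t i"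
  have s: "s \<in> carrier R" by (simp add: s_def cl)
  have W: "W \<in> carrier (A \<nu>)" by (simp add: W_def xp_closed xm_closed)
  have Ws: "W = (\<nu> $ i $ j) \<odot>\<^bsub>A \<nu>\<^esub> coef \<nu> s"
    unfolding W_def s_def by (rule crossed_product[OF nu ij])
  have "(\<nu> $ j $ i) \<odot>\<^bsub>A \<nu>\<^esub> W = (\<mu> $ j $ i * \<mu> $ i $ j) \<odot>\<^bsub>A \<nu>\<^esub> coef \<nu> s"
    using crossed_product(2)[OF nu ij] consistent_relation[OF mu consistent ij] s
    by (simp add: coef_smult W_def s_def)
  then have "(\<nu> $ i $ j * \<nu> $ j $ i) \<odot>\<^bsub>A \<nu>\<^esub> W = (\<nu> $ i $ j * (\<mu> $ j $ i * \<mu> $ i $ j)) \<odot>\<^bsub>A \<nu>\<^esub> coef \<nu> s"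
    using W s coef_closed[OF s, of \<nu>] smult_assoc[OF W, of "\<nu> $ i $ j"]
      smult_assoc[OF coef_closed[OF s, of \<nu>], of "\<nu> $ i $ j"] by simp
  also have "\<dots> = (\<mu> $ i $ j * \<mu> $ j $ i) \<odot>\<^bsub>A \<nu>\<^esub> W"
    unfolding Ws using coef_closed[OF s, of \<nu>] by (simp add: mult_ac flip: smult_assoc)
  finally have eq: "(\<nu> $ i $ j * \<nu> $ j $ i) \<odot>\<^bsub>A \<nu>\<^esub> W = (\<mu> $ i $ j * \<mu> $ j $ i) \<odot>\<^bsub>A \<nu>\<^esub> W" .
  have "(\<nu> $ i $ j * \<nu> $ j $ i - \<mu> $ i $ j * \<mu> $ j $ i) \<odot>\<^bsub>A \<nu>\<^esub> W
      \<oplus>\<^bsub>A \<nu>\<^esub> (\<mu> $ i $ j * \<mu> $ j $ i) \<odot>\<^bsub>A \<nu>\<^esub> W = (\<mu> $ i $ j * \<mu> $ j $ i) \<odot>\<^bsub>A \<nu>\<^esub> W"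
    using W eq by (simp flip: smult_l_distr)
  then have "(\<nu> $ i $ j * \<nu> $ j $ i - \<mu> $ i $ j * \<mu> $ j $ i) \<odot>\<^bsub>A \<nu>\<^esub> W = \<zero>\<^bsub>A \<nu>\<^esub>"
    using smult_closed[OF W] by simp
  then have zero: "W = \<zero>\<^bsub>A \<nu>\<^esub>"
    by (rule smult_cancel[OF W]) (use differ in \<open>metis eq_iff_diff_eq_0\<close>)
  have "\<exists>d\<in>coef \<nu> ` carrier R. x1 \<otimes>\<^bsub>A \<nu>\<^esub> (x2 \<otimes>\<^bsub>A \<nu>\<^esub> (x3 \<otimes>\<^bsub>A \<nu>\<^esub> x4)) = d \<otimes>\<^bsub>A \<nu>\<^esub> W"
    unfolding W_def
    by (intro M_product P_product part_axis[OF nu] x m_closed xp_closed xm_closed)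
  then show ?thesis
    using zero D_closed by auto
qed

text \<open>
  Otherwise all crossed products vanish in the algebra with parameters \<open>\<nu>\<close>. One of them is mapped to
  the crossed product of the generators for \<open>\<mu>\<close>, a nonzero multiple of the coefficient \<open>s\<close>, and
  \<open>s \<noteq> 0\<close> by regularity.
\<close>

lemma products_agree_if_twisted_iso:
  assumes nontrivial: "\<one>\<^bsub>R\<^esub> \<noteq> \<zero>\<^bsub>R\<^esub>"
    and mu: "\<And>i j. \<mu> $ i $ j \<noteq> 0" and nu: "\<And>i j. \<nu> $ i $ j \<noteq> 0"
    and regular: "regular_datum R t" and consistent: "consistent_datum R \<sigma> t \<mu>"
    and \<xi>: "\<And>\<alpha>. \<xi> \<alpha> \<in> graded_iso (A \<mu>) (tgwa_part R \<sigma> t \<mu>) (A \<mu>) (tgwa_part R \<sigma> t \<mu>)"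
    and h: "h \<in> graded_iso (A \<nu>) (tgwa_part R \<sigma> t \<nu>)
      (graded_twist (A \<mu>) (tgwa_part R \<sigma> t \<mu>) \<xi>) (tgwa_part R \<sigma> t \<mu>)"
    and ij: "i \<noteq> j"
  shows "\<nu> $ i $ j * \<nu> $ j $ i = \<mu> $ i $ j * \<mu> $ j $ i"
proof (rule ccontr)
  assume differ: "\<nu> $ i $ j * \<nu> $ j $ i \<noteq> \<mu> $ i $ j * \<mu> $ j $ i"
  interpret AN: graded_algebra "A \<nu>" "tgwa_part R \<sigma> t \<nu>" by (rule tgwa_graded)
  interpret AM: graded_algebra "A \<mu>" "tgwa_part R \<sigma> t \<mu>" by (rule tgwa_graded)
  note lift = twisted_iso_lift_product[OF tgwa_graded tgwa_graded h \<xi>]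
  have xp_part: "xp \<mu> l \<in> tgwa_part R \<sigma> t \<mu> (axis l 1)"
    and xm_part: "xm \<mu> l \<in> tgwa_part R \<sigma> t \<mu> (- axis l 1)" for l
    unfolding tgwa_part_proj xp_def xm_def letter_def
    by (intro imageI single_part; simp add: letters_closed word_degree_simps)+
  have "xm \<mu> j \<in> h ` tgwa_part R \<sigma> t \<nu> (- axis j 1)"
    using xm_part graded_isoD(7)[OF h] by simp
  then obtain x4 where x4: "x4 \<in> tgwa_part R \<sigma> t \<nu> (- axis j 1)" "h x4 = xm \<mu> j"
    by (metis imageE)
  obtain x3 where x3: "x3 \<in> tgwa_part R \<sigma> t \<nu> (axis i 1)"
    "h (x3 \<otimes>\<^bsub>A \<nu>\<^esub> x4) = xp \<mu> i \<otimes>\<^bsub>A \<mu>\<^esub> h x4"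
    using lift[OF xp_part x4(1)] by blast
  note x34 = AN.part_mult[OF x3(1) x4(1)]
  obtain x2 where x2: "x2 \<in> tgwa_part R \<sigma> t \<nu> (axis j 1)"
    "h (x2 \<otimes>\<^bsub>A \<nu>\<^esub> (x3 \<otimes>\<^bsub>A \<nu>\<^esub> x4)) = xp \<mu> j \<otimes>\<^bsub>A \<mu>\<^esub> h (x3 \<otimes>\<^bsub>A \<nu>\<^esub> x4)"
    using lift[OF xp_part x34] by blast
  note x234 = AN.part_mult[OF x2(1) x34]
  obtain x1 where x1: "x1 \<in> tgwa_part R \<sigma> t \<nu> (- axis i 1)"
    "h (x1 \<otimes>\<^bsub>A \<nu>\<^esub> (x2 \<otimes>\<^bsub>A \<nu>\<^esub> (x3 \<otimes>\<^bsub>A \<nu>\<^esub> x4))) =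
      xm \<mu> i \<otimes>\<^bsub>A \<mu>\<^esub> h (x2 \<otimes>\<^bsub>A \<nu>\<^esub> (x3 \<otimes>\<^bsub>A \<nu>\<^esub> x4))"
    using lift[OF xm_part x234] by blast
  define s where "s = \<sigma>_inv i (\<sigma> j (t j)) \<otimes>\<^bsub>R\<^esub> t i"
  have s: "s \<in> carrier R"
    by (simp add: s_def \<sigma>_closed \<sigma>_inv_closed t_closed)
  have "(\<mu> $ i $ j) \<odot>\<^bsub>A \<mu>\<^esub> coef \<mu> s =
      xm \<mu> i \<otimes>\<^bsub>A \<mu>\<^esub> (xp \<mu> j \<otimes>\<^bsub>A \<mu>\<^esub> (xp \<mu> i \<otimes>\<^bsub>A \<mu>\<^esub> xm \<mu> j))"
    unfolding s_def by (rule crossed_product(1)[OF mu ij, symmetric])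
  also have "\<dots> = h (x1 \<otimes>\<^bsub>A \<nu>\<^esub> (x2 \<otimes>\<^bsub>A \<nu>\<^esub> (x3 \<otimes>\<^bsub>A \<nu>\<^esub> x4)))"
    by (simp only: x1(2) x2(2) x3(2) x4(2))
  also have "\<dots> = h \<zero>\<^bsub>A \<nu>\<^esub>"
    by (simp only: crossed_products_vanish[OF mu nu consistent ij differ x1(1) x2(1) x3(1) x4(1)])
  also have "\<dots> = \<zero>\<^bsub>A \<mu>\<^esub>"
    by (rule graded_iso_zero[OF tgwa_k_algebra tgwa_k_algebra h])
  finally have "coef \<mu> s = \<zero>\<^bsub>A \<mu>\<^esub>"
    by (rule AM.smult_cancel[OF coef_closed[OF s] _ mu])
  then have "coef \<mu> s = coef \<mu> \<zero>\<^bsub>R\<^esub>"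
    by (simp add: coef_zero)
  moreover have "inj_on (coef \<mu>) (carrier R)"
    using consistent by (simp add: consistent_datum_def coef_def[abs_def] proj_def)
  ultimately have "s = \<zero>\<^bsub>R\<^esub>"
    using s by (simp add: inj_on_eq_iff)
  then have "\<sigma>_inv i (\<sigma> j (t j)) = \<zero>\<^bsub>R\<^esub>"
  proof -
    have "regular_element R (t i)"
      using regular by (simp add: regular_datum_def)
    moreover have "\<sigma>_inv i (\<sigma> j (t j)) \<in> carrier R"
      by (intro \<sigma>_inv_closed \<sigma>_closed t_closed)
    ultimately show ?thesis
      using \<open>s = \<zero>\<^bsub>R\<^esub>\<close> unfolding regular_element_def s_def by blast
  qed
  then have "\<sigma> j (t j) = \<sigma> i \<zero>\<^bsub>R\<^esub>"
    using \<sigma>_\<sigma>_inv[OF \<sigma>_closed[OF t_closed], of i j j] by simp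
  moreover have \<sigma>_zero: "\<sigma> l \<zero>\<^bsub>R\<^esub> = \<zero>\<^bsub>R\<^esub>" for l
    using \<sigma>_ring_iso[of l] by (intro ring_hom_zero R.ring_axioms) (simp add: ring_iso_def)
  ultimately have "\<sigma> j (t j) = \<sigma> j \<zero>\<^bsub>R\<^esub>"
    by simp
  then have "t j \<otimes>\<^bsub>R\<^esub> \<one>\<^bsub>R\<^esub> = \<zero>\<^bsub>R\<^esub>"
    using \<sigma>_bij[of j] t_closed by (auto simp: bij_betw_def inj_on_eq_iff)
  moreover have "t j \<otimes>\<^bsub>R\<^esub> \<one>\<^bsub>R\<^esub> = \<zero>\<^bsub>R\<^esub> \<longrightarrow> \<one>\<^bsub>R\<^esub> = \<zero>\<^bsub>R\<^esub>"
    using regular R.one_closed unfolding regular_datum_def regular_element_def by blast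
  ultimately show False
    using nontrivial by blast
qed

end


section \<open>Twists and the products of opposite parameters\<close>

theorem corollary4p6:
  fixes R :: "('k::field, 'r) module"
    and \<sigma> :: "'n::finite \<Rightarrow> 'r \<Rightarrow> 'r"
    and t :: "'n \<Rightarrow> 'r"
    and \<mu> \<nu> :: "'k ^ 'n ^ 'n"
  assumes datum: "tgw_datum R \<sigma> t"
    and nontrivial: "\<one>\<^bsub>R\<^esub> \<noteq> \<zero>\<^bsub>R\<^esub>"
    and mu_nonzero: "\<forall>i j. \<mu> $ i $ j \<noteq> 0"
    and nu_nonzero: "\<forall>i j. \<nu> $ i $ j \<noteq> 0"
    and regular: "regular_datum R t"
    and consistent: "consistent_datum R \<sigma> t \<mu>"
  shows "((\<exists>\<xi>. admissible_twisting R \<sigma> t \<mu> \<xi> \<and>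
              graded_isomorphic (tgwc R \<sigma> t \<nu>) (tgwc_part R \<sigma> t \<nu>)
                (twisted_tgwc R \<sigma> t \<mu> \<xi>) (tgwc_part R \<sigma> t \<mu>))
          \<longleftrightarrow> (\<forall>i j. i \<noteq> j \<longrightarrow> \<nu> $ i $ j * \<nu> $ j $ i = \<mu> $ i $ j * \<mu> $ j $ i))
       \<and> ((\<exists>\<xi>. admissible_twisting R \<sigma> t \<mu> \<xi> \<and>
              graded_isomorphic (tgwa R \<sigma> t \<nu>) (tgwa_part R \<sigma> t \<nu>)
                (twisted_tgwa R \<sigma> t \<mu> \<xi>) (tgwa_part R \<sigma> t \<mu>))
          \<longleftrightarrow> (\<forall>i j. i \<noteq> j \<longrightarrow> \<nu> $ i $ j * \<nu> $ j $ i = \<mu> $ i $ j * \<mu> $ j $ i))"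
    (is "(?C \<longleftrightarrow> ?E) \<and> (?A \<longleftrightarrow> ?E)")
proof -
  interpret twisted_weyl_datum R \<sigma> t
    by unfold_locales (rule datum)
  have admissible: "\<xi> \<alpha> \<in> graded_iso (tgwc R \<sigma> t \<mu>) (tgwc_part R \<sigma> t \<mu>)
      (tgwc R \<sigma> t \<mu>) (tgwc_part R \<sigma> t \<mu>)" if "admissible_twisting R \<sigma> t \<mu> \<xi>" for \<xi> \<alpha>
    using that by (simp add: admissible_twisting_def Let_def)
  have "?E \<Longrightarrow> ?C"
    by (rule twisted_iso_exists) (simp_all add: mu_nonzero nu_nonzero)
  moreover have "?C \<Longrightarrow> ?A"
    using tgwa_twisted_iso[OF admissible] unfolding graded_isomorphic_def by fast
  moreover have "?A \<Longrightarrow> ?E"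
  proof (intro allI impI)
    fix i j :: 'n assume "?A" "i \<noteq> j"
    then obtain \<xi> h where \<xi>: "admissible_twisting R \<sigma> t \<mu> \<xi>"
      and h: "h \<in> graded_iso (tgwa R \<sigma> t \<nu>) (tgwa_part R \<sigma> t \<nu>)
        (twisted_tgwa R \<sigma> t \<mu> \<xi>) (tgwa_part R \<sigma> t \<mu>)"
      unfolding graded_isomorphic_def by blast
    show "\<nu> $ i $ j * \<nu> $ j $ i = \<mu> $ i $ j * \<mu> $ j $ i"
      by (rule products_agree_if_twisted_iso[OF nontrivial _ _ regular consistent
            descended_graded_iso[where \<xi> = \<xi>, OF admissible[OF \<xi>]] h[unfolded twisted_tgwa_def] \<open>i \<noteq> j\<close>])
        (simp_all add: mu_nonzero nu_nonzero)
  qed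
  ultimately show ?thesis
    by blast
qed

end
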